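(* If $Z\subset\mathbb{P}^1\times\mathbb{P}^1$ is a zero-dimensional subscheme and $I$ is the corresponding $B$-saturated $S$-ideal, then there exists an ideal $Q$ whose radical is $\langle x_{1,0},x_{1,1}\rangle$ such that (i) the algebra $S/(I\cap Q)$ is Cohen–Macaulay, and (ii) there exists an $(m+1)\times m$ matrix over $S$ whose maximal minors generate $I\cap Q$.
   Context: Let $\Bbbk$ be a field. The Cox ring of $\mathbb{P}^1\times\mathbb{P}^1$ over $\Bbbk$ is $S=\Bbbk[x_{1,0},x_{1,1},x_{2,0},x_{2,1}]$ with the $\mathbb{Z}^2$-grading $\deg(x_{i,j})=\mathbf{e}_i$, and its irrelevant ideal is $B=\langle x_{1,0},x_{1,1}\rangle\cap\langle x_{2,0},x_{2,1}\rangle$. The $B$-saturated ideal of a closed subscheme $Z$ is the unique homogeneous ideal $I$ with $(I:B^\infty)=I$ whose associated sheaf is the ideal sheaf $\mathcal{I}_Z$. *)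

theory Defs
  imports
    "HOL-Algebra.Algebra"
    "HOL-Algebra.Algebraic_Closure_Type"
    "HOL-Library.Poly_Mapping"
    "HOL-Library.Extended_Nat"
    "HOL-Library.Extended_Real"
    "Jordan_Normal_Form.Determinant"
    "Jordan_Normal_Form.DL_Submatrix"
begin

section \<open>Commutative algebra\<close>

definition radical_of :: "('a, 'b) ring_scheme \<Rightarrow> 'a set \<Rightarrow> 'a set" where
  "radical_of R J = {f \<in> carrier R. \<exists>n::nat. f [^]\<^bsub>R\<^esub> n \<in> J}"

text \<open>The saturation \<open>(J : B\<^sup>\<infinity>) = (\<Union>n. (J : B\<^sup>n))\<close>; powers of \<open>B\<close> are powers in the monoid
  of ideals of \<open>R\<close>, so \<open>B\<^sup>0 = R\<close>.\<close>

definition saturation :: "('a, 'b) ring_scheme \<Rightarrow> 'a set \<Rightarrow> 'a set \<Rightarrow> 'a set" where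
  "saturation R J B =
     {f \<in> carrier R. \<exists>n::nat. \<forall>g \<in> B [^]\<^bsub>ideals_set R\<^esub> n. f \<otimes>\<^bsub>R\<^esub> g \<in> J}"

text \<open>A chain \<open>P\<^sub>0 \<subset> \<dots> \<subset> P\<^sub>n\<close> of primes is a list of length \<open>n + 1\<close>; its length as a chain is \<open>n\<close>.\<close>

definition prime_chain :: "('a, 'b) ring_scheme \<Rightarrow> 'a set list \<Rightarrow> bool" where
  "prime_chain R Ps \<longleftrightarrow>
     Ps \<noteq> [] \<and> (\<forall>P \<in> set Ps. primeideal P R) \<and> successively (\<subset>) Ps"

text \<open>The zero ring has no primes, hence dimension \<open>Sup {} = -\<infinity>\<close>.\<close>

definition krull_dim :: "('a, 'b) ring_scheme \<Rightarrow> ereal" where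
  "krull_dim R = Sup {ereal (real (length Ps - 1)) | Ps. prime_chain R Ps}"

definition height :: "('a, 'b) ring_scheme \<Rightarrow> 'a set \<Rightarrow> enat" where
  "height R P = Sup {enat (length Ps - 1) | Ps. prime_chain R Ps \<and> last Ps = P}"

definition regular_sequence :: "('a, 'b) ring_scheme \<Rightarrow> 'a list \<Rightarrow> bool" where
  "regular_sequence R xs \<longleftrightarrow>
     set xs \<subseteq> carrier R \<and> Idl\<^bsub>R\<^esub> (set xs) \<noteq> carrier R \<and>
     (\<forall>i < length xs. \<forall>a \<in> carrier R.
        xs ! i \<otimes>\<^bsub>R\<^esub> a \<in> Idl\<^bsub>R\<^esub> (set (take i xs)) \<longrightarrow> a \<in> Idl\<^bsub>R\<^esub> (set (take i xs)))"

definition depth :: "('a, 'b) ring_scheme \<Rightarrow> 'a set \<Rightarrow> enat" where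
  "depth R J = Sup {enat (length xs) | xs. regular_sequence R xs \<and> set xs \<subseteq> J}"

text \<open>The definition of Eisenbud, Commutative Algebra, Section 18.2: a Noetherian ring is
  Cohen--Macaulay if every maximal ideal \<open>P\<close> satisfies depth \<open>P\<close> = codim \<open>P\<close>, where the depth of
  \<open>P\<close> is the length of a maximal \<open>R\<close>-regular sequence in \<open>P\<close>.\<close>

definition cohen_macaulay :: "('a, 'b) ring_scheme \<Rightarrow> bool" where
  "cohen_macaulay R \<longleftrightarrow>
     cring R \<and> noetherian_ring R \<and> (\<forall>P. maximalideal P R \<longrightarrow> depth R P = height R P)"

definition minors :: "nat \<Rightarrow> 'a::comm_ring_1 mat \<Rightarrow> 'a set" where
  "minors r M = {det (submatrix M K L) | K L.
     K \<subseteq> {..<dim_row M} \<and> L \<subseteq> {..<dim_col M} \<and> card K = r \<and> card L = r}"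


section \<open>The Cox ring of \<open>\<P>\<^sup>1 \<times> \<P>\<^sup>1\<close>\<close>

text \<open>\<open>Xij\<close> stands for the variable \<open>x\<^sub>i\<^sub>,\<^sub>j\<close>.\<close>

datatype cox_var = X10 | X11 | X20 | X21

type_synonym 'k cox = "(cox_var \<Rightarrow>\<^sub>0 nat) \<Rightarrow>\<^sub>0 'k"

abbreviation cox_ring :: "'k::field cox ring" where
  "cox_ring \<equiv> ring_of_type_algebra"

definition cox_gen :: "cox_var \<Rightarrow> 'k::field cox" where
  "cox_gen v = Poly_Mapping.single (Poly_Mapping.single v 1) 1"

definition bidegree :: "(cox_var \<Rightarrow>\<^sub>0 'n::comm_monoid_add) \<Rightarrow> 'n \<times> 'n" where
  "bidegree e =
     (Poly_Mapping.lookup e X10 + Poly_Mapping.lookup e X11,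
      Poly_Mapping.lookup e X20 + Poly_Mapping.lookup e X21)"

definition bihom_component :: "nat \<times> nat \<Rightarrow> 'k::field cox \<Rightarrow> 'k cox" where
  "bihom_component d f =
     (\<Sum>e \<in> {e \<in> Poly_Mapping.keys f. bidegree e = d}.
        Poly_Mapping.single e (Poly_Mapping.lookup f e))"

definition homogeneous_ideal :: "'k::field cox set \<Rightarrow> bool" where
  "homogeneous_ideal J \<longleftrightarrow> ideal J cox_ring \<and> (\<forall>f \<in> J. \<forall>d. bihom_component d f \<in> J)"

definition irrelevant_ideal :: "'k::field cox set" where
  "irrelevant_ideal =
     Idl\<^bsub>cox_ring\<^esub> {cox_gen X10, cox_gen X11} \<inter> Idl\<^bsub>cox_ring\<^esub> {cox_gen X20, cox_gen X21}"


section \<open>Closed subschemes of \<open>\<P>\<^sup>1 \<times> \<P>\<^sup>1\<close>\<close>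

text \<open>
  For a set \<open>D\<close> of variables let \<open>x\<^sup>D\<close> be their product.  If \<open>D\<close> meets both \<open>{x\<^sub>1\<^sub>,\<^sub>0, x\<^sub>1\<^sub>,\<^sub>1}\<close> and
  \<open>{x\<^sub>2\<^sub>,\<^sub>0, x\<^sub>2\<^sub>,\<^sub>1}\<close>, the open set \<open>U\<^sub>D = {x\<^sup>D \<noteq> 0}\<close> is affine with coordinate ring
  \<open>(S[1/x\<^sup>D])\<^sub>0\<close>, the part of bidegree \<open>(0,0)\<close>.  All these rings are subrings of the ring of
  Laurent polynomials in the four variables.  The four standard charts are the \<open>U\<^sub>D\<close> with \<open>D\<close>
  consisting of one variable of each kind, and the intersection of the open sets of \<open>D\<close> and \<open>E\<close>
  is that of \<open>D \<union> E\<close>.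
\<close>

type_synonym 'k laurent = "(cox_var \<Rightarrow>\<^sub>0 int) \<Rightarrow>\<^sub>0 'k"

definition laurent_of :: "'k::field cox \<Rightarrow> 'k laurent" where
  "laurent_of f =
     (\<Sum>e \<in> Poly_Mapping.keys f.
        Poly_Mapping.single (Poly_Mapping.map int e) (Poly_Mapping.lookup f e))"

definition coord_ring :: "cox_var set \<Rightarrow> 'k::field laurent ring" where
  "coord_ring D = ring_of_type_algebra
     \<lparr>carrier := {f. \<forall>e \<in> Poly_Mapping.keys f.
        bidegree e = (0, 0) \<and> (\<forall>v. v \<notin> D \<longrightarrow> 0 \<le> Poly_Mapping.lookup e v)}\<rparr>"

definition charts :: "cox_var set set" where
  "charts = {{u, v} | u v. u \<in> {X10, X11} \<and> v \<in> {X20, X21}}"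

text \<open>A closed subscheme \<open>Z\<close> is given by its quasi-coherent ideal sheaf: an ideal \<open>Z D\<close> of the
  coordinate ring of each standard chart such that the ideals of any two charts generate the same
  ideal on the intersection of these charts.\<close>

definition closed_subscheme :: "(cox_var set \<Rightarrow> 'k::field laurent set) \<Rightarrow> bool" where
  "closed_subscheme Z \<longleftrightarrow>
     (\<forall>D \<in> charts. ideal (Z D) (coord_ring D)) \<and>
     (\<forall>D \<in> charts. \<forall>E \<in> charts.
        Idl\<^bsub>coord_ring (D \<union> E)\<^esub> (Z D) = Idl\<^bsub>coord_ring (D \<union> E)\<^esub> (Z E))"

text \<open>The dimension of \<open>Z\<close> is the supremum of those of its affine open pieces \<open>Z \<inter> U\<^sub>D\<close>; the empty
  scheme has dimension \<open>-\<infinity>\<close>.\<close>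

definition subscheme_dim :: "(cox_var set \<Rightarrow> 'k::field laurent set) \<Rightarrow> ereal" where
  "subscheme_dim Z = (SUP D \<in> charts. krull_dim (coord_ring D Quot Z D))"

text \<open>The sections over \<open>U\<^sub>D\<close> of the sheaf associated with a homogeneous ideal \<open>J\<close>, namely
  \<open>(J[1/x\<^sup>D])\<^sub>0\<close>.\<close>

definition associated_sheaf :: "'k::field cox set \<Rightarrow> cox_var set \<Rightarrow> 'k laurent set" where
  "associated_sheaf J D = {f \<in> carrier (coord_ring D).
     \<exists>n. laurent_of (\<Prod>v \<in> D. cox_gen v) ^ n * f \<in> laurent_of ` J}"

definition is_saturated_ideal_of ::
    "'k::field cox set \<Rightarrow> (cox_var set \<Rightarrow> 'k laurent set) \<Rightarrow> bool" where
  "is_saturated_ideal_of J Z \<longleftrightarrow>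
     homogeneous_ideal J \<and>
     saturation cox_ring J irrelevant_ideal = J \<and>
     (\<forall>D \<in> charts. associated_sheaf J D = Z D)"

end

theory Submission
  imports Defs "Jordan_Normal_Form.Char_Poly"
begin

text \<open>
  Write \<open>x\<^sub>0, x\<^sub>1, y\<^sub>0, y\<^sub>1\<close> for the variables \<open>X10, X11, X20, X21\<close> and \<open>(x)\<close> for the ideal of
  the first two. The ideal \<open>Q\<close> is a power \<open>(x)\<^sup>a\<close> with a large exponent, so that \<open>I \<inter> Q\<close> is the
  part of \<open>I\<close> of degree at least \<open>a\<close> in \<open>x\<^sub>0, x\<^sub>1\<close>. The field may be finite, so that there need
  not be sufficiently general linear forms; forms of higher degree take their place.

  A subscheme of dimension \<open>0\<close> has finite projections to both factors. On a chart this says that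
  each coordinate satisfies a polynomial equation (\<open>chart_equation\<close>): otherwise some prime
  containing the ideal of the subscheme would contract to \<open>0\<close> in \<open>k[T]\<close>, but this prime is
  maximal, and maximal ideals of finitely generated algebras contract to nonzero ideals of
  \<open>k[T]\<close>. The latter is the Nullstellensatz for arbitrary fields, which follows from the
  contraction theorem for Goldman ideals (\<open>goldman_contraction\<close>). Homogenizing and saturating
  gives \<open>F = y\<^sub>0\<^sup>b F'(y\<^sub>0, y\<^sub>1)\<close> and \<open>G = x\<^sub>0\<^sup>c G'(x\<^sub>0, x\<^sub>1)\<close> in \<open>I\<close> (\<open>zero_dimensional_forms\<close>),
  where \<open>F'\<close> and \<open>G'\<close> do not vanish at \<open>y\<^sub>0 = 0\<close> and \<open>x\<^sub>0 = 0\<close>. Then \<open>l = y\<^sub>0\<^sup>d + F'\<close> has no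
  zero in common with \<open>F\<close>, and \<open>g = x\<^sub>0\<^sup>e + G'\<close> none with \<open>G\<close>. Hence \<open>l\<close> and \<open>g\<close> are
  nonzerodivisors modulo the saturated ideal \<open>I\<close>, and multiplication by \<open>g\<close> is bijective between
  the parts of \<open>S / I\<close> of large degrees in \<open>x\<close>.

  For large \<open>a\<close> this makes \<open>l, g + F\<close> a regular pair modulo \<open>I \<inter> Q\<close> (\<open>parameters_regular\<close>). Both
  elements are homogeneous for a suitable positive weight. Therefore \<open>p(l), q(g + F)\<close> is a
  regular pair for all monic polynomials \<open>p\<close> and \<open>q\<close> (\<open>regular_pair_eval_poly\<close>), and by the
  Nullstellensatz every maximal ideal contains such a pair, so its depth is at least \<open>2\<close>. Its
  height is at most \<open>2\<close>: the quotient by \<open>l\<close> and \<open>g + F\<close> has finite dimension, which bounds the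
  growth of the graded pieces (\<open>no_prime_chain_of_length_three\<close>). As depth never exceeds height,
  \<open>S / (I \<inter> Q)\<close> is Cohen--Macaulay.

  For the matrix, let \<open>I\<^sub>i\<close> be the part of \<open>I\<close> of degree \<open>i\<close> in \<open>x\<close>. It is a free \<open>k[y\<^sub>0,
  y\<^sub>1]\<close>-module, by saturation with respect to \<open>(y\<^sub>0, y\<^sub>1)\<close> (\<open>minimal_generators_independent\<close>),
  and its rank is \<open>i + 1\<close>, as it contains \<open>F S\<^sub>i\<close> (\<open>basis_exists\<close>). If \<open>w\<close> belongs to a basis of
  \<open>I\<^bsub>a-1\<^esub>\<close>, express \<open>x\<^sub>0 w\<close> and \<open>x\<^sub>1 w\<close> by a basis of \<open>I\<^sub>a\<close>; the identity \<open>x\<^sub>0 (x\<^sub>1 w) - x\<^sub>1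
  (x\<^sub>0 w) = 0\<close> becomes a syzygy of the latter. The resulting \<open>a\<close> syzygies of \<open>a + 1\<close> elements
  are the columns of the matrix. By Cramer's rule (\<open>syzygy_minors\<close>) its maximal minors are, up
  to sign, the basis elements of \<open>I\<^sub>a\<close> times a quotient of two determinants, which are the
  coefficient determinants of the bases of \<open>I\<^bsub>a-1\<^esub>\<close> and \<open>I\<^sub>a\<close>. Because \<open>G \<in> I\<close>, these
  determinants form a chain of divisors (\<open>det_C_dvd\<close>), which becomes stationary. So for large
  \<open>a\<close> the minors generate the same ideal as \<open>I\<^sub>a\<close>, which is \<open>I \<inter> Q\<close> because \<open>I\<close> is generated in
  bounded degrees.
\<close>


section \<open>Ideals of a commutative ring\<close>

abbreviation type_ring :: "'a::comm_ring_1 ring" where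
  "type_ring \<equiv> ring_of_type_algebra"

lemma type_ring_simps [simp]:
  "carrier (type_ring :: 'a::comm_ring_1 ring) = UNIV"
  "x \<otimes>\<^bsub>type_ring\<^esub> y = x * y" "x \<oplus>\<^bsub>type_ring\<^esub> y = x + y"
  "\<zero>\<^bsub>type_ring\<^esub> = (0 :: 'a)" "\<one>\<^bsub>type_ring\<^esub> = (1 :: 'a)"
  by (simp_all add: ring_of_type_algebra_def)

lemma type_ring_cring [simp]: "cring (type_ring :: 'a::comm_ring_1 ring)"
  by (rule cring_from_type_algebra)

lemma type_ring_ring [simp]: "ring (type_ring :: 'a::comm_ring_1 ring)"
  by (rule ring_from_type_algebra)

lemma type_ring_a_inv [simp]: "\<ominus>\<^bsub>type_ring\<^esub> x = - (x :: 'a::comm_ring_1)"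
proof -
  interpret cring "type_ring :: 'a ring" by simp
  show ?thesis by (rule minus_equality) auto
qed

lemma type_ring_pow [simp]: "x [^]\<^bsub>type_ring\<^esub> (n::nat) = (x :: 'a::comm_ring_1) ^ n"
proof -
  interpret cring "type_ring :: 'a ring" by simp
  show ?thesis by (induction n) (auto simp: mult.commute)
qed

lemma type_ideal_iff:
  "ideal J (type_ring :: 'a::comm_ring_1 ring) \<longleftrightarrow>
     0 \<in> J \<and> (\<forall>a\<in>J. \<forall>b\<in>J. a + b \<in> J) \<and> (\<forall>a\<in>J. \<forall>r. r * a \<in> J)"
proof
  assume "ideal J (type_ring :: 'a ring)"
  then interpret I: ideal J "type_ring :: 'a ring" .
  show "0 \<in> J \<and> (\<forall>a\<in>J. \<forall>b\<in>J. a + b \<in> J) \<and> (\<forall>a\<in>J. \<forall>r. r * a \<in> J)"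
    using additive_subgroup.zero_closed[OF I.additive_subgroup_axioms]
      additive_subgroup.a_closed[OF I.additive_subgroup_axioms] I.I_l_closed by auto
next
  assume *: "0 \<in> J \<and> (\<forall>a\<in>J. \<forall>b\<in>J. a + b \<in> J) \<and> (\<forall>a\<in>J. \<forall>r. r * a \<in> J)"
  interpret cring "type_ring :: 'a ring" by simp
  have neg: "- a \<in> J" if "a \<in> J" for a
    using * that by (metis mult_minus1)
  show "ideal J (type_ring :: 'a ring)"
  proof (rule idealI)
    show "ring (type_ring :: 'a ring)" by simp
    show "subgroup J (add_monoid (type_ring :: 'a ring))"
      by (rule add.subgroupI) (use * neg in \<open>auto simp: a_inv_def[symmetric]\<close>)
  qed (use * in \<open>auto simp: mult.commute\<close>)
qed

lemma type_idealI:
  assumes "0 \<in> J" "\<And>a b. a \<in> J \<Longrightarrow> b \<in> J \<Longrightarrow> a + b \<in> J" "\<And>a r. a \<in> J \<Longrightarrow> r * a \<in> J"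
  shows "ideal J (type_ring :: 'a::comm_ring_1 ring)"
  using assms by (auto simp: type_ideal_iff)

context
  fixes J :: "'a::comm_ring_1 set"
  assumes J: "ideal J type_ring"
begin

lemma type_ideal_zero: "0 \<in> J"
  and type_ideal_add: "a \<in> J \<Longrightarrow> b \<in> J \<Longrightarrow> a + b \<in> J"
  and type_ideal_mult: "a \<in> J \<Longrightarrow> r * a \<in> J"
  using J by (auto simp: type_ideal_iff)

lemma type_ideal_mult_right: "a \<in> J \<Longrightarrow> a * r \<in> J"
  using type_ideal_mult by (simp add: mult.commute)

lemma type_ideal_uminus: "a \<in> J \<Longrightarrow> - a \<in> J"
  using type_ideal_mult[of a "-1"] by simp

lemma type_ideal_diff: "a \<in> J \<Longrightarrow> b \<in> J \<Longrightarrow> a - b \<in> J"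
  using type_ideal_add[OF _ type_ideal_uminus, of a b] by simp

lemma type_ideal_sum: "(\<And>i. i \<in> A \<Longrightarrow> f i \<in> J) \<Longrightarrow> sum f A \<in> J"
  by (induction A rule: infinite_finite_induct) (auto intro: type_ideal_zero type_ideal_add)

lemma type_ideal_cong: "a - b \<in> J \<Longrightarrow> a \<in> J \<longleftrightarrow> b \<in> J"
  using type_ideal_add[of "a - b" b] type_ideal_diff[of a "a - b"] by auto

end

lemma type_primeideal_iff:
  "primeideal P (type_ring :: 'a::comm_ring_1 ring) \<longleftrightarrow>
     ideal P type_ring \<and> 1 \<notin> P \<and> (\<forall>a b. a * b \<in> P \<longrightarrow> a \<in> P \<or> b \<in> P)"
proof
  assume "primeideal P (type_ring :: 'a ring)"
  then interpret primeideal P "type_ring :: 'a ring" .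
  show "ideal P (type_ring :: 'a ring) \<and> 1 \<notin> P \<and> (\<forall>a b. a * b \<in> P \<longrightarrow> a \<in> P \<or> b \<in> P)"
    using is_ideal one_imp_carrier I_notcarr I_prime by auto
next
  assume *: "ideal P (type_ring :: 'a ring) \<and> 1 \<notin> P \<and> (\<forall>a b. a * b \<in> P \<longrightarrow> a \<in> P \<or> b \<in> P)"
  show "primeideal P (type_ring :: 'a ring)"
    by (rule primeidealI) (use * in auto)
qed

lemma type_prime_power:
  assumes "primeideal P (type_ring :: 'a::comm_ring_1 ring)" "a ^ n \<in> P"
  shows "a \<in> P"
  using assms by (induction n) (auto simp: type_primeideal_iff)

lemma type_ideal_plus_principal:
  assumes "ideal J (type_ring :: 'a::comm_ring_1 ring)"
  shows "ideal {j + r * a |j r. j \<in> J} type_ring"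
proof (rule type_idealI)
  show "0 \<in> {j + r * a |j r. j \<in> J}"
    using type_ideal_zero[OF assms] by (auto intro!: exI[of _ 0])
next
  fix x y assume "x \<in> {j + r * a |j r. j \<in> J}" "y \<in> {j + r * a |j r. j \<in> J}"
  then obtain i j r s where "x = i + r * a" "y = j + s * a" "i \<in> J" "j \<in> J" by blast
  then have "x + y = (i + j) + (r + s) * a" "i + j \<in> J"
    using type_ideal_add[OF assms] by (auto simp: algebra_simps)
  then show "x + y \<in> {j + r * a |j r. j \<in> J}" by blast
next
  fix x c assume "x \<in> {j + r * a |j r. j \<in> J}"
  then obtain j r where "x = j + r * a" "j \<in> J" by blast
  then have "c * x = c * j + (c * r) * a" "c * j \<in> J"
    using type_ideal_mult[OF assms] by (simp_all add: distrib_left mult.assoc)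
  then show "c * x \<in> {j + r * a |j r. j \<in> J}" by blast
qed

lemma type_maximal_inverse:
  assumes "maximalideal P (type_ring :: 'a::comm_ring_1 ring)" "a \<notin> P"
  obtains r where "1 - r * a \<in> P"
proof -
  interpret m: maximalideal P "type_ring :: 'a ring" by fact
  let ?K = "{j + r * a |j r. j \<in> P}"
  have K: "ideal ?K type_ring" by (rule type_ideal_plus_principal[OF m.is_ideal])
  have "P \<subseteq> ?K"
  proof
    fix x assume "x \<in> P"
    then have "x = x + 0 * a" "x \<in> P" by simp_all
    then show "x \<in> ?K" by blast
  qed
  moreover have "a = 0 + 1 * a" "0 \<in> P" using type_ideal_zero[OF m.is_ideal] by simp_all
  then have "a \<in> ?K" by blast
  ultimately have "?K = UNIV" using m.I_maximal[OF K] assms(2) by auto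
  then obtain j r where "1 = j + r * a" "j \<in> P" by blast
  then have "1 - r * a \<in> P" by (metis add_diff_cancel_right')
  then show ?thesis by (rule that)
qed

lemma type_maximal_imp_prime:
  assumes "maximalideal P (type_ring :: 'a::comm_ring_1 ring)"
  shows "primeideal P (type_ring :: 'a ring)"
  using cring.maximalideal_prime[OF type_ring_cring assms] .

lemma genideal_mono_type:
  "ideal J (type_ring :: 'a::comm_ring_1 ring) \<Longrightarrow> A \<subseteq> J \<Longrightarrow> Idl\<^bsub>type_ring\<^esub> A \<subseteq> J"
  using ring.genideal_minimal[OF type_ring_ring] by blast

lemma genideal_type_ideal: "ideal (Idl\<^bsub>type_ring\<^esub> A) (type_ring :: 'a::comm_ring_1 ring)"
  by (rule ring.genideal_ideal) auto

lemma genideal_type_self: "A \<subseteq> Idl\<^bsub>type_ring\<^esub> (A :: 'a::comm_ring_1 set)"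
  by (rule ring.genideal_self) auto


section \<open>Prime ideals avoiding a multiplicative set\<close>

text \<open>Zorn's lemma provides an ideal \<open>P\<close> that is maximal among the ideals containing \<open>J\<close> and
  disjoint from \<open>M\<close>. For elements \<open>a\<close> and \<open>b\<close> outside \<open>P\<close>, both \<open>P + (a)\<close> and \<open>P + (b)\<close> meet
  \<open>M\<close>, so their product meets \<open>M\<close> as well and \<open>a b\<close> is not in \<open>P\<close>.\<close>

lemma (in cring) exists_prime_avoiding:
  assumes J: "ideal J R" and M: "M \<subseteq> carrier R" "\<one> \<in> M"
    and mult: "\<And>a b. a \<in> M \<Longrightarrow> b \<in> M \<Longrightarrow> a \<otimes> b \<in> M"
    and disj: "J \<inter> M = {}"
  shows "\<exists>P. primeideal P R \<and> J \<subseteq> P \<and> P \<inter> M = {}"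
proof -
  define \<A> where "\<A> = {K. ideal K R \<and> J \<subseteq> K \<and> K \<inter> M = {}}"
  have "\<exists>U\<in>\<A>. \<forall>K\<in>\<A>. U \<subseteq> K \<longrightarrow> K = U"
  proof (rule subset_Zorn_nonempty)
    show "\<A> \<noteq> {}" using J disj by (auto simp: \<A>_def)
  next
    fix C assume C: "C \<noteq> {}" "subset.chain \<A> C"
    have "subset.chain {I. ideal I R} C"
      using C by (auto simp: subset_chain_def \<A>_def)
    then have "ideal (\<Union>C) R" using chain_Union_is_ideal C(1) by presburger
    moreover have "J \<subseteq> \<Union>C" "\<Union>C \<inter> M = {}"
      using C unfolding subset_chain_def \<A>_def by blast+
    ultimately show "\<Union>C \<in> \<A>" by (simp add: \<A>_def)
  qed
  then obtain P where P: "ideal P R" "J \<subseteq> P" "P \<inter> M = {}"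
    and max: "\<And>K. ideal K R \<Longrightarrow> P \<subset> K \<Longrightarrow> K \<inter> M \<noteq> {}"
    by (auto simp: \<A>_def) (metis order.trans psubset_imp_subset psubset_eq)
  interpret P: ideal P R by fact
  have ex: "\<exists>p\<in>P. \<exists>r\<in>carrier R. p \<oplus> r \<otimes> a \<in> M" if "a \<in> carrier R" "a \<notin> P" for a
  proof -
    have I: "ideal (P <+>\<^bsub>R\<^esub> PIdl a) R"
      using add_ideals[OF P(1) cgenideal_ideal] that by blast
    have "P \<subseteq> P <+>\<^bsub>R\<^esub> PIdl a" "a \<in> P <+>\<^bsub>R\<^esub> PIdl a"
    proof -
      have z: "\<zero> \<in> PIdl a" "a \<in> PIdl a"
        using that cgenideal_self cgenideal_ideal[OF that(1)]
        by (auto simp: additive_subgroup.zero_closed ideal_def)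
      show "P \<subseteq> P <+>\<^bsub>R\<^esub> PIdl a"
      proof
        fix x assume x: "x \<in> P"
        then have "x = x \<oplus> \<zero>" using P.a_Hcarr by simp
        then show "x \<in> P <+>\<^bsub>R\<^esub> PIdl a" using x z unfolding set_add_def' by blast
      qed
      have "a = \<zero> \<oplus> a" using that by simp
      then show "a \<in> P <+>\<^bsub>R\<^esub> PIdl a" using z P.zero_closed unfolding set_add_def' by blast
    qed
    then have "P \<subset> P <+>\<^bsub>R\<^esub> PIdl a" using that by blast
    then obtain m where "m \<in> M" "m \<in> P <+>\<^bsub>R\<^esub> PIdl a" using max[OF I] by blast
    then show ?thesis by (auto simp: set_add_def' cgenideal_def)
  qed
  have "primeideal P R"
  proof (rule primeidealI)
    show "carrier R \<noteq> P" using P(3) M by blast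
  next
    fix a b assume ab: "a \<in> carrier R" "b \<in> carrier R" "a \<otimes> b \<in> P"
    show "a \<in> P \<or> b \<in> P"
    proof (rule ccontr)
      assume "\<not> (a \<in> P \<or> b \<in> P)"
      then obtain p r q s where *: "p \<in> P" "r \<in> carrier R" "p \<oplus> r \<otimes> a \<in> M"
          "q \<in> P" "s \<in> carrier R" "q \<oplus> s \<otimes> b \<in> M"
        using ex ab by meson
      have c: "p \<in> carrier R" "q \<in> carrier R" using * P.a_Hcarr by auto
      have "(p \<oplus> r \<otimes> a) \<otimes> (q \<oplus> s \<otimes> b) =
          p \<otimes> (q \<oplus> s \<otimes> b) \<oplus> ((r \<otimes> a) \<otimes> q \<oplus> (r \<otimes> s) \<otimes> (a \<otimes> b))"
        using * c ab by algebra
      also have "\<dots> \<in> P"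
        using P.I_r_closed[OF *(1), of "q \<oplus> s \<otimes> b"] P.I_l_closed[OF *(4), of "r \<otimes> a"]
          P.I_l_closed[OF ab(3), of "r \<otimes> s"] * c ab
        by (intro P.a_closed) auto
      finally show False using mult[OF *(3,6)] P(3) by blast
    qed
  qed (use P is_cring in auto)
  then show ?thesis using P by blast
qed

text \<open>The elements \<open>s x\<^sup>m\<close> with \<open>s \<notin> P\<close> form a multiplicative set, which avoids \<open>J\<close> because \<open>x\<close> is a
  nonzerodivisor modulo \<open>J\<close> and \<open>J \<subseteq> P\<close>. A prime that contains \<open>J\<close> and avoids this set lies in
  \<open>P\<close> and does not contain \<open>x\<close>.\<close>

lemma (in cring) smaller_prime:
  assumes P: "primeideal P R" and J: "ideal J R" "J \<subseteq> P" and x: "x \<in> P"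
    and nzd: "\<And>a. a \<in> carrier R \<Longrightarrow> x \<otimes> a \<in> J \<Longrightarrow> a \<in> J"
  shows "\<exists>P'. primeideal P' R \<and> J \<subseteq> P' \<and> P' \<subset> P"
proof -
  interpret P: primeideal P R by fact
  define M where "M = {s \<otimes> x [^] (m::nat) |s m. s \<in> carrier R - P}"
  have xc: "x \<in> carrier R" using x P.a_Hcarr by auto
  have pow: "a \<in> J" if "a \<in> carrier R" "a \<otimes> x [^] (m::nat) \<in> J" for a m
    using that(2)
  proof (induction m)
    case (Suc m)
    have "a \<otimes> x [^] Suc m = x \<otimes> (a \<otimes> x [^] m)" using that xc
      by (simp add: m_ac)
    then have "a \<otimes> x [^] m \<in> J"
      using nzd[of "a \<otimes> x [^] m"] Suc.prems that(1) xc by simp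
    then show ?case by (rule Suc.IH)
  qed (use that in simp)
  have one: "\<one> \<in> carrier R - P" using P.I_notcarr P.one_imp_carrier by auto
  have "\<exists>P'. primeideal P' R \<and> J \<subseteq> P' \<and> P' \<inter> M = {}"
  proof (rule exists_prime_avoiding[OF J(1)])
    show "M \<subseteq> carrier R" using xc by (auto simp: M_def)
    show "\<one> \<in> M" using one by (auto simp: M_def intro!: exI[of _ \<one>] exI[of _ "0::nat"])
    show "J \<inter> M = {}" using pow J(2) by (auto simp: M_def)
  next
    fix a b assume "a \<in> M" "b \<in> M"
    then obtain s t m n where *: "a = s \<otimes> x [^] (m::nat)" "b = t \<otimes> x [^] (n::nat)"
        "s \<in> carrier R - P" "t \<in> carrier R - P"
      by (auto simp: M_def)
    have "a \<otimes> b = (s \<otimes> t) \<otimes> x [^] (m + n)"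
      using * xc by (simp add: nat_pow_mult[symmetric] m_ac)
    moreover have "s \<otimes> t \<in> carrier R - P" using * P.I_prime by auto
    ultimately show "a \<otimes> b \<in> M" by (auto simp: M_def)
  qed
  then obtain P' where P': "primeideal P' R" "J \<subseteq> P'" "P' \<inter> M = {}" by blast
  interpret P': primeideal P' R by fact
  have "s \<in> P" if "s \<in> P'" for s
  proof (rule ccontr)
    assume "s \<notin> P"
    then have "s \<in> M" using that P'.a_Hcarr
      by (auto simp: M_def intro!: exI[of _ s] exI[of _ "0::nat"])
    then show False using P' that by blast
  qed
  moreover have "x \<notin> P'"
  proof -
    have "x \<in> M" using one xc by (auto simp: M_def intro!: exI[of _ \<one>] exI[of _ "1::nat"])
    then show ?thesis using P' by blast
  qed
  ultimately show ?thesis using P' x by blast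
qed

text \<open>Descend along the sequence: below a prime containing \<open>x\<^sub>1, \<dots>, x\<^sub>k\<close> there is a strictly smaller
  one containing \<open>x\<^sub>1, \<dots>, x\<^bsub>k-1\<^esub>\<close>.\<close>

lemma (in cring) regular_sequence_prime_chain:
  assumes xs: "regular_sequence R xs" and k: "k \<le> length xs"
  shows "primeideal P R \<Longrightarrow> set (take k xs) \<subseteq> P \<Longrightarrow>
    \<exists>Ps. prime_chain R Ps \<and> last Ps = P \<and> length Ps = k + 1"
  using k
proof (induction k arbitrary: P)
  case 0
  show ?case by (rule exI[of _ "[P]"]) (use 0 in \<open>simp add: prime_chain_def\<close>)
next
  case (Suc k)
  let ?J = "Idl (set (take k xs))"
  have set: "set (take k xs) \<subseteq> carrier R"
    using xs by (auto simp: regular_sequence_def dest: in_set_takeD)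
  have tk: "take (Suc k) xs = take k xs @ [xs ! k]" using Suc by (simp add: take_Suc_conv_app_nth)
  have P: "ideal P R" using Suc.prems(1) by (simp add: primeideal.axioms)
  have "\<exists>P'. primeideal P' R \<and> ?J \<subseteq> P' \<and> P' \<subset> P"
  proof (rule smaller_prime[OF Suc.prems(1)])
    show "ideal ?J R" using genideal_ideal[OF set] .
    show "?J \<subseteq> P" using genideal_minimal[OF P] Suc.prems tk by auto
    show "xs ! k \<in> P" using Suc.prems tk by auto
    show "a \<in> ?J" if "a \<in> carrier R" "xs ! k \<otimes> a \<in> ?J" for a
      using xs that Suc.prems(3) by (auto simp: regular_sequence_def)
  qed
  then obtain P' where P': "primeideal P' R" "?J \<subseteq> P'" "P' \<subset> P" by blast
  have "set (take k xs) \<subseteq> P'" using genideal_self[OF set] P' by blast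
  then obtain Ps where "prime_chain R Ps" "last Ps = P'" "length Ps = k + 1"
    using Suc.IH[OF P'(1)] Suc.prems by auto
  then have "prime_chain R (Ps @ [P])"
    using P' Suc.prems by (auto simp: prime_chain_def successively_append_iff)
  then show ?case using \<open>length Ps = k + 1\<close> by (intro exI[of _ "Ps @ [P]"]) auto
qed

lemma (in cring) depth_le_height:
  assumes "primeideal P R"
  shows "depth R P \<le> height R P"
proof -
  have "enat (length xs) \<le> height R P" if xs: "regular_sequence R xs" "set xs \<subseteq> P" for xs
  proof -
    obtain Ps where "prime_chain R Ps" "last Ps = P" "length Ps = length xs + 1"
      using regular_sequence_prime_chain[OF xs(1) le_refl assms] xs by auto
    then show ?thesis unfolding height_def
      by (intro Sup_upper) (auto intro!: exI[of _ Ps])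
  qed
  then show ?thesis unfolding depth_def by (auto intro!: Sup_least)
qed


section \<open>Goldman ideals and the weak Nullstellensatz\<close>

text \<open>In terms of the domain \<open>R / P\<close>: every nonzero element divides a power of \<open>u\<close>, so that
  inverting the single element \<open>u\<close> gives a field. Maximal ideals have this property with \<open>u =
  1\<close>; in contrast to maximality, it is inherited by contractions from \<open>R[X]\<close> to \<open>R\<close>.\<close>

definition goldman_ideal :: "'a::comm_ring_1 set \<Rightarrow> bool" where
  "goldman_ideal P \<longleftrightarrow> primeideal P type_ring \<and>
     (\<exists>u. u \<notin> P \<and> (\<forall>c. c \<notin> P \<longrightarrow> (\<exists>n h. u ^ n - h * c \<in> P)))"

lemma maximal_imp_goldman:
  assumes "maximalideal P (type_ring :: 'a::comm_ring_1 ring)"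
  shows "goldman_ideal P"
proof -
  have "primeideal P type_ring" by (rule type_maximal_imp_prime[OF assms])
  moreover have "\<exists>n h. 1 ^ n - h * c \<in> P" if "c \<notin> P" for c
    using type_maximal_inverse[OF assms that] by auto
  ultimately show ?thesis unfolding goldman_ideal_def by (auto simp: type_primeideal_iff)
qed

lemma top_coeff_outside:
  assumes "0 \<in> \<pp>" "\<exists>i. coeff (f :: 'a::comm_ring_1 poly) i \<notin> \<pp>"
  obtains e where "coeff f e \<notin> \<pp>" "\<And>i. i > e \<Longrightarrow> coeff f i \<in> \<pp>"
proof -
  let ?A = "{i. coeff f i \<notin> \<pp>}"
  have "finite ?A" using assms(1) by (intro finite_subset[of ?A "{..degree f}"]) (auto, metis coeff_eq_0 not_le)
  then have "Max ?A \<in> ?A" "\<And>i. i \<in> ?A \<Longrightarrow> i \<le> Max ?A" using assms(2) Max_in[of ?A] by auto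
  then show ?thesis using not_le by (intro that[of "Max ?A"]) blast+
qed

lemma ideal_const_monom:
  assumes K: "ideal K (type_ring :: 'a::comm_ring_1 poly ring)" and "[:c:] \<in> K"
  shows "monom c i \<in> K"
proof -
  have "monom c i = monom 1 i * [:c:]" by (simp add: smult_monom)
  then show ?thesis using type_ideal_mult[OF K assms(2)] by simp
qed

text \<open>The terms of \<open>f\<close> above the degree \<open>e\<close> have coefficients in \<open>\<pp>\<close> and hence lie in \<open>K\<close>, so they
  may be subtracted. This turns the leading coefficient of \<open>f\<close> modulo \<open>\<pp>\<close> into a genuine one.\<close>

lemma truncate_in_ideal:
  assumes K: "ideal K (type_ring :: 'a::comm_ring_1 poly ring)"
    and p: "0 \<in> \<pp>" "\<And>c. c \<in> \<pp> \<Longrightarrow> [:c:] \<in> K"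
    and f: "f \<in> K" and e: "coeff f e \<notin> \<pp>" "\<And>i. i > e \<Longrightarrow> coeff f i \<in> \<pp>"
  obtains g where "g \<in> K" "degree g = e" "lead_coeff g = coeff f e"
proof -
  define g where "g = f - (\<Sum>i\<in>{e<..degree f}. monom (coeff f i) i)"
  have "g \<in> K" unfolding g_def
    by (intro type_ideal_diff[OF K f] type_ideal_sum[OF K] ideal_const_monom[OF K] p(2) e(2)) auto
  have coeff: "coeff g j = (if j \<le> e then coeff f j else 0)" for j
  proof -
    have "coeff g j = coeff f j - (\<Sum>i\<in>{e<..degree f}. if i = j then coeff f i else 0)"
      by (simp add: g_def coeff_sum)
    also have "\<dots> = (if j \<le> e then coeff f j else 0)"
      by (auto simp: sum.delta coeff_eq_0)
    finally show ?thesis .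
  qed
  have "coeff f e \<noteq> 0" using e(1) p(1) by metis
  then have "degree g = e"
    by (intro antisym degree_le le_degree) (auto simp: coeff)
  then show ?thesis using \<open>g \<in> K\<close> coeff by (intro that) auto
qed

lemma coeff_mult_top:
  assumes p: "ideal \<pp> (type_ring :: 'a::comm_ring_1 ring)"
    and f: "\<And>i. i > d \<Longrightarrow> coeff f i \<in> \<pp>" and g: "\<And>i. i > e \<Longrightarrow> coeff g i \<in> \<pp>"
  shows "coeff (f * g) (d + e) - coeff f d * coeff g e \<in> \<pp>"
proof -
  have "coeff (f * g) (d + e) = coeff f d * coeff g e +
      (\<Sum>i\<in>{..d+e}-{d}. coeff f i * coeff g (d + e - i))"
    unfolding coeff_mult by (subst sum.remove[of _ d]) auto
  moreover have "(\<Sum>i\<in>{..d+e}-{d}. coeff f i * coeff g (d + e - i)) \<in> \<pp>"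
  proof (rule type_ideal_sum[OF p])
    fix i assume "i \<in> {..d+e}-{d}"
    then consider "i > d" | "d + e - i > e" by force
    then show "coeff f i * coeff g (d + e - i) \<in> \<pp>"
      using f g type_ideal_mult[OF p] type_ideal_mult_right[OF p] by cases auto
  qed
  ultimately show ?thesis by simp
qed

lemma coeff_mult_in_ideal:
  assumes p: "ideal \<pp> (type_ring :: 'a::comm_ring_1 ring)"
    and "\<And>i. coeff f i \<in> \<pp>"
  shows "coeff (g * f) n \<in> \<pp>"
  unfolding coeff_mult by (intro type_ideal_sum[OF p] type_ideal_mult[OF p] assms)

lemma pseudo_division:
  fixes f w :: "'a::comm_ring_1 poly"
  assumes "w \<noteq> 0"
  obtains N q r where "smult (lead_coeff w ^ N) f = w * q + r" "r = 0 \<or> degree r < degree w"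
  using pseudo_divmod[OF assms] by (metis prod.collapse)

lemma contracted_prime:
  assumes "primeideal P (type_ring :: 'a::comm_ring_1 poly ring)"
  shows "primeideal {a. [:a:] \<in> P} (type_ring :: 'a ring)"
proof -
  have P: "ideal P (type_ring :: 'a poly ring)" and one: "1 \<notin> P"
    and pr: "\<And>a b. a * b \<in> P \<Longrightarrow> a \<in> P \<or> b \<in> P"
    using assms by (auto simp: type_primeideal_iff)
  have id: "ideal {a. [:a:] \<in> P} type_ring"
  proof (rule type_idealI)
    show "a + b \<in> {a. [:a:] \<in> P}" if "a \<in> {a. [:a:] \<in> P}" "b \<in> {a. [:a:] \<in> P}" for a b
      using type_ideal_add[OF P, of "[:a:]" "[:b:]"] that by simp
    show "r * a \<in> {a. [:a:] \<in> P}" if "a \<in> {a. [:a:] \<in> P}" for a r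
      using type_ideal_mult[OF P, of "[:a:]" "[:r:]"] that by (simp add: mult.commute)
  qed (use type_ideal_zero[OF P] in simp)
  then show ?thesis using one pr[of "[:a:]" "[:b:]" for a b]
    by (auto simp: type_primeideal_iff one_pCons)
qed

text \<open>The hypothesis says that \<open>P = \<pp>[X]\<close> for a prime \<open>\<pp>\<close>. For a witness \<open>u\<close> of the Goldman
  property, the element \<open>c = 1 + X u\<close> would divide a power \<open>u\<^sup>n\<close> modulo \<open>P\<close>, and hence \<open>(X u)\<^sup>n
  = (c - 1)\<^sup>n\<close>, which is congruent to \<open>(-1)\<^sup>n\<close> modulo \<open>c\<close>. So \<open>c\<close> would be a unit modulo \<open>\<pp>[X]\<close>,
  although it is a polynomial of positive degree over the domain \<open>R / \<pp>\<close>.\<close>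

lemma goldman_not_extended:
  fixes P :: "'a::comm_ring_1 poly set"
  assumes G: "goldman_ideal P" and ext: "\<And>f i. f \<in> P \<Longrightarrow> [:coeff f i:] \<in> P"
  shows False
proof -
  define \<pp> where "\<pp> = {a. [:a:] \<in> P}"
  obtain u where prime: "primeideal P type_ring" and u: "u \<notin> P"
    and wit: "\<And>c. c \<notin> P \<Longrightarrow> \<exists>n h. u ^ n - h * c \<in> P"
    using G unfolding goldman_ideal_def by blast
  have P: "ideal P type_ring" and one: "1 \<notin> P" using prime by (auto simp: type_primeideal_iff)
  have pp: "primeideal \<pp> type_ring" unfolding \<pp>_def by (rule contracted_prime[OF prime])
  then have p: "ideal \<pp> type_ring" and ppr: "\<And>a b. a * b \<in> \<pp> \<Longrightarrow> a \<in> \<pp> \<or> b \<in> \<pp>"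
    by (auto simp: type_primeideal_iff)
  have inP: "f \<in> P" if "\<And>i. coeff f i \<in> \<pp>" for f
  proof -
    have "(\<Sum>i\<le>degree f. monom (coeff f i) i) \<in> P"
      using that by (intro type_ideal_sum[OF P] ideal_const_monom[OF P]) (auto simp: \<pp>_def)
    then show ?thesis by (simp add: poly_as_sum_of_monoms)
  qed
  have p0: "0 \<in> \<pp>" by (rule type_ideal_zero[OF p])
  obtain d where d: "coeff u d \<notin> \<pp>" "\<And>i. i > d \<Longrightarrow> coeff u i \<in> \<pp>"
    using top_coeff_outside[OF p0] inP u by metis
  define c where "c = 1 + pCons 0 u"
  have c_coeff: "coeff c (Suc i) = coeff u i" for i
    by (simp add: c_def)
  have c: "coeff c (Suc d) \<notin> \<pp>" "\<And>i. i > Suc d \<Longrightarrow> coeff c i \<in> \<pp>"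
    using d c_coeff by (auto elim!: Suc_lessE)
  then have "c \<notin> P" using ext \<pp>_def by blast
  then obtain n h where nh: "u ^ n - h * c \<in> P" using wit by blast
  have "\<exists>k. (pCons 0 u) ^ n = (-1) ^ n + k * c"
  proof (induction n)
    case (Suc n)
    then obtain k where k: "(pCons 0 u) ^ n = (-1) ^ n + k * c" by blast
    have X: "pCons 0 u = c - 1" by (simp add: c_def)
    have "(pCons 0 u) ^ Suc n = (c - 1) * ((-1) ^ n + k * c)" using k X by simp
    also have "\<dots> = (-1) ^ Suc n + ((-1) ^ n + k * c - k) * c" by (simp add: algebra_simps)
    finally show ?case by blast
  qed (auto intro: exI[of _ 0])
  then obtain k where k: "(pCons 0 u) ^ n = (-1) ^ n + k * c" by blast
  have "pCons 0 u = monom 1 1 * u" by (simp add: x_as_monom[symmetric] monom_altdef)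
  then have "monom 1 1 ^ n * (u ^ n - h * c) = (-1) ^ n - (monom 1 1 ^ n * h - k) * c"
    using k by (simp add: algebra_simps power_mult_distrib)
  moreover have "monom 1 1 ^ n * (u ^ n - h * c) \<in> P" by (rule type_ideal_mult[OF P nh])
  ultimately have "(-1) ^ n * ((-1) ^ n - (monom 1 1 ^ n * h - k) * c) \<in> P"
    using type_ideal_mult[OF P] by metis
  moreover have "(-1) ^ n * ((-1) ^ n - (monom 1 1 ^ n * h - k) * c) =
      1 - ((-1) ^ n * (monom 1 1 ^ n * h - k)) * c"
    by (simp add: algebra_simps flip: power_mult_distrib)
  ultimately obtain h' where h': "1 - h' * c \<in> P" by metis
  have "\<exists>i. coeff h' i \<notin> \<pp>"
  proof (rule ccontr)
    assume "\<not> ?thesis"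
    then have "h' \<in> P" using inP by blast
    then have "1 \<in> P" using type_ideal_add[OF P h' type_ideal_mult_right[OF P, of h' c]] by simp
    then show False using one by simp
  qed
  then obtain e where e: "coeff h' e \<notin> \<pp>" "\<And>i. i > e \<Longrightarrow> coeff h' i \<in> \<pp>"
    using top_coeff_outside[OF p0] by metis
  have "coeff (1 - h' * c) (e + Suc d) \<in> \<pp>" unfolding \<pp>_def by (rule CollectI) (rule ext[OF h'])
  then have "coeff (h' * c) (e + Suc d) \<in> \<pp>" using type_ideal_uminus[OF p] by force
  then have "coeff h' e * coeff c (Suc d) \<in> \<pp>"
    using coeff_mult_top[OF p e(2) c(2)] type_ideal_cong[OF p] by blast
  then show False using ppr e(1) c(1) by blast
qed

text \<open>Let \<open>f \<in> P\<close> have minimal degree \<open>n\<close> among the elements of \<open>P\<close> with leading coefficient outside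
  \<open>\<pp>\<close>; there are such elements because \<open>P\<close> is not extended from \<open>R\<close>. Let \<open>w\<close> be an element of \<open>P
  + (u)\<close> of minimal degree \<open>d\<close> with leading coefficient outside \<open>\<pp>\<close>, where \<open>u\<close> is a witness for
  \<open>P\<close>. If \<open>d > 0\<close>, pseudo-division of \<open>f\<close> by \<open>w\<close> leaves a remainder in \<open>P\<close>, so the quotient lies
  in \<open>P\<close>; as its degree is less than \<open>n\<close>, its coefficients lie in \<open>\<pp>\<close>, and so does the leading
  coefficient of \<open>f\<close>, a contradiction. Hence a multiple of \<open>u\<close> is congruent to a constant \<open>s \<notin>
  \<pp>\<close>, and \<open>lead_coeff f * s\<close> is a witness for \<open>\<pp>\<close>: if \<open>s\<^sup>m\<close> is a multiple of \<open>b\<close> modulo \<open>P\<close>,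
  pseudo-division of the cofactor by \<open>f\<close> makes this relation one between constants.\<close>

theorem goldman_contraction:
  fixes P :: "'a::comm_ring_1 poly set"
  assumes G: "goldman_ideal P"
  shows "goldman_ideal {a. [:a:] \<in> P}" and "\<exists>f\<in>P. [:lead_coeff f:] \<notin> P"
proof -
  define \<pp> where "\<pp> = {a. [:a:] \<in> P}"
  obtain u where prime: "primeideal P type_ring" and u: "u \<notin> P"
    and wit: "\<And>c. c \<notin> P \<Longrightarrow> \<exists>n h. u ^ n - h * c \<in> P"
    using G unfolding goldman_ideal_def by blast
  have P: "ideal P type_ring" and one: "1 \<notin> P"
    and pr: "\<And>a b. a * b \<in> P \<Longrightarrow> a \<in> P \<or> b \<in> P" using prime by (auto simp: type_primeideal_iff)
  have pp: "primeideal \<pp> type_ring" unfolding \<pp>_def by (rule contracted_prime[OF prime])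
  then have p: "ideal \<pp> type_ring" and p1: "1 \<notin> \<pp>"
    and ppr: "\<And>a b. a * b \<in> \<pp> \<Longrightarrow> a \<in> \<pp> \<or> b \<in> \<pp>"
    by (auto simp: type_primeideal_iff)
  have ppow: "a ^ n \<notin> \<pp>" if "a \<notin> \<pp>" for a n using type_prime_power[OF pp] that by blast
  have p0: "0 \<in> \<pp>" by (rule type_ideal_zero[OF p])
  have pP: "[:c:] \<in> P" if "c \<in> \<pp>" for c using that by (simp add: \<pp>_def)
  have inP: "f \<in> P" if "\<And>i. coeff f i \<in> \<pp>" for f
  proof -
    have "(\<Sum>i\<le>degree f. monom (coeff f i) i) \<in> P"
      using that pP by (intro type_ideal_sum[OF P] ideal_const_monom[OF P]) auto
    then show ?thesis by (simp add: poly_as_sum_of_monoms)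
  qed
  \<comment> \<open>Degrees modulo \<open>\<pp>\<close>: the ideal contains a polynomial of degree \<open>n\<close> over \<open>R / \<pp>\<close>.\<close>
  define good where "good = (\<lambda>K n. \<exists>f\<in>K. lead_coeff f \<notin> \<pp> \<and> degree f = n)"
  have goodI: "good K e" if "ideal K type_ring" "P \<subseteq> K" "f \<in> K" "coeff f e \<notin> \<pp>"
      "\<And>i. i > e \<Longrightarrow> coeff f i \<in> \<pp>" for K f e
    using truncate_in_ideal[OF that(1) p0 _ that(3,4,5)] pP that(2) that(4)
    unfolding good_def by (metis subset_iff)
  have "\<exists>n. good P n"
  proof (rule ccontr)
    assume no: "\<nexists>n. good P n"
    have "[:coeff f i:] \<in> P" if "f \<in> P" for f i
    proof (rule ccontr)
      assume "[:coeff f i:] \<notin> P"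
      then obtain e where "coeff f e \<notin> \<pp>" "\<And>i. i > e \<Longrightarrow> coeff f i \<in> \<pp>"
        using top_coeff_outside[OF p0, of f] by (auto simp: \<pp>_def)
      then show False using no goodI[OF P subset_refl that] by blast
    qed
    then show False using goldman_not_extended[OF G] by blast
  qed
  define n where "n = (LEAST n. good P n)"
  have "good P n" unfolding n_def by (rule LeastI_ex) fact
  then obtain f where f: "f \<in> P" "lead_coeff f \<notin> \<pp>" "degree f = n" by (auto simp: good_def)
  then show "\<exists>f\<in>P. [:lead_coeff f:] \<notin> P" by (auto simp: \<pp>_def)
  \<comment> \<open>Elements of \<open>P\<close> have degree at least \<open>n\<close> over \<open>R / \<pp>\<close>, unless they vanish there.\<close>
  have small: "coeff g i \<in> \<pp>" if "g \<in> P" "\<And>i. i \<ge> n \<Longrightarrow> coeff g i \<in> \<pp>" for g i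
  proof (rule ccontr)
    assume "coeff g i \<notin> \<pp>"
    then obtain e where e: "coeff g e \<notin> \<pp>" "\<And>i. i > e \<Longrightarrow> coeff g i \<in> \<pp>"
      using top_coeff_outside[OF p0, of g] by auto
    then have "good P e" by (rule goodI[OF P subset_refl that(1)])
    then have "n \<le> e" unfolding n_def by (rule Least_le)
    then show False using e that(2) by blast
  qed
  have n0: "n > 0"
  proof (rule ccontr)
    assume "\<not> n > 0"
    then have "f = [:lead_coeff f:]" using f(3) by (auto elim: degree_eq_zeroE)
    then show False using f by (auto simp: \<pp>_def)
  qed

  define K where "K = {j + r * u |j r. j \<in> P}"
  have K: "ideal K type_ring" unfolding K_def by (rule type_ideal_plus_principal[OF P])
  have PK: "P \<subseteq> K"
  proof
    fix x assume "x \<in> P" then have "x = x + 0 * u" "x \<in> P" by simp_all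
    then show "x \<in> K" unfolding K_def by blast
  qed
  have uK: "u \<in> K"
  proof -
    have "u = 0 + 1 * u" by simp
    then show ?thesis unfolding K_def using type_ideal_zero[OF P] by blast
  qed
  have "\<exists>d. good K d" using \<open>good P n\<close> PK by (auto simp: good_def)
  define d where "d = (LEAST d. good K d)"
  have "good K d" unfolding d_def by (rule LeastI_ex) fact
  then obtain w where w: "w \<in> K" "lead_coeff w \<notin> \<pp>" "degree w = d" by (auto simp: good_def)
  have w0: "w \<noteq> 0" using w(2) p0 by auto
  have smallK: "r \<in> P" if "r \<in> K" "r = 0 \<or> degree r < d" for r
  proof (rule inP, rule ccontr)
    fix i assume "coeff r i \<notin> \<pp>"
    then obtain e where e: "coeff r e \<notin> \<pp>" "\<And>i. i > e \<Longrightarrow> coeff r i \<in> \<pp>"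
      using top_coeff_outside[OF p0, of r] by auto
    have "d \<le> e" unfolding d_def by (rule Least_le) (rule goodI[OF K PK that(1) e])
    moreover have "e \<le> degree r" "r \<noteq> 0" using e(1) p0 by (auto intro: le_degree)
    ultimately show False using that(2) by auto
  qed
  have "d = 0"
  proof (rule ccontr)
    assume d0: "d \<noteq> 0"
    have lw: "[:lead_coeff w ^ N:] \<notin> P" for N using ppow[OF w(2)] by (simp add: \<pp>_def)
    have rem: "\<exists>N q. smult (lead_coeff w ^ N) g - w * q \<in> P" if "g \<in> K" for g
    proof -
      obtain N q r where *: "smult (lead_coeff w ^ N) g = w * q + r" "r = 0 \<or> degree r < degree w"
        by (rule pseudo_division[OF w0])
      have "r = [:lead_coeff w ^ N:] * g - q * w" using *(1) by (simp add: algebra_simps)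
      then have "r \<in> K" using type_ideal_diff[OF K type_ideal_mult[OF K that] type_ideal_mult[OF K w(1)]]
        by metis
      then have "r \<in> P" using smallK *(2) w(3) by blast
      then show ?thesis using *(1) by (metis add_diff_cancel_left')
    qed
    have "w \<notin> P"
    proof
      assume "w \<in> P"
      obtain N q where "smult (lead_coeff w ^ N) u - w * q \<in> P" using rem uK by blast
      then have "[:lead_coeff w ^ N:] * u \<in> P"
        using type_ideal_cong[OF P] type_ideal_mult_right[OF P \<open>w \<in> P\<close>] by auto
      then show False using pr lw u by blast
    qed
    obtain N q r where *: "smult (lead_coeff w ^ N) f = w * q + r" "r = 0 \<or> degree r < degree w"
      by (rule pseudo_division[OF w0])
    have "r = [:lead_coeff w ^ N:] * f - q * w" using *(1) by (simp add: algebra_simps)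
    then have "r \<in> K"
      using type_ideal_diff[OF K type_ideal_mult[OF K] type_ideal_mult[OF K w(1)]] f(1) PK
      by (metis subset_iff)
    then have rP: "r \<in> P" using smallK *(2) w(3) by blast
    have dn: "d \<le> n" unfolding d_def
      by (rule Least_le) (use f PK in \<open>auto simp: good_def\<close>)
    have r_coeff: "coeff r i \<in> \<pp>" for i
      by (rule small[OF rP]) (use *(2) w(3) dn p0 in \<open>auto simp: coeff_eq_0\<close>)
    have "w * q = [:lead_coeff w ^ N:] * f - r" using *(1) by simp
    then have "w * q \<in> P" using type_ideal_diff[OF P type_ideal_mult[OF P f(1)] rP] by metis
    then have qP: "q \<in> P" using pr \<open>w \<notin> P\<close> by blast
    have "coeff q i \<in> \<pp>" for i
    proof (rule ccontr)
      assume "coeff q i \<notin> \<pp>"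
      then obtain e where e: "coeff q e \<notin> \<pp>" "\<And>i. i > e \<Longrightarrow> coeff q i \<in> \<pp>"
        using top_coeff_outside[OF p0, of q] by auto
      have "n \<le> e" unfolding n_def by (rule Least_le) (rule goodI[OF P subset_refl qP e])
      then have "coeff (smult (lead_coeff w ^ N) f) (d + e) = 0" "coeff r (d + e) = 0"
        using f(3) d0 dn *(2) w(3) by (auto simp: coeff_eq_0)
      then have "coeff (w * q) (d + e) = 0" using *(1) by (metis add.right_neutral coeff_add)
      moreover have "coeff (w * q) (d + e) - coeff w d * coeff q e \<in> \<pp>"
        by (rule coeff_mult_top[OF p _ e(2)]) (use w(3) p0 in \<open>auto simp: coeff_eq_0\<close>)
      ultimately have "coeff w d * coeff q e \<in> \<pp>" using type_ideal_cong[OF p] p0 by metis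
      then show False using ppr w(2,3) e(1) by blast
    qed
    then have "coeff (w * q + r) n \<in> \<pp>"
      using coeff_mult_in_ideal[OF p] r_coeff type_ideal_add[OF p] by auto
    then have "lead_coeff w ^ N * lead_coeff f \<in> \<pp>" using *(1) f(3) by (metis coeff_smult)
    then show False using ppr ppow[OF w(2)] f(2) by blast
  qed
  then obtain s where s: "w = [:s:]" using w(3) by (auto elim: degree_eq_zeroE)
  then have "s \<notin> \<pp>" using w(2) by simp
  obtain j v where jv: "[:s:] = j + v * u" "j \<in> P" using w(1) unfolding K_def s by auto

  let ?c = "lead_coeff f"
  have f0: "f \<noteq> 0" using f(2) p0 by auto
  have "\<exists>m h. (?c * s) ^ m - h * b \<in> \<pp>" if b: "b \<notin> \<pp>" for b
  proof -
    have "[:b:] \<notin> P" using b by (simp add: \<pp>_def)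
    then obtain m h where h: "u ^ m - h * [:b:] \<in> P" using wit by blast
    have "[:s:] ^ m - (v * u) ^ m \<in> P"
    proof (induction m)
      case (Suc m)
      have "[:s:] ^ Suc m - (v * u) ^ Suc m = [:s:] * ([:s:] ^ m - (v * u) ^ m) + (v * u) ^ m * j"
        by (simp only: jv power_Suc) (simp add: algebra_simps)
      then show ?case
        using type_ideal_add[OF P type_ideal_mult[OF P Suc] type_ideal_mult[OF P jv(2)]] by metis
    qed (use type_ideal_zero[OF P] in simp)
    moreover have "v ^ m * (u ^ m - h * [:b:]) \<in> P" by (rule type_ideal_mult[OF P h])
    ultimately have sm: "[:s:] ^ m - (v ^ m * h) * [:b:] \<in> P"
      using type_ideal_add[OF P] by (fastforce simp: algebra_simps power_mult_distrib)
    obtain N q r where *: "smult (?c ^ N) (v ^ m * h) = f * q + r" "r = 0 \<or> degree r < degree f"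
      by (rule pseudo_division[OF f0])
    define t where "t = [:?c ^ N * s ^ m:] - smult b r"
    have "t = [:?c ^ N:] * ([:s:] ^ m - (v ^ m * h) * [:b:]) + [:b:] * (q * f)"
    proof -
      have "[:?c ^ N:] * ((v ^ m * h) * [:b:]) = [:b:] * smult (?c ^ N) (v ^ m * h)"
        by (simp add: algebra_simps)
      also have "\<dots> = [:b:] * (q * f) + smult b r" unfolding * by (simp add: algebra_simps smult_add_right)
      finally show ?thesis unfolding t_def
        by (simp add: algebra_simps poly_const_pow)
    qed
    then have "t \<in> P"
      using type_ideal_add[OF P type_ideal_mult[OF P sm] type_ideal_mult[OF P type_ideal_mult[OF P f(1)]]]
      by metis
    moreover have "coeff t i = 0" if "i \<ge> n" for i
      using that n0 *(2) f(3) unfolding t_def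
      by (cases i) (auto simp: coeff_eq_0)
    ultimately have "coeff t 0 \<in> \<pp>" using small p0 by metis
    then have "?c ^ N * s ^ m - b * coeff r 0 \<in> \<pp>" by (simp add: t_def)
    then have "(?c ^ m * s ^ N) * (?c ^ N * s ^ m - b * coeff r 0) \<in> \<pp>" by (rule type_ideal_mult[OF p])
    moreover have "(?c ^ m * s ^ N) * (?c ^ N * s ^ m - b * coeff r 0) =
        (?c * s) ^ (m + N) - ((?c ^ m * s ^ N) * coeff r 0) * b"
      by (simp add: algebra_simps power_mult_distrib power_add)
    ultimately show ?thesis by metis
  qed
  moreover have "?c * s \<notin> \<pp>" using ppr f(2) \<open>s \<notin> \<pp>\<close> by blast
  ultimately show "goldman_ideal {a. [:a:] \<in> P}"
    using pp unfolding goldman_ideal_def \<pp>_def by blast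
qed


section \<open>Evaluation of polynomials and finitely generated algebras\<close>

definition eval_poly :: "('a::comm_ring_1 \<Rightarrow> 'b::comm_ring_1) \<Rightarrow> 'b \<Rightarrow> 'a poly \<Rightarrow> 'b" where
  "eval_poly \<phi> s p = poly (map_poly \<phi> p) s"

lemma eval_poly_hom:
  assumes "comm_ring_hom \<phi>"
  shows "comm_ring_hom (eval_poly \<phi> s)"
proof -
  interpret \<phi>: map_poly_comm_ring_hom \<phi> using assms by (simp add: map_poly_comm_ring_hom_def)
  show ?thesis
    by unfold_locales (simp_all add: eval_poly_def \<phi>.hom_add \<phi>.hom_mult)
qed

lemma eval_poly_const: "comm_ring_hom \<phi> \<Longrightarrow> eval_poly \<phi> s [:a:] = \<phi> a"
proof -
  assume "comm_ring_hom \<phi>"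
  then interpret comm_ring_hom \<phi> .
  have "map_poly \<phi> [:a:] = [:\<phi> a:]"
    by (rule poly_eqI) (simp add: coeff_map_poly coeff_pCons split: nat.splits)
  then show ?thesis by (simp add: eval_poly_def)
qed

lemma eval_poly_X: "comm_ring_hom \<phi> \<Longrightarrow> eval_poly \<phi> s [:0, 1:] = s"
proof -
  assume "comm_ring_hom \<phi>"
  then interpret comm_ring_hom \<phi> .
  show ?thesis by (simp add: eval_poly_def)
qed

lemma eval_poly_altdef:
  assumes "comm_ring_hom \<phi>"
  shows "eval_poly \<phi> s p = (\<Sum>i\<le>degree p. \<phi> (coeff p i) * s ^ i)"
proof -
  interpret comm_ring_hom \<phi> by fact
  have "degree (map_poly \<phi> p) \<le> degree p" by (rule degree_map_poly_le)
  then show ?thesis unfolding eval_poly_def poly_altdef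
    by (intro sum.mono_neutral_cong_left) (auto simp: coeff_map_poly intro: le_degree)
qed

text \<open>Inverses modulo \<open>P\<close> lift along the surjection, so \<open>1\<close> is a witness for the preimage.\<close>

lemma hom_vimage_maximal:
  assumes \<phi>: "comm_ring_hom (\<phi> :: 'a::comm_ring_1 \<Rightarrow> 'b::comm_ring_1)" "surj \<phi>"
    and P: "maximalideal P type_ring"
  shows "goldman_ideal (\<phi> -` P)"
proof -
  interpret comm_ring_hom \<phi> by fact
  have prime: "primeideal P type_ring" by (rule type_maximal_imp_prime[OF P])
  then have "primeideal (\<phi> -` P) type_ring"
    by (auto simp: type_primeideal_iff type_ideal_iff hom_distribs)
  moreover have "\<exists>n h. 1 ^ n - h * c \<in> \<phi> -` P" if c: "c \<notin> \<phi> -` P" for c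
  proof -
    obtain r where "1 - r * \<phi> c \<in> P" using type_maximal_inverse[OF P] c by auto
    moreover obtain r' where "r = \<phi> r'" using \<phi>(2) by blast
    ultimately have "1 ^ 0 - r' * c \<in> \<phi> -` P" by (simp add: hom_distribs)
    then show ?thesis by blast
  qed
  ultimately show ?thesis
    unfolding goldman_ideal_def using prime by (metis hom_one type_primeideal_iff vimage_eq)
qed

text \<open>The element of \<open>P\<close> with leading coefficient outside \<open>P\<close> is not constant, and over a field it
  can be made monic.\<close>

lemma goldman_field_poly:
  assumes "goldman_ideal (P :: 'k::field poly set)"
  obtains p where "p \<in> P" "lead_coeff p = 1" "degree p > 0"
proof -
  obtain f where f: "f \<in> P" "[:lead_coeff f:] \<notin> P" using goldman_contraction(2)[OF assms] by blast
  have P: "ideal P type_ring" using assms by (auto simp: goldman_ideal_def type_primeideal_iff)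
  have f0: "f \<noteq> 0" using f type_ideal_zero[OF P] by auto
  define p where "p = smult (inverse (lead_coeff f)) f"
  have "p = [:inverse (lead_coeff f):] * f" by (simp add: p_def)
  then have "p \<in> P" using type_ideal_mult[OF P f(1)] by metis
  moreover have "lead_coeff p = 1" "degree p = degree f" using f0 by (simp_all add: p_def)
  moreover have "degree f > 0"
  proof (rule ccontr)
    assume "\<not> degree f > 0"
    then have "f = [:lead_coeff f:]" by (auto elim: degree_eq_zeroE)
    then show False using f by auto
  qed
  ultimately show ?thesis using that by simp
qed


section \<open>Noetherian rings\<close>

lemma noetherian_surj:
  assumes R: "noetherian_ring R" and S: "ring S" and h: "h \<in> Ring.ring_hom R S"
    and surj: "h ` carrier R = carrier S"
  shows "noetherian_ring S"
proof (rule ring.noetherian_ringI[OF S])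
  interpret R: noetherian_ring R by fact
  interpret S: ring S by fact
  interpret h: ring_hom_ring R S h by (rule ring_hom_ringI2) (use R.ring_axioms S h in auto)
  fix J assume J: "ideal J S"
  interpret J: ideal J S by fact
  obtain A where A: "A \<subseteq> carrier R" "finite A" "{r \<in> carrier R. h r \<in> J} = Idl\<^bsub>R\<^esub> A"
    using R.finetely_gen[OF h.ideal_vimage[OF J]] by blast
  have AJ: "h ` A \<subseteq> J" using R.genideal_self[OF A(1)] A(3) by blast
  have hA: "h ` A \<subseteq> carrier S" using A(1) h.hom_closed by auto
  have "ideal {r \<in> carrier R. h r \<in> Idl\<^bsub>S\<^esub> (h ` A)} R"
    by (rule h.ideal_vimage[OF S.genideal_ideal[OF hA]])
  moreover have "A \<subseteq> {r \<in> carrier R. h r \<in> Idl\<^bsub>S\<^esub> (h ` A)}"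
    using A(1) S.genideal_self[OF hA] by auto
  ultimately have "Idl\<^bsub>R\<^esub> A \<subseteq> {r \<in> carrier R. h r \<in> Idl\<^bsub>S\<^esub> (h ` A)}"
    by (rule R.genideal_minimal)
  then have sub: "h r \<in> Idl\<^bsub>S\<^esub> (h ` A)" if "r \<in> carrier R" "h r \<in> J" for r
    using that unfolding A(3)[symmetric] by blast
  have "J \<subseteq> Idl\<^bsub>S\<^esub> (h ` A)"
  proof
    fix y assume y: "y \<in> J"
    then have "y \<in> h ` carrier R" unfolding surj by (rule J.a_Hcarr)
    then obtain r where "r \<in> carrier R" "y = h r" by blast
    then show "y \<in> Idl\<^bsub>S\<^esub> (h ` A)" using sub y by blast
  qed
  moreover have "Idl\<^bsub>S\<^esub> (h ` A) \<subseteq> J" by (rule S.genideal_minimal[OF J AJ])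
  ultimately show "\<exists>A\<subseteq>carrier S. finite A \<and> J = Idl\<^bsub>S\<^esub> A"
    using hA A(2) by (intro exI[of _ "h ` A"]) auto
qed

lemma noetherian_type_surj:
  assumes "noetherian_ring (type_ring :: 'a::comm_ring_1 ring)"
    and "comm_ring_hom (\<phi> :: 'a \<Rightarrow> 'b::comm_ring_1)" "surj \<phi>"
  shows "noetherian_ring (type_ring :: 'b ring)"
proof (rule noetherian_surj[OF assms(1)])
  interpret comm_ring_hom \<phi> by fact
  show "\<phi> \<in> Ring.ring_hom type_ring type_ring"
    by (rule ring_hom_memI) (auto simp: hom_distribs)
qed (use assms(3) in auto)

lemma genideal_image_sum:
  fixes a :: "nat \<Rightarrow> 'a::comm_ring_1"
  assumes "x \<in> Idl\<^bsub>type_ring\<^esub> (a ` {..<n})"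
  obtains r where "x = (\<Sum>i<n. r i * a i)"
proof -
  let ?S = "{x. \<exists>r. x = (\<Sum>i<n. r i * a i)}"
  have "ideal ?S type_ring"
  proof (rule type_idealI)
    show "0 \<in> ?S" by (auto intro!: exI[of _ "\<lambda>_. 0"])
  next
    fix x y assume "x \<in> ?S" "y \<in> ?S"
    then obtain r s where "x = (\<Sum>i<n. r i * a i)" "y = (\<Sum>i<n. s i * a i)" by blast
    then have "x + y = (\<Sum>i<n. (r i + s i) * a i)" by (simp add: algebra_simps sum.distrib)
    then show "x + y \<in> ?S" by (auto intro!: exI[of _ "\<lambda>i. r i + s i"])
  next
    fix x c assume "x \<in> ?S"
    then obtain r where "x = (\<Sum>i<n. r i * a i)" by blast
    then have "c * x = (\<Sum>i<n. (c * r i) * a i)" by (simp add: sum_distrib_left mult.assoc)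
    then show "c * x \<in> ?S" by (auto intro!: exI[of _ "\<lambda>i. c * r i"])
  qed
  moreover have "a ` {..<n} \<subseteq> ?S"
  proof clarify
    fix i assume "i < n"
    then have "a i = (\<Sum>j<n. (if j = i then 1 else 0) * a j)"
      by (subst sum.cong[OF refl, of _ _ "\<lambda>j. if j = i then a j else 0"]) auto
    then show "\<exists>r. a i = (\<Sum>j<n. r j * a j)" by (intro exI[of _ "\<lambda>j. if j = i then 1 else 0"])
  qed
  ultimately have "Idl\<^bsub>type_ring\<^esub> (a ` {..<n}) \<subseteq> ?S" by (rule genideal_mono_type)
  then show ?thesis using assms that by blast
qed

text \<open>The ideals of the initial segments form an ascending chain.\<close>

lemma noetherian_sequence_stable:
  fixes a :: "nat \<Rightarrow> 'a::comm_ring_1"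
  assumes "noetherian_ring (type_ring :: 'a ring)"
  obtains N where "\<And>m. a m \<in> Idl\<^bsub>type_ring\<^esub> (a ` {..<N})"
proof -
  interpret noetherian_ring "type_ring :: 'a ring" by fact
  let ?I = "\<lambda>n. Idl\<^bsub>type_ring\<^esub> (a ` {..<n})"
  have mono: "?I m \<subseteq> ?I n" if "m \<le> n" for m n
    using that genideal_mono_type[OF genideal_type_ideal] genideal_type_self[of "a ` {..<n}"]
    by (meson image_mono lessThan_subset_iff order_trans)
  have "\<Union>(range ?I) \<in> range ?I"
  proof (rule ideal_chain_is_trivial)
    show "subset.chain {I. ideal I type_ring} (range ?I)"
      unfolding subset_chain_def using genideal_type_ideal mono nat_le_linear by blast
  qed auto
  then obtain N where N: "\<Union>(range ?I) = ?I N" by blast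
  have "a m \<in> ?I N" for m
  proof -
    have "a m \<in> ?I (Suc m)" using genideal_type_self[of "a ` {..<Suc m}"] by auto
    then show ?thesis using N by blast
  qed
  then show ?thesis by (rule that)
qed

text \<open>In an ideal that is not finitely generated, choose successively elements \<open>f\<^sub>n\<close> of least degree
  outside the ideal of the previous ones. A relation expressing the leading coefficient of \<open>f\<^sub>N\<close>
  by those of its predecessors lowers the degree of \<open>f\<^sub>N\<close>, which contradicts its choice.\<close>

theorem hilbert_basis:
  assumes noeth: "noetherian_ring (type_ring :: 'a::comm_ring_1 ring)"
  shows "noetherian_ring (type_ring :: 'a poly ring)"
proof (rule ring.noetherian_ringI[OF type_ring_ring])
  fix J :: "'a poly set" assume J: "ideal J type_ring"
  show "\<exists>A\<subseteq>carrier type_ring. finite A \<and> J = Idl\<^bsub>type_ring\<^esub> A"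
  proof (rule ccontr)
    assume notfg: "\<not> ?thesis"
    have ex: "\<exists>g. g \<in> J - Idl\<^bsub>type_ring\<^esub> A" if "finite A" "A \<subseteq> J" for A
      using notfg that genideal_mono_type[OF J that(2)] by auto
    define C where "C = (\<lambda>f n (g :: 'a poly). g \<in> J - Idl\<^bsub>type_ring\<^esub> (f ` {..<n::nat}) \<and>
      (\<forall>g' \<in> J - Idl\<^bsub>type_ring\<^esub> (f ` {..<n}). degree g \<le> degree g'))"
    have "\<exists>f. \<forall>n. C f n (f n)"
    proof (rule dependent_wellorder_choice)
      fix f g :: "nat \<Rightarrow> 'a poly" and n r assume "\<And>m. m < n \<Longrightarrow> f m = g m"
      then have "f ` {..<n} = g ` {..<n}" by auto
      then show "C f n r = C g n r" by (simp add: C_def)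
    next
      fix n and f :: "nat \<Rightarrow> 'a poly" assume "\<And>m. m < n \<Longrightarrow> C f m (f m)"
      then have "f ` {..<n} \<subseteq> J" by (auto simp: C_def)
      then obtain g where "g \<in> J - Idl\<^bsub>type_ring\<^esub> (f ` {..<n})" using ex by blast
      then have "\<exists>g. g \<in> J - Idl\<^bsub>type_ring\<^esub> (f ` {..<n}) \<and>
          (\<forall>g'. g' \<in> J - Idl\<^bsub>type_ring\<^esub> (f ` {..<n}) \<longrightarrow> degree g \<le> degree g')"
        by (rule ex_has_least_nat)
      then show "\<exists>g. C f n g" unfolding C_def by blast
    qed
    then obtain f where f: "\<And>n. C f n (f n)" by blast
    have fJ: "f n \<in> J" and fN: "f n \<notin> Idl\<^bsub>type_ring\<^esub> (f ` {..<n})" for n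
      using f by (auto simp: C_def)
    obtain N where "lead_coeff (f N) \<in> Idl\<^bsub>type_ring\<^esub> ((\<lambda>n. lead_coeff (f n)) ` {..<N})"
      using noetherian_sequence_stable[OF noeth, of "\<lambda>n. lead_coeff (f n)"] by metis
    then obtain r where r: "lead_coeff (f N) = (\<Sum>i<N. r i * lead_coeff (f i))"
      by (rule genideal_image_sum)
    let ?I = "Idl\<^bsub>type_ring\<^esub> (f ` {..<N})"
    note I = genideal_type_ideal[of "f ` {..<N}"]
    have fI: "f i \<in> ?I" if "i < N" for i using genideal_type_self[of "f ` {..<N}"] that by auto
    have deg: "degree (f i) \<le> degree (f N)" if "i < N" for i
    proof -
      have "f N \<notin> Idl\<^bsub>type_ring\<^esub> (f ` {..<i})"
        using fN[of N] genideal_mono_type[OF I, of "f ` {..<i}"] fI that by fastforce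
      then show ?thesis using f[of i] fJ by (auto simp: C_def)
    qed
    define h where "h = (\<Sum>i<N. monom (r i) (degree (f N) - degree (f i)) * f i)"
    have hI: "h \<in> ?I" unfolding h_def using fI by (auto intro!: type_ideal_sum[OF I] type_ideal_mult[OF I])
    have hJ: "h \<in> J" unfolding h_def using fJ by (auto intro!: type_ideal_sum[OF J] type_ideal_mult[OF J])
    have "coeff h (degree (f N)) = (\<Sum>i<N. r i * lead_coeff (f i))"
      unfolding h_def coeff_sum by (rule sum.cong) (use deg in \<open>auto simp: coeff_monom_mult\<close>)
    then have lead: "coeff (f N - h) (degree (f N)) = 0" using r by simp
    have "degree h \<le> degree (f N)" unfolding h_def
    proof (rule degree_sum_le)
      fix i assume "i \<in> {..<N}"
      then show "degree (monom (r i) (degree (f N) - degree (f i)) * f i) \<le> degree (f N)"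
        using deg[of i] degree_mult_le[of "monom (r i) (degree (f N) - degree (f i))" "f i"]
          degree_monom_le[of "r i" "degree (f N) - degree (f i)"] by auto
    qed auto
    then have le: "degree (f N - h) \<le> degree (f N)" by (simp add: degree_diff_le)
    have notI: "f N - h \<notin> ?I" using type_ideal_add[OF I _ hI, of "f N - h"] fN by auto
    then have "f N - h \<in> J - ?I" using type_ideal_diff[OF J fJ hJ] by blast
    then have "degree (f N) \<le> degree (f N - h)" using f[of N] by (auto simp: C_def)
    then have "lead_coeff (f N - h) = 0" using le lead by simp
    then have "f N - h = 0" by (simp only: leading_coeff_0_iff)
    then show False using notI type_ideal_zero[OF I] by auto
  qed
qed

lemma noetherian_type_field: "noetherian_ring (type_ring :: 'k::field ring)"
proof (rule ring.noetherian_ringI[OF type_ring_ring])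
  fix J :: "'k set" assume J: "ideal J type_ring"
  have "J = {0} \<or> J = UNIV"
  proof (rule ccontr)
    assume no: "\<not> ?thesis"
    then obtain a where a: "a \<in> J" "a \<noteq> 0" using type_ideal_zero[OF J] by blast
    have "x \<in> J" for x using type_ideal_mult[OF J a(1), of "x / a"] a(2) by simp
    then show False using no by blast
  qed
  then obtain a :: 'k where a: "J = {0} \<and> a = 0 \<or> J = UNIV \<and> a = 1" by blast
  have "J = Idl\<^bsub>type_ring\<^esub> {a}"
  proof
    show "Idl\<^bsub>type_ring\<^esub> {a} \<subseteq> J" by (rule genideal_mono_type[OF J]) (use a in auto)
    have "x \<in> Idl\<^bsub>type_ring\<^esub> {a}" if "x \<in> J" for x
      using type_ideal_mult[OF genideal_type_ideal, of a "{a}" x] genideal_type_self[of "{a}"] a that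
      by auto
    then show "J \<subseteq> Idl\<^bsub>type_ring\<^esub> {a}" by blast
  qed
  then show "\<exists>A\<subseteq>carrier type_ring. finite A \<and> J = Idl\<^bsub>type_ring\<^esub> A"
    by (intro exI[of _ "{a}"]) auto
qed


section \<open>Monomials and gradings of the Cox ring\<close>

text \<open>An order of the variables orders the exponents linearly and compatibly with addition, which
  makes the Cox ring an integral domain.\<close>

instantiation cox_var :: linorder
begin

definition less_eq_cox_var :: "cox_var \<Rightarrow> cox_var \<Rightarrow> bool" where
  "less_eq_cox_var u v \<longleftrightarrow> rec_cox_var (0::nat) 1 2 3 u \<le> rec_cox_var 0 1 2 3 v"

definition less_cox_var :: "cox_var \<Rightarrow> cox_var \<Rightarrow> bool" where
  "less_cox_var u v \<longleftrightarrow> rec_cox_var (0::nat) 1 2 3 u < rec_cox_var 0 1 2 3 v"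

instance
proof
  fix x y z :: cox_var
  show "x \<le> y \<Longrightarrow> y \<le> x \<Longrightarrow> x = y"
    by (cases x; cases y) (simp_all add: less_eq_cox_var_def)
qed (auto simp: less_eq_cox_var_def less_cox_var_def)

end

definition const :: "'k::field \<Rightarrow> 'k cox" where
  "const c = Poly_Mapping.single 0 c"

lemma const_hom: "comm_ring_hom const"
  by unfold_locales (simp_all add: const_def single_add mult_single)

lemma const_0 [simp]: "const 0 = 0" and const_1 [simp]: "const 1 = 1"
  by (simp_all add: const_def)

lemma const_mult: "const (a * b) = const a * const b"
  by (simp add: const_def mult_single)

lemma const_inverse: "c \<noteq> 0 \<Longrightarrow> const (inverse c) * const c = 1"
  by (simp add: const_mult[symmetric])

lemma sum_monomials:
  "(\<Sum>e\<in>Poly_Mapping.keys f. Poly_Mapping.single e (Poly_Mapping.lookup f e)) = f"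
proof (rule poly_mapping_eqI)
  fix k
  have "(\<Sum>e\<in>Poly_Mapping.keys f. (Poly_Mapping.lookup f e when e = k)) = Poly_Mapping.lookup f k"
    by (cases "k \<in> Poly_Mapping.keys f")
       (auto simp: when_def sum.delta not_in_keys_iff_lookup_eq_zero)
  then show "Poly_Mapping.lookup (\<Sum>e\<in>Poly_Mapping.keys f. Poly_Mapping.single e (Poly_Mapping.lookup f e)) k =
      Poly_Mapping.lookup f k"
    by (simp add: lookup_sum lookup_single)
qed

lemma cox_gen_power:
  "cox_gen v ^ n = Poly_Mapping.single (Poly_Mapping.single v n) (1 :: 'k::field)"
  by (induction n) (simp_all add: cox_gen_def mult_single single_add[symmetric])

lemma cox_exponent_eq:
  "e = Poly_Mapping.single X10 (Poly_Mapping.lookup e X10) + Poly_Mapping.single X11 (Poly_Mapping.lookup e X11)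
     + Poly_Mapping.single X20 (Poly_Mapping.lookup e X20) + Poly_Mapping.single X21 (Poly_Mapping.lookup e X21)"
proof (rule poly_mapping_eqI)
  fix v show "Poly_Mapping.lookup e v = Poly_Mapping.lookup (Poly_Mapping.single X10 (Poly_Mapping.lookup e X10) + Poly_Mapping.single X11 (Poly_Mapping.lookup e X11)
     + Poly_Mapping.single X20 (Poly_Mapping.lookup e X20) + Poly_Mapping.single X21 (Poly_Mapping.lookup e X21)) v"
    by (cases v) (simp_all add: lookup_add lookup_single)
qed

lemma monomial_eq:
  "Poly_Mapping.single e c = const c * cox_gen X10 ^ Poly_Mapping.lookup e X10
     * cox_gen X11 ^ Poly_Mapping.lookup e X11 * cox_gen X20 ^ Poly_Mapping.lookup e X20
     * cox_gen X21 ^ Poly_Mapping.lookup e X21"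
  by (subst cox_exponent_eq[of e]) (simp add: const_def cox_gen_power mult_single)

lemma cox_induct [case_names const var add mult]:
  fixes f :: "'k::field cox"
  assumes c: "\<And>c. \<Phi> (const c)" and v: "\<And>v. \<Phi> (cox_gen v)"
    and add: "\<And>f g. \<Phi> f \<Longrightarrow> \<Phi> g \<Longrightarrow> \<Phi> (f + g)"
    and mult: "\<And>f g. \<Phi> f \<Longrightarrow> \<Phi> g \<Longrightarrow> \<Phi> (f * g)"
  shows "\<Phi> f"
proof -
  have pow: "\<Phi> (cox_gen v ^ n)" for v n
    by (induction n) (use c[of 1] v mult in auto)
  have sum: "\<Phi> (sum g A)" if "\<And>a. a \<in> A \<Longrightarrow> \<Phi> (g a)" for A and g :: "(cox_var \<Rightarrow>\<^sub>0 nat) \<Rightarrow> 'k cox"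
    using that by (induction A rule: infinite_finite_induct) (use c[of 0] add in auto)
  show ?thesis
    by (subst sum_monomials[of f, symmetric], rule sum, subst monomial_eq) (intro mult c pow)
qed

definition part :: "('e \<Rightarrow> bool) \<Rightarrow> ('e \<Rightarrow>\<^sub>0 'c::zero) \<Rightarrow> ('e \<Rightarrow>\<^sub>0 'c)" where
  "part P f = Poly_Mapping.mapp (\<lambda>e c. if P e then c else 0) f"

lemma lookup_part: "Poly_Mapping.lookup (part P f) e = (if P e then Poly_Mapping.lookup f e else 0)"
  by (auto simp: part_def lookup_mapp when_def not_in_keys_iff_lookup_eq_zero)

lemma keys_part: "Poly_Mapping.keys (part P f) = {e \<in> Poly_Mapping.keys f. P e}"
  by (auto simp: lookup_part in_keys_iff split: if_splits)

lemma part_zero [simp]: "part P 0 = 0"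
  by (rule poly_mapping_eqI) (simp add: lookup_part)

lemma part_add: "part P (f + g) = part P f + part P (g :: 'e \<Rightarrow>\<^sub>0 'c::monoid_add)"
  by (rule poly_mapping_eqI) (simp add: lookup_part lookup_add)

lemma part_diff: "part P (f - g) = part P f - part P (g :: 'e \<Rightarrow>\<^sub>0 'c::ab_group_add)"
  by (rule poly_mapping_eqI) (simp add: lookup_part lookup_minus)

lemma part_sum: "part P (sum f A) = (\<Sum>a\<in>A. part P (f a :: 'e \<Rightarrow>\<^sub>0 'c::comm_monoid_add))"
  by (induction A rule: infinite_finite_induct) (simp_all add: part_add)

lemma part_id: "(\<And>e. e \<in> Poly_Mapping.keys f \<Longrightarrow> P e) \<Longrightarrow> part P f = f"
  by (rule poly_mapping_eqI) (auto simp: lookup_part in_keys_iff)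

lemma part_none: "(\<And>e. e \<in> Poly_Mapping.keys f \<Longrightarrow> \<not> P e) \<Longrightarrow> part P f = 0"
  by (rule poly_mapping_eqI) (auto simp: lookup_part in_keys_iff)

lemma part_split: "part P f + part (\<lambda>e. \<not> P e) f = (f :: 'e \<Rightarrow>\<^sub>0 'c::monoid_add)"
  by (rule poly_mapping_eqI) (simp add: lookup_part lookup_add)

lemma part_disjoint_sum:
  assumes "finite D"
  shows "part (\<lambda>e. w e \<in> D) f = (\<Sum>d\<in>D. part (\<lambda>e. w e = d) (f :: 'e \<Rightarrow>\<^sub>0 'c::comm_monoid_add))"
  by (rule poly_mapping_eqI) (use assms in \<open>simp add: lookup_part lookup_sum sum.delta\<close>)

definition supported :: "('e \<Rightarrow> bool) \<Rightarrow> ('e \<Rightarrow>\<^sub>0 'c::zero) \<Rightarrow> bool" where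
  "supported P f \<longleftrightarrow> (\<forall>e\<in>Poly_Mapping.keys f. P e)"

lemma supported_part: "supported P (part P f)"
  by (simp add: supported_def keys_part)

lemma supported_partI: "supported P f \<Longrightarrow> supported P (part P' f)"
  by (simp add: supported_def keys_part)

lemma supported_zero [simp]: "supported P 0"
  by (simp add: supported_def)

lemma supported_add: "supported P f \<Longrightarrow> supported P g \<Longrightarrow> supported P (f + g)"
  using keys_add[of f g] by (auto simp: supported_def)

lemma supported_diff:
  "supported P f \<Longrightarrow> supported P g \<Longrightarrow> supported P (f - g :: 'e \<Rightarrow>\<^sub>0 'c::ab_group_add)"
  by (auto simp: supported_def in_keys_iff lookup_minus)

lemma supported_uminus: "supported P f \<Longrightarrow> supported P (- f :: 'e \<Rightarrow>\<^sub>0 'c::ab_group_add)"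
  using supported_diff[of P 0 f] by simp

lemma supported_sum: "(\<And>a. a \<in> A \<Longrightarrow> supported P (f a)) \<Longrightarrow> supported P (sum f A)"
  by (induction A rule: infinite_finite_induct) (auto intro: supported_add)

lemma supported_mult:
  assumes "supported P f" "supported Q g" "\<And>a b. P a \<Longrightarrow> Q b \<Longrightarrow> R (a + b)"
  shows "supported R (f * g)"
  using assms keys_mult[of f g] by (fastforce simp: supported_def)

lemma supported_mono: "supported P f \<Longrightarrow> (\<And>e. P e \<Longrightarrow> Q e) \<Longrightarrow> supported Q f"
  by (auto simp: supported_def)

lemma supported_single: "P e \<Longrightarrow> supported P (Poly_Mapping.single e c)"
  by (simp add: supported_def)

lemma part_supported: "supported P f \<Longrightarrow> part P f = f"
  by (auto intro: part_id simp: supported_def)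

lemma part_supported_none: "supported Q f \<Longrightarrow> (\<And>e. Q e \<Longrightarrow> \<not> P e) \<Longrightarrow> part P f = 0"
  by (auto intro: part_none simp: supported_def)

text \<open>The gradings in use come from additive weights of the exponents: the degree in the first and
  in the second pair of variables, and a positive combination of these.\<close>

definition additive_weight :: "(('v \<Rightarrow>\<^sub>0 nat) \<Rightarrow> nat) \<Rightarrow> bool" where
  "additive_weight w \<longleftrightarrow> (\<forall>a b. w (a + b) = w a + w b)"

lemma additiveD: "additive_weight w \<Longrightarrow> w (a + b) = w a + w b"
  by (simp add: additive_weight_def)

lemma additive_zero: "additive_weight w \<Longrightarrow> w 0 = 0"
  using additiveD[of w 0 0] by simp

abbreviation gpart :: "(('v \<Rightarrow>\<^sub>0 nat) \<Rightarrow> nat) \<Rightarrow> nat \<Rightarrow> (('v \<Rightarrow>\<^sub>0 nat) \<Rightarrow>\<^sub>0 'k::zero) \<Rightarrow> ('v \<Rightarrow>\<^sub>0 nat) \<Rightarrow>\<^sub>0 'k" where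
  "gpart w n f \<equiv> part (\<lambda>e. w e = n) f"

abbreviation homog :: "(('v \<Rightarrow>\<^sub>0 nat) \<Rightarrow> nat) \<Rightarrow> nat \<Rightarrow> (('v \<Rightarrow>\<^sub>0 nat) \<Rightarrow>\<^sub>0 'k::zero) \<Rightarrow> bool" where
  "homog w n f \<equiv> supported (\<lambda>e. w e = n) f"

abbreviation below :: "(('v \<Rightarrow>\<^sub>0 nat) \<Rightarrow> nat) \<Rightarrow> nat \<Rightarrow> (('v \<Rightarrow>\<^sub>0 nat) \<Rightarrow>\<^sub>0 'k::zero) \<Rightarrow> bool" where
  "below w n f \<equiv> supported (\<lambda>e. w e < n) f"

lemma homog_mult:
  "additive_weight w \<Longrightarrow> homog w m f \<Longrightarrow> homog w n g \<Longrightarrow> homog w (m + n) (f * g)"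
  by (erule supported_mult, assumption) (simp add: additiveD)

lemma homog_power: "additive_weight w \<Longrightarrow> homog w m f \<Longrightarrow> homog w (n * m) (f ^ n)"
proof (induction n)
  case 0 then show ?case by (simp add: supported_def additive_zero)
next
  case (Suc n) then show ?case using homog_mult[of w m f "n * m" "f ^ n"] by simp
qed

lemma below_exists: "\<exists>n. below w n f"
  by (rule exI[of _ "Suc (Max (w ` Poly_Mapping.keys f))"]) (auto simp: supported_def less_Suc_eq_le)

lemma below_decompose: "below w n f \<Longrightarrow> f = (\<Sum>i<n. gpart w i f)"
  using part_disjoint_sum[of "{..<n}" w f] part_supported[of "\<lambda>e. w e \<in> {..<n}" f] by simp

lemma gpart_mult_homog:
  assumes w: "additive_weight w" and u: "homog w m u"
  shows "gpart w (m + n) (u * f) = u * gpart w n f"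
proof -
  have "gpart w (m + n) (u * f) = gpart w (m + n) (u * gpart w n f) + gpart w (m + n) (u * part (\<lambda>e. w e \<noteq> n) f)"
    using part_split[of "\<lambda>e. w e = n" f] by (metis distrib_left part_add)
  moreover have "gpart w (m + n) (u * gpart w n f) = u * gpart w n f"
    by (rule part_supported, rule homog_mult[OF w u supported_part])
  moreover have "gpart w (m + n) (u * part (\<lambda>e. w e \<noteq> n) f) = 0"
    by (rule part_supported_none[of "\<lambda>e. w e \<noteq> m + n"], rule supported_mult[OF u supported_part])
       (auto simp: additiveD[OF w])
  ultimately show ?thesis by simp
qed

lemma gpart_mult_homog_less:
  assumes w: "additive_weight w" and u: "homog w m u" and "n < m"
  shows "gpart w n (u * f) = 0"
proof (rule part_supported_none[of "\<lambda>e. w e \<ge> m"])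
  show "supported (\<lambda>e. m \<le> w e) (u * f)"
    by (rule supported_mult[OF u, of "\<lambda>_. True"]) (auto simp: additiveD[OF w] supported_def)
qed (use assms in auto)

lemma below_mult:
  "additive_weight w \<Longrightarrow> below w m f \<Longrightarrow> supported (\<lambda>e. w e \<le> n) g \<Longrightarrow> below w (m + n) (f * g)"
  by (erule supported_mult, assumption) (simp add: additiveD)

definition xdeg :: "(cox_var \<Rightarrow>\<^sub>0 nat) \<Rightarrow> nat" where
  "xdeg e = Poly_Mapping.lookup e X10 + Poly_Mapping.lookup e X11"

definition ydeg :: "(cox_var \<Rightarrow>\<^sub>0 nat) \<Rightarrow> nat" where
  "ydeg e = Poly_Mapping.lookup e X20 + Poly_Mapping.lookup e X21"

lemma bidegree_eq: "bidegree e = (xdeg e, ydeg e)"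
  by (simp add: bidegree_def xdeg_def ydeg_def)

lemma additive_xdeg: "additive_weight xdeg" and additive_ydeg: "additive_weight ydeg"
  by (simp_all add: additive_weight_def xdeg_def ydeg_def lookup_add)

lemma additive_weighted: "additive_weight v \<Longrightarrow> additive_weight w \<Longrightarrow> additive_weight (\<lambda>e. a * v e + b * w e)"
  by (simp add: additive_weight_def algebra_simps)

lemma bihom_component_eq: "bihom_component d f = part (\<lambda>e. bidegree e = d) f"
proof (rule poly_mapping_eqI)
  fix k
  have "Poly_Mapping.lookup (bihom_component d f) k =
      (\<Sum>e\<in>{e \<in> Poly_Mapping.keys f. bidegree e = d}. (Poly_Mapping.lookup f e when e = k))"
    by (simp add: bihom_component_def lookup_sum lookup_single)
  also have "\<dots> = Poly_Mapping.lookup (part (\<lambda>e. bidegree e = d) f) k"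
    by (cases "k \<in> Poly_Mapping.keys f")
       (auto simp: when_def sum.delta lookup_part not_in_keys_iff_lookup_eq_zero)
  finally show "Poly_Mapping.lookup (bihom_component d f) k = Poly_Mapping.lookup (part (\<lambda>e. bidegree e = d) f) k" .
qed

text \<open>A part that is described by the bidegree is a finite sum of bihomogeneous components, so the
  ideal is homogeneous for every grading that is coarser than the bigrading.\<close>

lemma homogeneous_ideal_part:
  assumes J: "homogeneous_ideal J" and f: "f \<in> J"
  shows "part (\<lambda>e. R (xdeg e) (ydeg e)) f \<in> J"
proof -
  have id: "ideal J type_ring" and comp: "\<And>f d. f \<in> J \<Longrightarrow> part (\<lambda>e. bidegree e = d) f \<in> J"
    using J by (auto simp: homogeneous_ideal_def bihom_component_eq)
  define D where "D = {d \<in> bidegree ` Poly_Mapping.keys f. R (fst d) (snd d)}"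
  have "finite D" by (simp add: D_def)
  have "part (\<lambda>e. R (xdeg e) (ydeg e)) f = part (\<lambda>e. bidegree e \<in> D) f"
    by (rule poly_mapping_eqI)
       (auto simp: lookup_part D_def bidegree_eq in_keys_iff)
  also have "\<dots> = (\<Sum>d\<in>D. part (\<lambda>e. bidegree e = d) f)"
    by (rule part_disjoint_sum[OF \<open>finite D\<close>])
  also have "\<dots> \<in> J" by (rule type_ideal_sum[OF id comp[OF f]])
  finally show ?thesis .
qed


section \<open>Polynomial relations modulo a maximal ideal\<close>

text \<open>The Cox ring as a quotient of an iterated polynomial ring. The innermost variable is redundant
  as a generator and goes to a prescribed element \<open>\<eta>\<close>: after contraction along the four other
  variables, an ideal turns into the ideal of polynomial relations of \<open>\<eta>\<close>.\<close>

abbreviation cox_presentation :: "'k::field cox \<Rightarrow> 'k poly poly poly poly poly \<Rightarrow> 'k cox" where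
  "cox_presentation \<eta> \<equiv> eval_poly (eval_poly (eval_poly (eval_poly (eval_poly const \<eta>)
     (cox_gen X10)) (cox_gen X11)) (cox_gen X20)) (cox_gen X21)"

lemma cox_presentation_hom: "comm_ring_hom (cox_presentation \<eta>)"
  by (intro eval_poly_hom const_hom)

lemma cox_presentation_surj: "surj (cox_presentation \<eta>)"
proof -
  interpret comm_ring_hom "cox_presentation \<eta>" by (rule cox_presentation_hom)
  note homs = const_hom eval_poly_hom
  have "f \<in> range (cox_presentation \<eta>)" for f
  proof (induction f rule: cox_induct)
    case (const c)
    have "cox_presentation \<eta> [:[:[:[:[:c:]:]:]:]:] = const c"
      by (simp add: eval_poly_const homs)
    then show ?case by (metis rangeI)
  next
    case (var v)
    have "cox_gen v = cox_presentation \<eta> (case v of X10 \<Rightarrow> [:[:[:[:0, 1:]:]:]:] | X11 \<Rightarrow> [:[:[:0, 1:]:]:]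
        | X20 \<Rightarrow> [:[:0, 1:]:] | X21 \<Rightarrow> [:0, 1:])"
      by (cases v) (simp_all only: eval_poly_const eval_poly_X homs cox_var.case)
    then show ?case by (metis rangeI)
  next
    case (add f g)
    then obtain a b where "f = cox_presentation \<eta> a" "g = cox_presentation \<eta> b" by blast
    then have "f + g = cox_presentation \<eta> (a + b)" by (simp only: hom_add)
    then show ?case by (simp only: rangeI)
  next
    case (mult f g)
    then obtain a b where "f = cox_presentation \<eta> a" "g = cox_presentation \<eta> b" by blast
    then have "f * g = cox_presentation \<eta> (a * b)" by (simp only: hom_mult)
    then show ?case by (simp only: rangeI)
  qed
  then show ?thesis by auto
qed

lemma noetherian_cox: "noetherian_ring (cox_ring :: 'k::field cox ring)"
  by (rule noetherian_type_surj[OF _ cox_presentation_hom[of 0] cox_presentation_surj])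
     (intro hilbert_basis noetherian_type_field)

text \<open>The preimage of \<open>P\<close> under the presentation is a Goldman ideal, and so are its contractions.
  The fourth one is the ideal of all \<open>p \<in> k[T]\<close> with \<open>p(\<eta>) \<in> P\<close>.\<close>

theorem weak_nullstellensatz:
  assumes P: "maximalideal P (cox_ring :: 'k::field cox ring)"
  obtains p where "lead_coeff p = 1" "degree p > 0" "eval_poly const \<eta> p \<in> P"
proof -
  let ?\<psi> = "cox_presentation \<eta>"
  note homs = const_hom eval_poly_hom
  have "goldman_ideal (?\<psi> -` P)"
    by (rule hom_vimage_maximal[OF cox_presentation_hom cox_presentation_surj P])
  from goldman_contraction(1)[OF goldman_contraction(1)[OF goldman_contraction(1)[OF
      goldman_contraction(1)[OF this]]]]
  have "goldman_ideal {a. [:[:[:[:a:]:]:]:] \<in> ?\<psi> -` P}" by simp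
  moreover have "{a. [:[:[:[:a:]:]:]:] \<in> ?\<psi> -` P} = {a. eval_poly const \<eta> a \<in> P}"
    by (simp add: eval_poly_const homs)
  ultimately have "goldman_ideal {a. eval_poly const \<eta> a \<in> P}" by simp
  then show ?thesis by (rule goldman_field_poly) (use that in auto)
qed


section \<open>Quotient rings\<close>

text \<open>Quotient rings enter through a surjection from a type class ring: their ideals are then
  studied as preimages, where ring operations are those of the type.\<close>

locale ring_surjection =
  fixes h :: "'a::comm_ring_1 \<Rightarrow> 'b" and S :: "('b, 'c) ring_scheme" (structure)
  assumes cring: "cring S" and hom: "h \<in> Ring.ring_hom type_ring S"
    and surj: "range h = carrier S"
begin

sublocale S: cring S by (rule cring)

sublocale h: ring_hom_ring type_ring S h
  by (rule ring_hom_ringI2) (auto intro: hom S.ring_axioms)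

lemma h_closed: "h a \<in> carrier S"
  using surj by blast

lemma h_add: "h (a + b) = h a \<oplus> h b" and h_mult: "h (a * b) = h a \<otimes> h b"
  and h_one: "h 1 = \<one>" and h_zero: "h 0 = \<zero>"
  using h.hom_add[of a b] h.hom_mult[of a b] h.hom_one h.hom_zero by simp_all

definition kernel :: "'a set" where "kernel = {a. h a = \<zero>}"

lemma h_eq_iff: "h a = h b \<longleftrightarrow> a - b \<in> kernel"
proof -
  have "h (a - b) \<oplus> h b = h a" by (simp flip: h_add)
  moreover have "\<zero> \<oplus> h b = h b" using h_closed by (rule S.l_zero)
  ultimately show ?thesis unfolding kernel_def mem_Collect_eq
    using S.add.right_cancel[OF h_closed[of b] h_closed[of "a - b"] S.zero_closed] by metis
qed

lemma kernel_ideal: "ideal kernel type_ring"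
  unfolding kernel_def type_ideal_iff by (auto simp: h_add h_mult h_zero h_closed)

lemma vimage_ideal: "ideal J S \<Longrightarrow> ideal (h -` J) type_ring"
  using h.ideal_vimage[of J] by (simp add: vimage_def)

lemma vimage_prime: "primeideal P S \<Longrightarrow> primeideal (h -` P) type_ring"
  using h.primeideal_vimage[of P] by (simp add: vimage_def)

lemma kernel_subset_vimage: "ideal J S \<Longrightarrow> kernel \<subseteq> h -` J"
  using additive_subgroup.zero_closed[OF ideal.axioms(1)] by (auto simp: kernel_def)

lemma image_vimage: "J \<subseteq> carrier S \<Longrightarrow> h ` (h -` J) = J"
  using surj by auto

lemma in_image_iff:
  assumes "ideal J type_ring" "kernel \<subseteq> J"
  shows "h a \<in> h ` J \<longleftrightarrow> a \<in> J"
  using assms h_eq_iff type_ideal_cong[OF assms(1)] by (auto simp: image_iff)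

lemma image_ideal:
  assumes "ideal J type_ring"
  shows "ideal (h ` J) S"
proof (rule idealI[OF S.ring_axioms])
  show "subgroup (h ` J) (add_monoid S)"
    by (rule h.img_is_add_subgroup[OF additive_subgroup.a_subgroup[OF ideal.axioms(1)[OF assms]]])
next
  fix a x assume a: "a \<in> h ` J" and x: "x \<in> carrier S"
  obtain b where b: "b \<in> J" "a = h b" using a by blast
  obtain y where y: "x = h y" using x surj by blast
  show "x \<otimes> a \<in> h ` J"
    unfolding b(2) y h_mult[symmetric] by (intro imageI type_ideal_mult[OF assms b(1)])
  show "a \<otimes> x \<in> h ` J"
    unfolding b(2) y h_mult[symmetric] by (intro imageI type_ideal_mult_right[OF assms b(1)])
qed

lemma image_prime:
  assumes P: "primeideal P type_ring" and K: "kernel \<subseteq> P"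
  shows "primeideal (h ` P) S"
proof -
  have id: "ideal P type_ring" using P by (simp add: type_primeideal_iff)
  note iff = in_image_iff[OF id K]
  show ?thesis
  proof (rule primeidealI[OF image_ideal[OF id] cring])
    show "carrier S \<noteq> h ` P"
      using iff[of 1] P h_closed by (auto simp: type_primeideal_iff)
  next
    fix x y assume "x \<in> carrier S" "y \<in> carrier S" and xy: "x \<otimes> y \<in> h ` P"
    then obtain a b where ab: "x = h a" "y = h b" using surj by blast
    then have "a * b \<in> P" using xy iff by (simp flip: h_mult)
    then show "x \<in> h ` P \<or> y \<in> h ` P" using P ab by (auto simp: type_primeideal_iff)
  qed
qed

lemma vimage_maximal:
  assumes "maximalideal P S"
  shows "maximalideal (h -` P) type_ring"
proof -
  interpret P: maximalideal P S by fact
  show ?thesis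
  proof (rule maximalidealI[OF vimage_ideal[OF P.is_ideal]])
    have "P \<noteq> carrier S" using P.I_notcarr by blast
    then have "\<one> \<notin> P" using P.one_imp_carrier by blast
    then show "carrier type_ring \<noteq> h -` P" using h_one by (metis UNIV_I type_ring_simps(1) vimage_eq)
  next
    fix J assume J: "ideal J type_ring" "h -` P \<subseteq> J" "J \<subseteq> carrier type_ring"
    have K: "kernel \<subseteq> J" using kernel_subset_vimage[OF P.is_ideal] J(2) by blast
    have "P \<subseteq> h ` J" using J(2) image_vimage[of P] P.a_subset by blast
    moreover have "h ` J \<subseteq> carrier S" using h_closed by blast
    ultimately have "h ` J = P \<or> h ` J = carrier S" using P.I_maximal[OF image_ideal[OF J(1)]] by blast
    then show "J = h -` P \<or> J = carrier type_ring"
      using in_image_iff[OF J(1) K] h_closed by auto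
  qed
qed

text \<open>The images of \<open>P\<close> and \<open>P'\<close> would form a chain of length \<open>1\<close>.\<close>

lemma no_prime_inclusion:
  assumes dim: "krull_dim S \<le> 0"
    and P: "primeideal P type_ring" "primeideal P' type_ring" and K: "kernel \<subseteq> P" and sub: "P \<subset> P'"
  shows False
proof -
  have K': "kernel \<subseteq> P'" using K sub by blast
  have "h ` P \<subset> h ` P'"
  proof -
    obtain a where a: "a \<in> P'" "a \<notin> P" using sub by blast
    then have "h a \<in> h ` P'" "h a \<notin> h ` P"
      using in_image_iff[of P a] P(1) K by (auto simp: type_primeideal_iff)
    then show ?thesis using sub by blast
  qed
  then have "prime_chain S [h ` P, h ` P']"
    using image_prime[OF P(1) K] image_prime[OF P(2) K'] by (simp add: prime_chain_def)
  then have "ereal (real (length [h ` P, h ` P'] - 1)) \<le> krull_dim S"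
    unfolding krull_dim_def by (intro Sup_upper) blast
  then have "ereal 1 \<le> 0" using dim by (metis One_nat_def diff_Suc_1 length_Cons list.size(3) of_nat_1 order_trans)
  then show False by simp
qed

end

lemma type_quotient_surjection:
  assumes "ideal J (type_ring :: 'a::comm_ring_1 ring)"
  shows "ring_surjection (\<lambda>a. J +>\<^bsub>type_ring\<^esub> a) (type_ring Quot J)"
    and "ring_surjection.kernel (\<lambda>a. J +>\<^bsub>type_ring\<^esub> a) (type_ring Quot J) = J"
proof -
  interpret J: ideal J "type_ring :: 'a ring" by fact
  show surj: "ring_surjection (\<lambda>a. J +>\<^bsub>type_ring\<^esub> a) (type_ring Quot J)"
  proof (rule ring_surjection.intro)
    show "cring (type_ring Quot J)" by (rule J.quotient_is_cring[OF type_ring_cring])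
    show "(+>\<^bsub>type_ring\<^esub>) J \<in> Ring.ring_hom type_ring (type_ring Quot J)" by (rule J.rcos_ring_hom)
    show "range ((+>\<^bsub>type_ring\<^esub>) J) = carrier (type_ring Quot J)"
      by (auto simp: FactRing_def A_RCOSETS_def')
  qed
  interpret ring_surjection "\<lambda>a. J +>\<^bsub>type_ring\<^esub> a" "type_ring Quot J" by fact
  have "(J +>\<^bsub>type_ring\<^esub> a = J) \<longleftrightarrow> a \<in> J" for a
    using J.a_rcos_const[of a] J.a_rcos_self[of a] by auto
  moreover have "\<zero>\<^bsub>type_ring Quot J\<^esub> = J" by (simp add: FactRing_def)
  ultimately show "kernel = J" unfolding kernel_def by auto
qed


section \<open>Saturation\<close>

lemma weight_ideal:
  assumes "additive_weight w"
  shows "ideal {f. supported (\<lambda>e. n \<le> w e) f} (type_ring :: (('v \<Rightarrow>\<^sub>0 nat) \<Rightarrow>\<^sub>0 'k::field) ring)"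
proof (rule type_idealI)
  show "r * a \<in> {f. supported (\<lambda>e. n \<le> w e) f}" if "a \<in> {f. supported (\<lambda>e. n \<le> w e) f}"
    for a r :: "('v \<Rightarrow>\<^sub>0 nat) \<Rightarrow>\<^sub>0 'k"
    using that supported_mult[of "\<lambda>_. True" r "\<lambda>e. n \<le> w e" a "\<lambda>e. n \<le> w e"]
    by (auto simp: additiveD[OF assms] supported_def)
qed (auto intro: supported_add)

lemma irrelevant_weight:
  assumes "w = xdeg \<or> w = ydeg"
  shows "irrelevant_ideal \<subseteq> {f :: 'k::field cox. supported (\<lambda>e. 1 \<le> w e) f}"
proof -
  have "additive_weight w" using assms additive_xdeg additive_ydeg by auto
  note I = weight_ideal[OF this, of 1, where 'k = 'k]
  have "Idl\<^bsub>cox_ring\<^esub> {cox_gen X10, cox_gen X11} \<subseteq> {f :: 'k cox. supported (\<lambda>e. 1 \<le> w e) f}" if "w = xdeg"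
    by (rule genideal_mono_type[OF I]) (simp add: that supported_def cox_gen_def xdeg_def)
  moreover have "Idl\<^bsub>cox_ring\<^esub> {cox_gen X20, cox_gen X21} \<subseteq> {f :: 'k cox. supported (\<lambda>e. 1 \<le> w e) f}" if "w = ydeg"
    by (rule genideal_mono_type[OF I]) (simp add: that supported_def cox_gen_def ydeg_def)
  ultimately show ?thesis using assms by (auto simp: irrelevant_ideal_def)
qed

lemma irrelevant_power_weight:
  assumes "w = xdeg \<or> w = ydeg"
  shows "irrelevant_ideal [^]\<^bsub>ideals_set cox_ring\<^esub> (n::nat) \<subseteq> {f :: 'k::field cox. supported (\<lambda>e. n \<le> w e) f}"
proof (induction n)
  case 0
  show ?case by (simp add: supported_def)
next
  case (Suc n)
  have w: "additive_weight w" using assms additive_xdeg additive_ydeg by auto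
  have "f \<in> {f. supported (\<lambda>e. Suc n \<le> w e) f}"
    if "f \<in> ideal_prod cox_ring (irrelevant_ideal [^]\<^bsub>ideals_set cox_ring\<^esub> n) irrelevant_ideal" for f :: "'k cox"
    using that
  proof induction
    case (prod i j)
    then have "supported (\<lambda>e. n \<le> w e) i" "supported (\<lambda>e. 1 \<le> w e) j"
      using Suc irrelevant_weight[OF assms] by auto
    then have "supported (\<lambda>e. Suc n \<le> w e) (i * j)"
      by (rule supported_mult) (simp add: additiveD[OF w])
    then show ?case by simp
  next
    case (sum s1 s2)
    then show ?case by (auto intro: supported_add)
  qed
  then show ?case by (auto simp: ideals_set_def nat_pow_def)
qed

lemma monomial_var_power:
  assumes "n \<le> Poly_Mapping.lookup e v"
  shows "Poly_Mapping.single e (c :: 'k::field) =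
    cox_gen v ^ n * Poly_Mapping.single (e - Poly_Mapping.single v n) c"
proof -
  have "e = Poly_Mapping.single v n + (e - Poly_Mapping.single v n)"
    by (rule poly_mapping_eqI) (use assms in \<open>auto simp: lookup_add lookup_minus lookup_single when_def\<close>)
  then show ?thesis by (simp add: cox_gen_power mult_single flip: single_add)
qed

text \<open>Every monomial of degree at least \<open>m + n\<close> in \<open>u\<close> and \<open>v\<close> is divisible by \<open>u\<^sup>m\<close> or \<open>v\<^sup>n\<close>, and
  \<open>B\<^bsup>m+n\<^esup>\<close> consists of combinations of such monomials, so it multiplies \<open>f\<close> into \<open>I\<close>. In other
  words, an ideal that is saturated with respect to \<open>B\<close> is saturated with respect to \<open>(x\<^sub>0,
  x\<^sub>1)\<close> and \<open>(y\<^sub>0, y\<^sub>1)\<close>.\<close>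

lemma saturated_cancel:
  fixes I :: "'k::field cox set"
  assumes I: "ideal I cox_ring" and sat: "saturation cox_ring I irrelevant_ideal = I"
    and uv: "(u, v) = (X10, X11) \<or> (u, v) = (X20, X21)"
    and f: "cox_gen u ^ m * f \<in> I" "cox_gen v ^ n * f \<in> I"
  shows "f \<in> I"
proof -
  define w where "w = (if u = X10 then xdeg else ydeg)"
  have w: "w = xdeg \<or> w = ydeg" and we: "w e = Poly_Mapping.lookup e u + Poly_Mapping.lookup e v" for e
    using uv by (auto simp: w_def xdeg_def ydeg_def)
  have "f * g \<in> I" if g: "supported (\<lambda>e. m + n \<le> w e) g" for g
  proof -
    have "f * Poly_Mapping.single e c \<in> I" if e: "m + n \<le> w e" for e c
    proof -
      consider "m \<le> Poly_Mapping.lookup e u" | "n \<le> Poly_Mapping.lookup e v" using e we[of e] by linarith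
      then show ?thesis
      proof cases
        case 1
        show ?thesis unfolding monomial_var_power[OF 1]
          using type_ideal_mult_right[OF I f(1), of "Poly_Mapping.single (e - Poly_Mapping.single u m) c"]
          by (simp add: mult_ac)
      next
        case 2
        show ?thesis unfolding monomial_var_power[OF 2]
          using type_ideal_mult_right[OF I f(2), of "Poly_Mapping.single (e - Poly_Mapping.single v n) c"]
          by (simp add: mult_ac)
      qed
    qed
    then have "(\<Sum>e\<in>Poly_Mapping.keys g. f * Poly_Mapping.single e (Poly_Mapping.lookup g e)) \<in> I"
      using g by (intro type_ideal_sum[OF I]) (auto simp: supported_def)
    then show ?thesis by (simp add: sum_monomials flip: sum_distrib_left)
  qed
  then have "f \<in> saturation cox_ring I irrelevant_ideal"
    unfolding saturation_def using irrelevant_power_weight[OF w, of "m + n"]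
    by (auto intro!: exI[of _ "m + n"])
  then show ?thesis using sat by simp
qed


section \<open>Forms vanishing on a zero-dimensional subscheme\<close>

text \<open>A form of degree \<open>d\<close> in \<open>u\<close> and \<open>v\<close> alone, not vanishing at the point \<open>u = 0\<close> of the
  projective line.\<close>

definition monic_form :: "cox_var \<Rightarrow> cox_var \<Rightarrow> nat \<Rightarrow> 'k::field cox \<Rightarrow> bool" where
  "monic_form u v d G \<longleftrightarrow>
     (\<exists>c h. c \<noteq> 0 \<and> G = const c * cox_gen v ^ d + cox_gen u * h) \<and>
     supported (\<lambda>e. Poly_Mapping.lookup e u + Poly_Mapping.lookup e v = d \<and>
       (\<forall>t. t \<noteq> u \<longrightarrow> t \<noteq> v \<longrightarrow> Poly_Mapping.lookup e t = 0)) G"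

lemma monic_form_mult:
  assumes "monic_form u v d G" "monic_form u v d' G'"
  shows "monic_form u v (d + d') (G * G')"
proof -
  obtain c h c' h' where *: "c \<noteq> 0" "G = const c * cox_gen v ^ d + cox_gen u * h"
      "c' \<noteq> 0" "G' = const c' * cox_gen v ^ d' + cox_gen u * h'"
    using assms by (auto simp: monic_form_def)
  have "G * G' = const (c * c') * cox_gen v ^ (d + d') +
      cox_gen u * (h * G' + const c * cox_gen v ^ d * h')"
    unfolding *(2,4) by (simp add: const_mult power_add algebra_simps)
  moreover have "supported (\<lambda>e. Poly_Mapping.lookup e u + Poly_Mapping.lookup e v = d + d' \<and>
       (\<forall>t. t \<noteq> u \<longrightarrow> t \<noteq> v \<longrightarrow> Poly_Mapping.lookup e t = 0)) (G * G')"
    by (rule supported_mult[OF assms[unfolded monic_form_def, THEN conjunct2]]) (auto simp: lookup_add)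
  moreover have "c * c' \<noteq> 0" using * by simp
  ultimately show ?thesis unfolding monic_form_def by metis
qed

lemma monic_form_var: "u \<noteq> v \<Longrightarrow> monic_form u v 1 (cox_gen v :: 'k::field cox)"
  unfolding monic_form_def supported_def
  by (intro conjI exI[of _ 1] exI[of _ 0]) (auto simp: cox_gen_def lookup_single when_def)

definition homogenize :: "cox_var \<Rightarrow> cox_var \<Rightarrow> 'k::field poly \<Rightarrow> 'k cox" where
  "homogenize u v q = (\<Sum>i\<le>degree q. const (coeff q i) * cox_gen v ^ i * cox_gen u ^ (degree q - i))"

lemma monic_form_homogenize:
  fixes q :: "'k::field poly"
  assumes "q \<noteq> 0" "u \<noteq> v"
  shows "monic_form u v (degree q) (homogenize u v q)"
proof -
  let ?n = "degree q"
  have "homogenize u v q = const (lead_coeff q) * cox_gen v ^ ?n +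
      (\<Sum>i<?n. const (coeff q i) * cox_gen v ^ i * cox_gen u ^ (?n - i))"
    unfolding homogenize_def by (simp add: lessThan_Suc_atMost[symmetric] add.commute)
  also have "(\<Sum>i<?n. const (coeff q i) * cox_gen v ^ i * cox_gen u ^ (?n - i)) =
      cox_gen u * (\<Sum>i<?n. const (coeff q i) * cox_gen v ^ i * cox_gen u ^ (?n - i - 1))"
    unfolding sum_distrib_left
  proof (rule sum.cong)
    fix i assume "i \<in> {..<?n}"
    then have "?n - i = Suc (?n - i - 1)" by auto
    then have "cox_gen u ^ (?n - i) = cox_gen u * (cox_gen u ^ (?n - i - 1) :: 'k cox)"
      by (metis power_Suc)
    then show "const (coeff q i) * cox_gen v ^ i * cox_gen u ^ (?n - i) =
        cox_gen u * (const (coeff q i) * cox_gen v ^ i * cox_gen u ^ (?n - i - 1))"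
      by (simp add: mult_ac)
  qed auto
  finally have "homogenize u v q = const (lead_coeff q) * cox_gen v ^ ?n +
      cox_gen u * (\<Sum>i<?n. const (coeff q i) * cox_gen v ^ i * cox_gen u ^ (?n - i - 1))" .
  moreover have "lead_coeff q \<noteq> 0" using assms(1) by simp
  ultimately have "\<exists>c h. c \<noteq> 0 \<and> homogenize u v q = const c * cox_gen v ^ ?n + cox_gen u * h"
    by blast
  moreover have "supported (\<lambda>e. Poly_Mapping.lookup e u + Poly_Mapping.lookup e v = ?n \<and>
       (\<forall>t. t \<noteq> u \<longrightarrow> t \<noteq> v \<longrightarrow> Poly_Mapping.lookup e t = 0)) (homogenize u v q)"
    unfolding homogenize_def const_def cox_gen_power mult_single
    using assms(2) by (intro supported_sum supported_single) (auto simp: lookup_add lookup_single when_def)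
  ultimately show ?thesis unfolding monic_form_def by blast
qed

subsection \<open>Laurent polynomials\<close>

abbreviation laurent_mon :: "(cox_var \<Rightarrow>\<^sub>0 int) \<Rightarrow> 'k::field laurent" where
  "laurent_mon e \<equiv> Poly_Mapping.single e 1"

definition int_exp :: "(cox_var \<Rightarrow>\<^sub>0 nat) \<Rightarrow> (cox_var \<Rightarrow>\<^sub>0 int)" where
  "int_exp e = Poly_Mapping.map int e"

lemma lookup_int_exp: "Poly_Mapping.lookup (int_exp e) v = int (Poly_Mapping.lookup e v)"
  by (simp add: int_exp_def map.rep_eq when_def)

lemma int_exp_add: "int_exp (a + b) = int_exp a + int_exp b"
  by (rule poly_mapping_eqI) (simp add: lookup_int_exp lookup_add)

lemma int_exp_zero: "int_exp 0 = 0"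
  by (rule poly_mapping_eqI) (simp add: lookup_int_exp)

lemma int_exp_single: "int_exp (Poly_Mapping.single v n) = Poly_Mapping.single v (int n)"
  by (rule poly_mapping_eqI) (simp add: lookup_int_exp lookup_single when_def)

lemma int_exp_inj: "int_exp a = int_exp b \<longleftrightarrow> a = b"
  by (metis lookup_int_exp of_nat_eq_iff poly_mapping_eqI)

lemma laurent_of_sum:
  assumes "finite A" "Poly_Mapping.keys f \<subseteq> A"
  shows "laurent_of f = (\<Sum>e\<in>A. Poly_Mapping.single (int_exp e) (Poly_Mapping.lookup f e))"
  unfolding laurent_of_def int_exp_def[symmetric]
  by (rule sum.mono_neutral_left) (use assms in \<open>auto simp: in_keys_iff\<close>)

lemma lookup_laurent_of: "Poly_Mapping.lookup (laurent_of f) (int_exp e) = Poly_Mapping.lookup f e"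
proof -
  have "Poly_Mapping.lookup (laurent_of f) (int_exp e) =
      (\<Sum>a\<in>insert e (Poly_Mapping.keys f). (Poly_Mapping.lookup f a when a = e))"
    by (subst laurent_of_sum[of "insert e (Poly_Mapping.keys f)"])
       (auto simp: lookup_sum lookup_single int_exp_inj)
  then show ?thesis by (simp add: when_def sum.delta)
qed

lemma laurent_of_inj: "laurent_of f = laurent_of g \<Longrightarrow> f = g"
  by (metis lookup_laurent_of poly_mapping_eqI)

lemma laurent_of_single: "laurent_of (Poly_Mapping.single e c) = Poly_Mapping.single (int_exp e) c"
  by (subst laurent_of_sum[of "{e}"]) auto

lemma laurent_of_add: "laurent_of (f + g) = laurent_of f + laurent_of g"
proof -
  let ?A = "Poly_Mapping.keys f \<union> Poly_Mapping.keys g"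
  show ?thesis
    by (subst (1 2 3) laurent_of_sum[of ?A]) (use keys_add[of f g] in \<open>auto simp: lookup_add single_add sum.distrib\<close>)
qed

lemma laurent_of_mult: "laurent_of (f * g) = laurent_of f * laurent_of (g :: 'k::field cox)"
proof -
  have zero: "laurent_of (0 :: 'k cox) = 0" by (simp add: laurent_of_def)
  have sum: "laurent_of (sum F A) = (\<Sum>a\<in>A. laurent_of (F a))" for A and F :: "(cox_var \<Rightarrow>\<^sub>0 nat) \<Rightarrow> 'k cox"
    by (induction A rule: infinite_finite_induct) (simp_all add: laurent_of_add zero)
  have "laurent_of (f * g) = laurent_of ((\<Sum>a\<in>Poly_Mapping.keys f. Poly_Mapping.single a (Poly_Mapping.lookup f a)) *
      (\<Sum>b\<in>Poly_Mapping.keys g. Poly_Mapping.single b (Poly_Mapping.lookup g b)))"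
    by (simp only: sum_monomials)
  also have "\<dots> = (\<Sum>a\<in>Poly_Mapping.keys f. \<Sum>b\<in>Poly_Mapping.keys g.
      laurent_of (Poly_Mapping.single a (Poly_Mapping.lookup f a)) * laurent_of (Poly_Mapping.single b (Poly_Mapping.lookup g b)))"
    unfolding sum_product sum by (simp add: mult_single laurent_of_single int_exp_add)
  also have "\<dots> = laurent_of (\<Sum>a\<in>Poly_Mapping.keys f. Poly_Mapping.single a (Poly_Mapping.lookup f a)) *
      laurent_of (\<Sum>b\<in>Poly_Mapping.keys g. Poly_Mapping.single b (Poly_Mapping.lookup g b))"
    unfolding sum sum_product ..
  finally show ?thesis by (simp only: sum_monomials)
qed

lemma laurent_of_hom: "comm_ring_hom (laurent_of :: 'k::field cox \<Rightarrow> 'k laurent)"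
proof -
  have "laurent_of 1 = (1 :: 'k laurent)" "laurent_of 0 = (0 :: 'k laurent)"
    using laurent_of_single[of 0 1] by (simp_all add: int_exp_zero laurent_of_def)
  then show ?thesis by unfold_locales (simp_all add: laurent_of_add laurent_of_mult)
qed

definition lconst :: "'k::field \<Rightarrow> 'k laurent" where
  "lconst c = Poly_Mapping.single 0 c"

lemma lconst_hom: "comm_ring_hom lconst"
  by unfold_locales (simp_all add: lconst_def single_add mult_single)

lemma laurent_of_const: "laurent_of (const c) = lconst c"
  by (simp add: const_def lconst_def laurent_of_single int_exp_zero)

lemma laurent_of_gen_power: "laurent_of (cox_gen v ^ n) = laurent_mon (Poly_Mapping.single v (int n))"
  by (simp add: cox_gen_power laurent_of_single int_exp_single)

definition ratio :: "cox_var \<Rightarrow> cox_var \<Rightarrow> 'k::field laurent" where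
  "ratio v u = laurent_mon (Poly_Mapping.single v 1 - Poly_Mapping.single u 1)"

lemma laurent_mon_power:
  "(laurent_mon (Poly_Mapping.single v 1 - Poly_Mapping.single u 1) :: 'k::field laurent) ^ n =
     laurent_mon (Poly_Mapping.single v (int n) - Poly_Mapping.single u (int n))"
proof (induction n)
  case (Suc n)
  have "Poly_Mapping.single v 1 - Poly_Mapping.single u 1 +
      (Poly_Mapping.single v (int n) - Poly_Mapping.single u (int n)) =
      Poly_Mapping.single v (int (Suc n)) - Poly_Mapping.single u (int (Suc n))"
    by (rule poly_mapping_eqI) (simp add: lookup_add lookup_minus lookup_single when_def)
  then show ?case using Suc by (simp add: mult_single)
qed simp

lemma ratio_power:
  "ratio v u ^ n = laurent_mon (Poly_Mapping.single v (int n) - Poly_Mapping.single u (int n))"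
  unfolding ratio_def by (rule laurent_mon_power)

lemma laurent_of_homogenize:
  fixes q :: "'k::field poly"
  shows "laurent_of (homogenize u v q) = laurent_of (cox_gen u ^ degree q) * eval_poly lconst (ratio v u) q"
proof -
  interpret comm_ring_hom laurent_of by (rule laurent_of_hom)
  have *: "laurent_of (const c * (cox_gen v ^ i * cox_gen u ^ (degree q - i))) =
      laurent_of (cox_gen u ^ degree q) * (lconst c * ratio v u ^ i)" if "i \<le> degree q" for i and c :: 'k
  proof -
    have "Poly_Mapping.single v (int i) + Poly_Mapping.single u (int (degree q - i)) =
        Poly_Mapping.single u (int (degree q)) + (Poly_Mapping.single v (int i) - Poly_Mapping.single u (int i))"
      by (rule poly_mapping_eqI) (use that in \<open>simp add: lookup_add lookup_minus lookup_single when_def\<close>)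
    then have "laurent_of (cox_gen v ^ i * cox_gen u ^ (degree q - i)) =
        (laurent_of (cox_gen u ^ degree q) * ratio v u ^ i :: 'k laurent)"
      by (simp only: laurent_of_mult laurent_of_gen_power ratio_power mult_single)
    then show ?thesis by (simp only: laurent_of_mult laurent_of_const mult.left_commute)
  qed
  then show ?thesis
    unfolding homogenize_def eval_poly_altdef[OF lconst_hom] hom_sum sum_distrib_left mult.assoc
    by (intro sum.cong refl *) simp
qed

subsection \<open>Charts\<close>

text \<open>The chart \<open>{u, s}\<close> with affine coordinates \<open>v/u\<close> and \<open>t/s\<close>.\<close>

definition chart_vars :: "cox_var \<Rightarrow> cox_var \<Rightarrow> cox_var \<Rightarrow> cox_var \<Rightarrow> bool" where
  "chart_vars u v s t \<longleftrightarrow>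
     {u, v} = {X10, X11} \<and> {s, t} = {X20, X21} \<or> {u, v} = {X20, X21} \<and> {s, t} = {X10, X11}"

lemma chart_vars_iff:
  "chart_vars u v s t \<longleftrightarrow> (u, v, s, t) \<in>
    {(X10, X11, X20, X21), (X10, X11, X21, X20), (X11, X10, X20, X21), (X11, X10, X21, X20),
     (X20, X21, X10, X11), (X20, X21, X11, X10), (X21, X20, X10, X11), (X21, X20, X11, X10)}"
  unfolding chart_vars_def doubleton_eq_iff by auto

definition chart_hom :: "cox_var \<Rightarrow> cox_var \<Rightarrow> cox_var \<Rightarrow> cox_var \<Rightarrow> 'k::field poly poly \<Rightarrow> 'k laurent" where
  "chart_hom u v s t = eval_poly (eval_poly lconst (ratio v u)) (ratio t s)"

lemma chart_hom: "comm_ring_hom (chart_hom u v s t)"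
  unfolding chart_hom_def by (intro eval_poly_hom lconst_hom)

definition chart_exp :: "cox_var set \<Rightarrow> (cox_var \<Rightarrow>\<^sub>0 int) \<Rightarrow> bool" where
  "chart_exp D e \<longleftrightarrow> bidegree e = (0, 0) \<and> (\<forall>v. v \<notin> D \<longrightarrow> 0 \<le> Poly_Mapping.lookup e v)"

lemma coord_ring_eq: "coord_ring D = type_ring\<lparr>carrier := {f. supported (chart_exp D) f}\<rparr>"
  by (simp add: coord_ring_def supported_def chart_exp_def)

lemma chart_exp_add: "chart_exp D a \<Longrightarrow> chart_exp D b \<Longrightarrow> chart_exp D (a + b)"
  by (auto simp: chart_exp_def bidegree_def lookup_add)

text \<open>An exponent of bidegree \<open>(0, 0)\<close> is determined by its entries \<open>i\<close> at \<open>v\<close> and \<open>j\<close> at \<open>t\<close>. These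
  are nonnegative on the chart, where the monomial is \<open>(v/u)\<^sup>i (t/s)\<^sup>j\<close>.\<close>

lemma chart_hom_range:
  assumes "chart_vars u v s t"
  shows "range (chart_hom u v s t) = {f :: 'k::field laurent. supported (chart_exp {u, s}) f}"
proof
  let ?C = "{f :: 'k laurent. supported (chart_exp {u, s}) f}"
  have zero: "chart_exp {u, s} 0" by (simp add: chart_exp_def bidegree_def)
  have const: "lconst c \<in> ?C" for c
    unfolding lconst_def using supported_single[of "chart_exp {u, s}", OF zero] by blast
  have mult: "f * g \<in> ?C" if "f \<in> ?C" "g \<in> ?C" for f g
    using that supported_mult[of "chart_exp {u, s}" f "chart_exp {u, s}" g "chart_exp {u, s}"]
      chart_exp_add by blast
  have pow: "f ^ n \<in> ?C" if "f \<in> ?C" for f n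
    using that mult const[of 1] by (induction n) (auto simp: lconst_def)
  have ratio: "ratio v u \<in> ?C" "ratio t s \<in> ?C"
    using assms unfolding ratio_def chart_vars_iff
    by (auto intro!: supported_single simp: chart_exp_def bidegree_def lookup_minus lookup_single when_def)
  have inner: "eval_poly lconst (ratio v u) p \<in> ?C" for p
    unfolding eval_poly_altdef[OF lconst_hom] mem_Collect_eq
    by (intro supported_sum) (use mult const pow ratio in blast)
  have "chart_hom u v s t p \<in> ?C" for p
    unfolding chart_hom_def eval_poly_altdef[OF eval_poly_hom[OF lconst_hom]] mem_Collect_eq
    by (intro supported_sum) (use mult inner pow ratio in blast)
  then show "range (chart_hom u v s t) \<subseteq> ?C" by blast
next
  interpret comm_ring_hom "chart_hom u v s t :: 'k poly poly \<Rightarrow> 'k laurent" by (rule chart_hom)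
  note homs = lconst_hom eval_poly_hom
  let ?R = "range (chart_hom u v s t :: 'k poly poly \<Rightarrow> 'k laurent)"
  have mult: "f * g \<in> ?R" if fg: "f \<in> ?R" "g \<in> ?R" for f g
  proof -
    from fg obtain a b where "f = chart_hom u v s t a" "g = chart_hom u v s t b" by blast
    then have "f * g = chart_hom u v s t (a * b)" by (simp only: hom_mult)
    then show ?thesis by simp
  qed
  have sum: "sum F A \<in> ?R" if "\<And>a. a \<in> A \<Longrightarrow> F a \<in> ?R" for A and F :: "(cox_var \<Rightarrow>\<^sub>0 int) \<Rightarrow> 'k laurent"
    using that
  proof (induction A rule: infinite_finite_induct)
    case (insert x A)
    then obtain a b where "F x = chart_hom u v s t a" "sum F A = chart_hom u v s t b" by blast
    then have "sum F (insert x A) = chart_hom u v s t (a + b)" using insert by (simp add: hom_add)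
    then show ?case by simp
  qed (use hom_zero in \<open>auto simp: image_iff intro!: exI[of _ 0]\<close>)
  have pow: "f ^ n \<in> ?R" if "f \<in> ?R" for f n
  proof (induction n)
    case 0
    have "f ^ 0 = chart_hom u v s t 1" by (simp add: hom_one)
    then show ?case by (simp only: rangeI)
  qed (use that mult in simp)
  have "lconst c = chart_hom u v s t [:[:c:]:]" for c
    unfolding chart_hom_def by (simp add: eval_poly_const homs)
  then have const: "lconst c \<in> ?R" for c by (metis rangeI)
  have "ratio v u = chart_hom u v s t [:[:0, 1:]:]" "ratio t s = chart_hom u v s t [:0, 1:]"
    unfolding chart_hom_def by (simp_all only: eval_poly_const eval_poly_X homs)
  then have ratio: "ratio v u \<in> ?R" "ratio t s \<in> ?R" by (metis rangeI)+
  have mon: "Poly_Mapping.single e c \<in> ?R" if e: "chart_exp {u, s} e" for e c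
  proof -
    define i j where "i = nat (Poly_Mapping.lookup e v)" and "j = nat (Poly_Mapping.lookup e t)"
    have nn: "v \<notin> {u, s}" "t \<notin> {u, s}" using assms by (auto simp: chart_vars_iff)
    have ij: "int i = Poly_Mapping.lookup e v" "int j = Poly_Mapping.lookup e t"
      using e nn by (auto simp: i_def j_def chart_exp_def)
    have "e = 0 + (Poly_Mapping.single v (int i) - Poly_Mapping.single u (int i)) +
        (Poly_Mapping.single t (int j) - Poly_Mapping.single s (int j))"
    proof (rule poly_mapping_eqI)
      fix x
      have bi: "Poly_Mapping.lookup e X10 + Poly_Mapping.lookup e X11 = 0"
        "Poly_Mapping.lookup e X20 + Poly_Mapping.lookup e X21 = 0"
        using e by (auto simp: chart_exp_def bidegree_def)
      show "Poly_Mapping.lookup e x = Poly_Mapping.lookup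
        (0 + (Poly_Mapping.single v (int i) - Poly_Mapping.single u (int i)) +
        (Poly_Mapping.single t (int j) - Poly_Mapping.single s (int j))) x"
        using assms bi ij unfolding chart_vars_iff
        by (cases x) (auto simp: lookup_add lookup_minus lookup_single)
    qed
    then have "Poly_Mapping.single e c = lconst c * ratio v u ^ i * ratio t s ^ j"
      unfolding ratio_power lconst_def by (simp add: mult_single)
    then show ?thesis using mult const pow ratio by auto
  qed
  show "{f. supported (chart_exp {u, s}) f} \<subseteq> ?R"
  proof
    fix f :: "'k laurent" assume "f \<in> {f. supported (chart_exp {u, s}) f}"
    then have "(\<Sum>e\<in>Poly_Mapping.keys f. Poly_Mapping.single e (Poly_Mapping.lookup f e)) \<in> ?R"
      by (intro sum mon) (auto simp: supported_def)
    then show "f \<in> ?R" by (simp only: sum_monomials)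
  qed
qed

lemma chart_surjection:
  fixes A :: "'k::field laurent set"
  assumes uvst: "chart_vars u v s t" and A: "ideal A (coord_ring {u, s})"
  shows "ring_surjection (\<lambda>p. A +>\<^bsub>coord_ring {u, s}\<^esub> chart_hom u v s t p) (coord_ring {u, s} Quot A)"
    and "ring_surjection.kernel (\<lambda>p. A +>\<^bsub>coord_ring {u, s}\<^esub> chart_hom u v s t p) (coord_ring {u, s} Quot A) =
      {p. chart_hom u v s t p \<in> A}"
proof -
  let ?C = "coord_ring {u, s} :: 'k laurent ring"
  let ?h = "\<lambda>p. A +>\<^bsub>?C\<^esub> chart_hom u v s t p"
  interpret comm_ring_hom "chart_hom u v s t :: 'k poly poly \<Rightarrow> 'k laurent" by (rule chart_hom)
  have carr: "carrier ?C = range (chart_hom u v s t)"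
    by (simp add: coord_ring_eq chart_hom_range[OF uvst])
  have ring_ops: "x \<otimes>\<^bsub>?C\<^esub> y = x * y" "x \<oplus>\<^bsub>?C\<^esub> y = x + y" "\<one>\<^bsub>?C\<^esub> = 1" "\<zero>\<^bsub>?C\<^esub> = 0" for x y
    by (simp_all add: coord_ring_eq ring_of_type_algebra_def)
  interpret A: ideal A ?C by fact
  have cring: "cring ?C"
    by (rule cring.intro[OF A.ring_axioms])
       (auto intro!: comm_monoid.intro A.is_monoid comm_monoid_axioms.intro simp: ring_ops mult.commute)
  have hom: "chart_hom u v s t \<in> Ring.ring_hom type_ring ?C"
    by (rule ring_hom_memI) (auto simp: carr ring_ops hom_add hom_mult)
  show surj: "ring_surjection ?h (?C Quot A)"
  proof (rule ring_surjection.intro)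
    show "cring (?C Quot A)" by (rule A.quotient_is_cring[OF cring])
    show "?h \<in> Ring.ring_hom type_ring (?C Quot A)"
      using ring_hom_trans[OF hom A.rcos_ring_hom] by (simp add: comp_def)
    show "range ?h = carrier (?C Quot A)"
      by (auto simp: FactRing_def A_RCOSETS_def' carr)
  qed
  interpret ring_surjection ?h "?C Quot A" by fact
  have "(A +>\<^bsub>?C\<^esub> a = A) \<longleftrightarrow> a \<in> A" if "a \<in> carrier ?C" for a
    using A.a_rcos_const[of a] A.a_rcos_self[OF that] by auto
  moreover have "\<zero>\<^bsub>?C Quot A\<^esub> = A" by (simp add: FactRing_def)
  ultimately show "kernel = {p. chart_hom u v s t p \<in> A}" unfolding kernel_def using carr by auto
qed

text \<open>If no nonzero polynomial in the coordinate \<open>v/u\<close> belonged to \<open>A\<close>, some prime containing \<open>A\<close>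
  would avoid all of them. In dimension \<open>0\<close> this prime is maximal, hence a Goldman ideal, and
  contracts to a nonzero ideal of \<open>k[v/u]\<close>.\<close>

lemma chart_equation:
  fixes A :: "'k::field laurent set"
  assumes uvst: "chart_vars u v s t" and A: "ideal A (coord_ring {u, s})"
    and dim: "krull_dim (coord_ring {u, s} Quot A) \<le> 0"
  obtains q where "q \<noteq> 0" "eval_poly lconst (ratio v u) q \<in> A"
proof -
  interpret ring_surjection "\<lambda>p. A +>\<^bsub>coord_ring {u, s}\<^esub> chart_hom u v s t p" "coord_ring {u, s} Quot A"
    by (rule chart_surjection(1)[OF uvst A])
  note ker = chart_surjection(2)[OF uvst A]
  interpret T: cring "type_ring :: 'k poly poly ring" by simp
  have "\<exists>q. q \<noteq> 0 \<and> [:q:] \<in> kernel"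
  proof (rule ccontr)
    assume no: "\<not> ?thesis"
    have "\<exists>P. primeideal P type_ring \<and> kernel \<subseteq> P \<and> P \<inter> {[:q:] |q. q \<noteq> 0} = {}"
    proof (rule T.exists_prime_avoiding[OF kernel_ideal])
      show "\<one>\<^bsub>type_ring\<^esub> \<in> {[:q:] |q. q \<noteq> (0 :: 'k poly)}"
        by (auto simp: one_pCons intro!: exI[of _ 1])
    qed (use no in auto)
    then obtain P where P: "primeideal P type_ring" "kernel \<subseteq> P" "P \<inter> {[:q:] |q. q \<noteq> 0} = {}"
      by blast
    then have id: "ideal P type_ring" and one: "1 \<notin> P" by (auto simp: type_primeideal_iff)
    have "maximalideal P type_ring"
    proof (rule maximalidealI[OF id])
      fix J assume J: "ideal J (type_ring :: 'k poly poly ring)" "P \<subseteq> J"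
      show "J = P \<or> J = carrier type_ring"
      proof (rule ccontr)
        assume *: "\<not> ?thesis"
        have "1 \<notin> J"
        proof
          assume "1 \<in> J"
          then have "x \<in> J" for x using type_ideal_mult[OF J(1), of 1 x] by simp
          then show False using * by auto
        qed
        then have "\<exists>P'. primeideal P' type_ring \<and> J \<subseteq> P' \<and> P' \<inter> {1} = {}"
          by (intro T.exists_prime_avoiding[OF J(1)]) auto
        then obtain P' where "primeideal P' type_ring" "J \<subseteq> P'" by blast
        moreover have "P \<subset> J" using J(2) * by blast
        ultimately show False using no_prime_inclusion[OF dim P(1) _ P(2), of P'] by blast
      qed
    qed (use one in auto)
    then have "goldman_ideal {q. [:q:] \<in> P}"
      using goldman_contraction(1)[OF maximal_imp_goldman] by blast
    then obtain q where "q \<in> {q. [:q:] \<in> P}" "degree q > 0" by (rule goldman_field_poly)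
    then have "[:q:] \<in> P" "q \<noteq> 0" by auto
    then show False using P(3) by blast
  qed
  then obtain q where "q \<noteq> 0" "chart_hom u v s t [:q:] \<in> A" unfolding ker by blast
  then show ?thesis using that[of q] by (simp add: chart_hom_def eval_poly_const eval_poly_hom lconst_hom)
qed

text \<open>The equations for \<open>v/u\<close> on the two charts with \<open>u \<noteq> 0\<close> become forms after homogenization. The
  product of the two belongs to \<open>I\<close> up to powers of \<open>u\<close>, of \<open>s\<close> and of \<open>t\<close>, where \<open>s\<close> and \<open>t\<close>
  are the variables of the other kind; the first form takes care of one of the latter and the
  second form of the other, and saturation removes them.\<close>

theorem zero_dimensional_forms:
  fixes Z :: "cox_var set \<Rightarrow> 'k::field laurent set"
  assumes Z: "closed_subscheme Z" and dim: "subscheme_dim Z = 0" and I: "is_saturated_ideal_of I Z"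
    and uv: "(u, v) = (X10, X11) \<or> (u, v) = (X20, X21)"
  obtains b d G where "d > 0" "monic_form u v d G" "cox_gen u ^ b * G \<in> I"
proof -
  have id: "ideal I cox_ring" and sat: "saturation cox_ring I irrelevant_ideal = I"
    and sheaf: "\<And>D. D \<in> charts \<Longrightarrow> associated_sheaf I D = Z D"
    using I by (auto simp: is_saturated_ideal_of_def homogeneous_ideal_def)
  have chart: "\<exists>n q. q \<noteq> 0 \<and> cox_gen s ^ n * (cox_gen u ^ n * homogenize u v q) \<in> I"
    if uvst: "chart_vars u v s t" for s t
  proof -
    have D: "{u, s} \<in> charts" using uvst uv by (auto simp: chart_vars_iff charts_def insert_commute)
    have "krull_dim (coord_ring {u, s} Quot Z {u, s}) \<le> subscheme_dim Z"
      unfolding subscheme_dim_def by (rule SUP_upper[OF D])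
    moreover have "ideal (Z {u, s}) (coord_ring {u, s})"
      using Z D by (auto simp: closed_subscheme_def)
    ultimately obtain q where q: "q \<noteq> 0" "eval_poly lconst (ratio v u) q \<in> Z {u, s}"
      using chart_equation[OF uvst] dim by metis
    then obtain n f where nf: "laurent_of (\<Prod>v\<in>{u, s}. cox_gen v) ^ n * eval_poly lconst (ratio v u) q = laurent_of f" "f \<in> I"
      using sheaf[OF D] unfolding associated_sheaf_def by blast
    interpret comm_ring_hom laurent_of by (rule laurent_of_hom)
    have "u \<noteq> s" using uvst by (auto simp: chart_vars_iff)
    then have "laurent_of ((cox_gen u * cox_gen s) ^ n * homogenize u v q) =
        laurent_of (cox_gen u ^ degree q) * (laurent_of (\<Prod>v\<in>{u, s}. cox_gen v) ^ n * eval_poly lconst (ratio v u) q)"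
      by (simp add: hom_mult hom_power laurent_of_homogenize mult_ac)
    also have "\<dots> = laurent_of (cox_gen u ^ degree q * f)" by (simp only: nf hom_mult)
    finally have "(cox_gen u * cox_gen s) ^ n * homogenize u v q = cox_gen u ^ degree q * f"
      by (rule laurent_of_inj)
    then have "(cox_gen u * cox_gen s) ^ n * homogenize u v q \<in> I"
      using type_ideal_mult[OF id nf(2)] by simp
    then show ?thesis using q(1) by (intro exI[of _ n] exI[of _ q]) (simp add: power_mult_distrib mult_ac)
  qed
  define s t where "s = (if u = X10 then X20 else X10)" and "t = (if u = X10 then X21 else X11)"
  have st: "chart_vars u v s t" "chart_vars u v t s" "(s, t) = (X10, X11) \<or> (s, t) = (X20, X21)" "u \<noteq> v"
    using uv by (auto simp: s_def t_def chart_vars_iff)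
  obtain n q m p where *: "q \<noteq> 0" "cox_gen s ^ n * (cox_gen u ^ n * homogenize u v q) \<in> I"
      "p \<noteq> 0" "cox_gen t ^ m * (cox_gen u ^ m * homogenize u v p) \<in> I"
    using chart[OF st(1)] chart[OF st(2)] by blast
  \<comment> \<open>The factor \<open>v\<close> makes the degree positive even if both equations are constant, as happens for
    the empty scheme.\<close>
  define G where "G = homogenize u v q * homogenize u v p * cox_gen v"
  have form: "monic_form u v (degree q + degree p + 1) G"
    unfolding G_def by (intro monic_form_mult monic_form_homogenize monic_form_var *(1,3) st)
  have "cox_gen s ^ n * (cox_gen u ^ (n + m) * G) \<in> I"
    using type_ideal_mult_right[OF id *(2), of "cox_gen u ^ m * homogenize u v p * cox_gen v"]
    by (simp add: G_def power_add mult_ac)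
  moreover have "cox_gen t ^ m * (cox_gen u ^ (n + m) * G) \<in> I"
    using type_ideal_mult_right[OF id *(4), of "cox_gen u ^ n * homogenize u v q * cox_gen v"]
    by (simp add: G_def power_add mult_ac)
  ultimately have "cox_gen u ^ (n + m) * G \<in> I" by (rule saturated_cancel[OF id sat st(3)])
  then show ?thesis using that[OF _ form] by simp
qed


section \<open>Regular pairs\<close>

text \<open>A regular sequence \<open>v, u\<close> on \<open>R / J\<close>, except that \<open>J\<close>, \<open>v\<close> and \<open>u\<close> may generate the unit
  ideal.\<close>

definition regular_pair :: "'a::comm_ring_1 set \<Rightarrow> 'a \<Rightarrow> 'a \<Rightarrow> bool" where
  "regular_pair J v u \<longleftrightarrow> (\<forall>f. v * f \<in> J \<longrightarrow> f \<in> J) \<and>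
     (\<forall>f h. u * f - v * h \<in> J \<longrightarrow> (\<exists>k. f - v * k \<in> J))"

lemma regular_pair_power_left:
  assumes J: "ideal J type_ring" and reg: "regular_pair J v (u :: 'a::comm_ring_1)"
  shows "regular_pair J (v ^ n) u"
proof (induction n)
  case 0
  have "f - v ^ 0 * f \<in> J" for f using type_ideal_zero[OF J] by simp
  then show ?case unfolding regular_pair_def by (metis mult_1 power_0)
next
  case (Suc n)
  have nzd: "f \<in> J" if "v * f \<in> J" for f using reg that by (auto simp: regular_pair_def)
  have "\<exists>k. f - v ^ Suc n * k \<in> J" if uf: "u * f - v ^ Suc n * h \<in> J" for f h
  proof -
    have "u * f - v * (v ^ n * h) \<in> J" using uf by (simp add: mult_ac)
    then obtain k where k: "f - v * k \<in> J" using reg unfolding regular_pair_def by blast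
    have "(u * f - v ^ Suc n * h) - u * (f - v * k) \<in> J"
      by (rule type_ideal_diff[OF J uf type_ideal_mult[OF J k]])
    also have "(u * f - v ^ Suc n * h) - u * (f - v * k) = v * (u * k - v ^ n * h)"
      by (simp add: algebra_simps)
    finally obtain k' where k': "k - v ^ n * k' \<in> J"
      using nzd Suc unfolding regular_pair_def by blast
    have "(f - v * k) + v * (k - v ^ n * k') \<in> J"
      by (rule type_ideal_add[OF J k type_ideal_mult[OF J k']])
    also have "(f - v * k) + v * (k - v ^ n * k') = f - v ^ Suc n * k'"
      by (simp add: algebra_simps)
    finally show ?thesis by blast
  qed
  moreover have "f \<in> J" if "v ^ Suc n * f \<in> J" for f
  proof -
    have "v * (v ^ n * f) \<in> J" using that by (simp add: mult.assoc)
    then have "v ^ n * f \<in> J" by (rule nzd)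
    then show ?thesis using Suc unfolding regular_pair_def by blast
  qed
  ultimately show ?case unfolding regular_pair_def by blast
qed

lemma regular_pair_power_right:
  assumes reg: "regular_pair J v (u :: 'a::comm_ring_1)"
  shows "regular_pair J v (u ^ n)"
proof (induction n)
  case 0
  then show ?case using reg by (auto simp: regular_pair_def)
next
  case (Suc n)
  have "\<exists>k. f - v * k \<in> J" if "u ^ Suc n * f - v * h \<in> J" for f h
  proof -
    have "u * (u ^ n * f) - v * h \<in> J" using that by (simp add: mult_ac)
    then obtain k where "u ^ n * f - v * k \<in> J" using reg unfolding regular_pair_def by blast
    then show ?thesis using Suc unfolding regular_pair_def by blast
  qed
  then show ?case using reg unfolding regular_pair_def by blast
qed

text \<open>The part of highest weight of a relation between \<open>v + v'\<close> and \<open>u + u'\<close> is a relation between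
  \<open>v\<close> and \<open>u\<close>. Since these are regular it is a trivial relation modulo \<open>J\<close>, and subtracting it
  lowers the weight of \<open>f\<close>.\<close>

theorem regular_pair_top_forms:
  fixes J :: "(('v \<Rightarrow>\<^sub>0 nat) \<Rightarrow>\<^sub>0 'k::field) set"
  assumes J: "ideal J type_ring" and hom: "\<And>f n. f \<in> J \<Longrightarrow> gpart w n f \<in> J"
    and w: "additive_weight w"
    and v: "homog w \<beta> v" "below w \<beta> v'" and u: "homog w \<alpha> u" "below w \<alpha> u'"
    and reg: "regular_pair J v u"
  shows "regular_pair J (v + v') (u + u')"
proof -
  have nzd: "f \<in> J" if "v * f \<in> J" for f using reg that by (auto simp: regular_pair_def)
  have top: "gpart w (\<beta> + n) ((a + a') * f) = a * gpart w n f"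
    if "homog w \<beta> a" "below w \<beta> a'" "below w (Suc n) f" for a a' f \<beta> n
  proof -
    have "below w (\<beta> + n) (a' * f)"
      by (rule below_mult[OF w that(2)]) (use that(3) in \<open>simp add: supported_def less_Suc_eq_le\<close>)
    then have "gpart w (\<beta> + n) (a' * f) = 0" by (rule part_supported_none) auto
    then show ?thesis using gpart_mult_homog[OF w that(1)] by (simp add: distrib_right part_add)
  qed
  have drop: "below w n (f - gpart w n f)" if "below w (Suc n) f" for n and f :: "('v \<Rightarrow>\<^sub>0 nat) \<Rightarrow>\<^sub>0 'k"
  proof -
    have "f - gpart w n f = part (\<lambda>e. w e \<noteq> n) f"
      by (rule poly_mapping_eqI) (simp add: lookup_minus lookup_part)
    then show ?thesis using that by (auto simp: supported_def keys_part less_Suc_eq)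
  qed
  have zero: "f = 0" if "below w 0 f" for f :: "('v \<Rightarrow>\<^sub>0 nat) \<Rightarrow>\<^sub>0 'k"
    using that by (auto simp: supported_def)
  have nzd': "below w n f \<Longrightarrow> (v + v') * f \<in> J \<Longrightarrow> f \<in> J" for n f
  proof (induction n arbitrary: f)
    case 0
    then show ?case using zero type_ideal_zero[OF J] by auto
  next
    case (Suc n)
    have "v * gpart w n f \<in> J" using hom[OF Suc.prems(2), of "\<beta> + n"] top[OF v Suc.prems(1)] by simp
    then have fn: "gpart w n f \<in> J" by (rule nzd)
    have "(v + v') * f - (v + v') * gpart w n f \<in> J"
      by (rule type_ideal_diff[OF J Suc.prems(2) type_ideal_mult[OF J fn]])
    then have "(v + v') * (f - gpart w n f) \<in> J" by (simp only: right_diff_distrib)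
    then have "f - gpart w n f \<in> J" by (rule Suc.IH[OF drop[OF Suc.prems(1)]])
    then show ?case using fn type_ideal_cong[OF J] by blast
  qed
  have main: "below w n f \<Longrightarrow> (u + u') * f - (v + v') * h \<in> J \<Longrightarrow> \<exists>k. f - (v + v') * k \<in> J" for n f h
  proof (induction n arbitrary: f h)
    case 0
    then have "f - (v + v') * 0 \<in> J" using zero type_ideal_zero[OF J] by auto
    then show ?case by blast
  next
    case (Suc n)
    \<comment> \<open>The inner induction treats an \<open>h\<close> whose weight exceeds that of \<open>(u + u') f\<close>: then \<open>v\<close> times
      its top form lies in \<open>J\<close>, and so does the top form itself.\<close>
    have "\<exists>k. f - (v + v') * k \<in> J" if "below w m h" "(u + u') * f - (v + v') * h \<in> J" for m h
      using that
    proof (induction m arbitrary: h rule: less_induct)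
      case (less m)
      show ?case
      proof (cases "m = 0 \<or> m + \<beta> \<le> n + \<alpha> + 1")
        case le: True
        have "\<exists>h0. u * gpart w n f - v * h0 \<in> J"
        proof (cases "m = 0")
          case True
          then have "h = 0" using zero less.prems(1) by blast
          then have "u * gpart w n f - v * 0 \<in> J"
            using hom[OF less.prems(2), of "\<alpha> + n"] top[OF u Suc.prems(1)] by (simp add: part_diff)
          then show ?thesis by blast
        next
          case False
          define r where "r = n + \<alpha> - \<beta>"
          have r: "\<alpha> + n = \<beta> + r" "m \<le> Suc r" using le False by (auto simp: r_def)
          have "below w (Suc r) h" using less.prems(1) r(2) by (auto simp: supported_def)
          then have "u * gpart w n f - v * gpart w r h \<in> J"
            using hom[OF less.prems(2), of "\<alpha> + n"] top[OF u Suc.prems(1)] top[OF v, of r h] r(1)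
            by (simp add: part_diff)
          then show ?thesis by blast
        qed
        then obtain k where k: "gpart w n f - v * k \<in> J" using reg unfolding regular_pair_def by blast
        \<comment> \<open>Only the homogeneous part of \<open>k\<close> of the right weight contributes to \<open>v k\<close>.\<close>
        define k' where "k' = (if \<beta> \<le> n then gpart w (n - \<beta>) k else 0)"
        have idem: "gpart w n (gpart w n f) = gpart w n f" by (rule part_supported[OF supported_part])
        have "gpart w n (v * k) = v * k'"
          using gpart_mult_homog[OF w v(1), of "n - \<beta>" k] gpart_mult_homog_less[OF w v(1), of n k]
          by (auto simp: k'_def)
        then have k'J: "gpart w n f - v * k' \<in> J" using hom[OF k, of n] idem by (simp add: part_diff)
        define f' where "f' = f - gpart w n f - v' * k'"
        have "below w n (v' * k')"
        proof (cases "\<beta> \<le> n")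
          case True
          have "supported (\<lambda>e. w e \<le> n - \<beta>) k'"
            using True supported_part[of "\<lambda>e. w e = n - \<beta>" k] by (auto simp: k'_def supported_def)
          then show ?thesis using below_mult[OF w v(2)] True by fastforce
        qed (simp add: k'_def)
        then have f': "below w n f'" unfolding f'_def by (intro supported_diff drop Suc.prems(1))
        have "((u + u') * f - (v + v') * h) - (u + u') * (gpart w n f - v * k') \<in> J"
          by (rule type_ideal_diff[OF J less.prems(2) type_ideal_mult[OF J k'J]])
        also have "((u + u') * f - (v + v') * h) - (u + u') * (gpart w n f - v * k') =
            (u + u') * f' - (v + v') * (h - (u + u') * k')"
          by (simp add: f'_def algebra_simps)
        finally obtain k2 where k2: "f' - (v + v') * k2 \<in> J" using Suc.IH[OF f'] by blast
        have "(f' - (v + v') * k2) + (gpart w n f - v * k') \<in> J"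
          by (rule type_ideal_add[OF J k2 k'J])
        also have "(f' - (v + v') * k2) + (gpart w n f - v * k') = f - (v + v') * (k' + k2)"
          by (simp add: f'_def algebra_simps)
        finally show ?thesis by blast
      next
        case False
        then obtain m' where m: "m = Suc m'" by (cases m) (use False in auto)
        have "below w (\<beta> + m') ((u + u') * f)"
        proof -
          have "supported (\<lambda>e. w e \<le> \<alpha>) (u + u')"
            by (rule supported_add) (use u in \<open>auto simp: supported_def\<close>)
          moreover have "below w (Suc n) f" by fact
          ultimately show ?thesis
            by (rule supported_mult) (use False m in \<open>simp add: additiveD[OF w]\<close>)
        qed
        then have "gpart w (\<beta> + m') ((u + u') * f) = 0" by (rule part_supported_none) auto
        then have "- (v * gpart w m' h) \<in> J"
          using hom[OF less.prems(2), of "\<beta> + m'"] top[OF v, of m' h] less.prems(1) m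
          by (simp add: part_diff)
        then have hm: "gpart w m' h \<in> J" using nzd type_ideal_uminus[OF J] by force
        have "((u + u') * f - (v + v') * h) + (v + v') * gpart w m' h \<in> J"
          by (rule type_ideal_add[OF J less.prems(2) type_ideal_mult[OF J hm]])
        then have "(u + u') * f - (v + v') * (h - gpart w m' h) \<in> J" by (simp add: algebra_simps)
        moreover have "below w m' (h - gpart w m' h)" using drop less.prems(1) m by blast
        ultimately show ?thesis using less.IH[of m'] m by blast
      qed
    qed
    then show ?case using below_exists[of w h] Suc.prems(2) by blast
  qed
  show ?thesis unfolding regular_pair_def using nzd' main below_exists by blast
qed

lemma eval_poly_top_form:
  fixes s :: "'k::field cox"
  assumes w: "additive_weight w" and s: "homog w m s" and m: "m > 0" and p: "lead_coeff p = 1"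
  obtains r where "eval_poly const s p = s ^ degree p + r" "below w (degree p * m) r"
proof -
  let ?r = "\<Sum>i<degree p. const (coeff p i) * s ^ i"
  have "eval_poly const s p = s ^ degree p + ?r"
    using p by (simp add: eval_poly_altdef[OF const_hom] lessThan_Suc_atMost[symmetric] add.commute)
  moreover have "below w (degree p * m) ?r"
  proof (rule supported_sum)
    fix i assume "i \<in> {..<degree p}"
    then have "i * m < degree p * m" using m by simp
    moreover have "homog w 0 (const (coeff p i))"
      by (simp add: const_def supported_def additive_zero[OF w])
    then have "homog w (0 + i * m) (const (coeff p i) * s ^ i)" by (rule homog_mult[OF w _ homog_power[OF w s]])
    ultimately show "below w (degree p * m) (const (coeff p i) * s ^ i)" by (auto simp: supported_def)
  qed
  ultimately show ?thesis by (rule that)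
qed

text \<open>The top forms of \<open>p(v)\<close> and \<open>q(u)\<close> are powers of \<open>v\<close> and \<open>u\<close>. This moves a regular pair into
  any given maximal ideal.\<close>

theorem regular_pair_eval_poly:
  fixes J :: "'k::field cox set"
  assumes J: "ideal J type_ring" and hom: "\<And>f n. f \<in> J \<Longrightarrow> gpart w n f \<in> J"
    and w: "additive_weight w"
    and v: "homog w \<beta> v" "\<beta> > 0" and u: "homog w \<alpha> u" "\<alpha> > 0"
    and reg: "regular_pair J v u" and p: "lead_coeff p = 1" and q: "lead_coeff q = 1"
  shows "regular_pair J (eval_poly const v p) (eval_poly const u q)"
proof -
  obtain v' where v': "eval_poly const v p = v ^ degree p + v'" "below w (degree p * \<beta>) v'"
    by (rule eval_poly_top_form[OF w v p])
  obtain u' where u': "eval_poly const u q = u ^ degree q + u'" "below w (degree q * \<alpha>) u'"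
    by (rule eval_poly_top_form[OF w u q])
  have reg': "regular_pair J (v ^ degree p) (u ^ degree q)"
    by (intro regular_pair_power_right regular_pair_power_left[OF J] reg)
  show ?thesis unfolding v' u'
    by (rule regular_pair_top_forms[OF J _ w homog_power[OF w v(1)] v'(2) homog_power[OF w u(1)] u'(2) reg'])
       (rule hom)
qed

context ring_surjection
begin

lemma regular_pair_imp_regular_sequence:
  assumes reg: "regular_pair kernel a b" and P: "ideal P S" "P \<noteq> carrier S" and ab: "h a \<in> P" "h b \<in> P"
  shows "regular_sequence S [h a, h b]"
proof -
  have 0: "Idl {} = {\<zero>}"
    using S.genideal_minimal[OF S.zeroideal, of "{}"] S.genideal_ideal[of "{}"]
    by (auto simp: additive_subgroup.zero_closed ideal.axioms)
  have 1: "r \<in> {x. \<exists>k. x - a * k \<in> kernel}" if "h r \<in> Idl {h a}" for r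
  proof -
    let ?L = "{j + r * a |j r. j \<in> kernel}"
    have L: "ideal ?L type_ring" by (rule type_ideal_plus_principal[OF kernel_ideal])
    have K: "kernel \<subseteq> ?L"
    proof
      fix x assume "x \<in> kernel" then have "x = x + 0 * a" "x \<in> kernel" by simp_all
      then show "x \<in> ?L" by blast
    qed
    have "a = 0 + 1 * a" "0 \<in> kernel" using type_ideal_zero[OF kernel_ideal] by simp_all
    then have "a \<in> ?L" by blast
    then have "Idl {h a} \<subseteq> h ` ?L" by (intro S.genideal_minimal image_ideal[OF L]) auto
    then have "r \<in> ?L" using that in_image_iff[OF L K] by blast
    then obtain j k where "r = j + k * a" "j \<in> kernel" by blast
    then have "r - a * k \<in> kernel" by (simp add: mult.commute)
    then show ?thesis by blast
  qed
  have 2: "h r \<in> Idl {h a}" if "r - a * k \<in> kernel" for r k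
  proof -
    have "h r = h a \<otimes> h k" using that by (simp add: h_eq_iff flip: h_mult)
    then show ?thesis
      using ideal.I_r_closed[OF S.genideal_ideal[of "{h a}"]] S.genideal_self'[OF h_closed] h_closed by simp
  qed
  have "Idl {h a, h b} \<subseteq> P" by (rule S.genideal_minimal[OF P(1)]) (use ab in auto)
  moreover have "P \<subseteq> carrier S" using P(1) by (simp add: additive_subgroup.a_subset ideal.axioms)
  ultimately have proper: "Idl {h a, h b} \<noteq> carrier S" using P(2) by blast
  have "x \<in> Idl (set (take i [h a, h b]))"
    if i: "i < 2" and x: "x \<in> carrier S" "[h a, h b] ! i \<otimes> x \<in> Idl (set (take i [h a, h b]))" for i x
  proof -
    obtain f where f: "x = h f" using x(1) surj by blast
    consider "i = 0" | "i = 1" using i by linarith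
    then show ?thesis
    proof cases
      case 1
      then have "a * f \<in> kernel" using x(2) f by (simp add: 0 kernel_def h_mult)
      then have "f \<in> kernel" using reg by (auto simp: regular_pair_def)
      then show ?thesis using 1 f by (simp add: 0 kernel_def)
    next
      case i: 2
      then have "h (b * f) \<in> Idl {h a}" using x(2) f by (simp add: h_mult)
      then obtain k where "b * f - a * k \<in> kernel" using 1 by blast
      then obtain k' where "f - a * k' \<in> kernel" using reg unfolding regular_pair_def by blast
      then show ?thesis using 2 i f by simp
    qed
  qed
  moreover have "length [h a, h b] = 2" "set [h a, h b] = {h a, h b}" by simp_all
  ultimately show ?thesis
    unfolding regular_sequence_def using h_closed proper by (metis empty_subsetI insert_subset)
qed

lemma vimage_prime_chain:
  assumes "prime_chain S Ps" "i < length Ps"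
  shows "primeideal (h -` (Ps ! i)) type_ring" "kernel \<subseteq> h -` (Ps ! i)"
    and "Suc i < length Ps \<Longrightarrow> h -` (Ps ! i) \<subset> h -` (Ps ! Suc i)"
proof -
  have pr: "primeideal (Ps ! j) S" if "j < length Ps" for j
    using assms that by (auto simp: prime_chain_def)
  show "primeideal (h -` (Ps ! i)) type_ring" by (rule vimage_prime[OF pr[OF assms(2)]])
  show "kernel \<subseteq> h -` (Ps ! i)"
    by (rule kernel_subset_vimage) (use pr[OF assms(2)] in \<open>simp add: primeideal.axioms\<close>)
  assume i: "Suc i < length Ps"
  then have lt: "Ps ! i \<subset> Ps ! Suc i"
    using assms by (auto simp: prime_chain_def successively_conv_nth)
  have "Ps ! j \<subseteq> carrier S" if "j < length Ps" for j
    using pr[OF that] by (simp add: additive_subgroup.a_subset ideal.axioms primeideal.axioms)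
  then show "h -` (Ps ! i) \<subset> h -` (Ps ! Suc i)"
    using lt image_vimage i assms(2) by (metis psubset_eq vimage_mono)
qed

end


section \<open>An upper bound for heights\<close>

lemma const_add: "const (a + b) = const a + const b"
  by (simp add: const_def single_add)

text \<open>The vector space structure serves to count dimensions.\<close>

interpretation cox_vs: vector_space "\<lambda>(c::'k::field) (f::'k cox). const c * f"
  by unfold_locales (simp_all add: distrib_left distrib_right const_mult const_add mult.assoc)

text \<open>Peel off the lowest coefficient, which lies in \<open>P'\<close> together with all other terms, and divide
  by \<open>f\<close>, a nonzerodivisor modulo \<open>P\<close>. Applied along a chain of primes, this shows that elements
  of the successive differences are algebraically independent.\<close>

lemma power_sum_in_prime:
  assumes P: "primeideal P (type_ring :: 'a::comm_ring_1 ring)" "primeideal P' (type_ring :: 'a ring)"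
    and sub: "P \<subseteq> P'" and f: "f \<in> P'" "f \<notin> P"
  shows "(\<Sum>i\<le>m. a i * f ^ i) \<in> P \<Longrightarrow> (\<And>i. i \<le> m \<Longrightarrow> a i \<in> P' \<Longrightarrow> a i = 0) \<Longrightarrow> i \<le> m \<Longrightarrow> a i = 0"
proof (induction m arbitrary: a i)
  case 0
  then show ?case using sub by auto
next
  case (Suc m)
  have id: "ideal P' type_ring" and pr: "\<And>a b. a * b \<in> P \<Longrightarrow> a \<in> P \<or> b \<in> P"
    using P by (auto simp: type_primeideal_iff)
  have split: "(\<Sum>i\<le>Suc m. a i * f ^ i) = a 0 + f * (\<Sum>i\<le>m. a (Suc i) * f ^ i)"
    by (subst sum.atMost_Suc_shift) (simp add: sum_distrib_left mult_ac)
  then have "a 0 = (\<Sum>i\<le>Suc m. a i * f ^ i) - (\<Sum>i\<le>m. a (Suc i) * f ^ i) * f"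
    by (simp add: mult.commute)
  also have "\<dots> \<in> P'" using Suc.prems(1) sub f by (intro type_ideal_diff[OF id] type_ideal_mult[OF id]) auto
  finally have a0: "a 0 = 0" using Suc.prems(2) by blast
  then have "(\<Sum>i\<le>m. a (Suc i) * f ^ i) \<in> P" using pr f(2) Suc.prems(1) split by auto
  then have "a (Suc i) = 0" if "i \<le> m" for i
    by (rule Suc.IH) (use Suc.prems(2) that in auto)
  then show ?case using a0 Suc.prems(3) by (cases i) auto
qed

lemma monomials_finite:
  "finite {e. Poly_Mapping.lookup e X10 < n \<and> Poly_Mapping.lookup e X11 < n \<and>
     Poly_Mapping.lookup e X20 < n \<and> Poly_Mapping.lookup e X21 < (n::nat)}"
proof (rule finite_subset)
  let ?g = "\<lambda>(a, b, c, d). Poly_Mapping.single X10 a + Poly_Mapping.single X11 b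
      + Poly_Mapping.single X20 c + Poly_Mapping.single X21 (d :: nat)"
  show "finite (?g ` ({..<n} \<times> {..<n} \<times> {..<n} \<times> {..<n}))" by simp
  show "{e. Poly_Mapping.lookup e X10 < n \<and> Poly_Mapping.lookup e X11 < n \<and>
     Poly_Mapping.lookup e X20 < n \<and> Poly_Mapping.lookup e X21 < n} \<subseteq>
     ?g ` ({..<n} \<times> {..<n} \<times> {..<n} \<times> {..<n})"
  proof
    fix e assume "e \<in> {e. Poly_Mapping.lookup e X10 < n \<and> Poly_Mapping.lookup e X11 < n \<and>
     Poly_Mapping.lookup e X20 < n \<and> Poly_Mapping.lookup e X21 < n}"
    then show "e \<in> ?g ` ({..<n} \<times> {..<n} \<times> {..<n} \<times> {..<n})"
      using cox_exponent_eq[of e]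
      by (intro image_eqI[of _ _ "(Poly_Mapping.lookup e X10, Poly_Mapping.lookup e X11, Poly_Mapping.lookup e X20, Poly_Mapping.lookup e X21)"]) auto
  qed
qed

text \<open>Suppose that \<open>S / (\<bb> + (l, \<eta>))\<close> has finite length.  Then \<open>S / \<bb>\<close> is spanned by finitely
  many monomials over \<open>k[l, \<eta>]\<close>, so its part of weight at most \<open>n\<close> grows like \<open>n\<^sup>2\<close>.  A chain of
  primes \<open>P\<^sub>0 \<subset> P\<^sub>1 \<subset> P\<^sub>2 \<subset> P\<^sub>3\<close> would make the monomials in three
  elements \<open>f\<^sub>i \<in> P\<^sub>i - P\<^bsub>i-1\<^esub>\<close> linearly independent modulo \<open>P\<^sub>0\<close>, and their number grows like
  \<open>n\<^sup>3\<close>.\<close>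

theorem no_prime_chain_of_length_three:
  fixes \<bb> :: "'k::field cox set"
  assumes b: "ideal \<bb> type_ring" and hom: "\<And>f n. f \<in> \<bb> \<Longrightarrow> gpart w n f \<in> \<bb>"
    and w: "w = (\<lambda>e. A * xdeg e + B * ydeg e)" "A > 0" "B > 0"
    and l: "homog w \<beta> l" "\<beta> > 0" and \<eta>: "homog w \<alpha> \<eta>" "\<alpha> > 0"
    and fin: "\<And>v. \<exists>j r s. cox_gen v ^ N = j + r * l + s * \<eta> \<and> j \<in> \<bb>"
    and P: "primeideal P0 type_ring" "primeideal P1 type_ring" "primeideal P2 type_ring" "primeideal P3 type_ring"
    and chain: "\<bb> \<subseteq> P0" "P0 \<subset> P1" "P1 \<subset> P2" "P2 \<subset> P3"
  shows False
proof -
  have wt: "additive_weight w" unfolding w(1) by (rule additive_weighted[OF additive_xdeg additive_ydeg])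
  define K where "K = {j + s * \<eta> |j s. j \<in> {j + r * l |j r. j \<in> \<bb>}}"
  have K: "ideal K type_ring" unfolding K_def by (intro type_ideal_plus_principal b)
  have K_iff: "f \<in> K \<longleftrightarrow> (\<exists>j r s. f = j + r * l + s * \<eta> \<and> j \<in> \<bb>)" for f
    unfolding K_def by blast
  \<comment> \<open>A monomial of weight at least \<open>W\<close> is divisible by the \<open>N\<close>-th power of some variable.\<close>
  define W where "W = (A + B) * (2 * N)"
  define E where "E = {e. w e < W}"
  have "E \<subseteq> {e. Poly_Mapping.lookup e X10 < W \<and> Poly_Mapping.lookup e X11 < W \<and>
     Poly_Mapping.lookup e X20 < W \<and> Poly_Mapping.lookup e X21 < W}"
  proof
    fix e assume "e \<in> E"
    then have "A * xdeg e + B * ydeg e < W" by (simp add: E_def w)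
    moreover have "xdeg e \<le> A * xdeg e" "ydeg e \<le> B * ydeg e" using w by auto
    ultimately have "xdeg e < W" "ydeg e < W" by linarith+
    then show "e \<in> {e. Poly_Mapping.lookup e X10 < W \<and> Poly_Mapping.lookup e X11 < W \<and>
     Poly_Mapping.lookup e X20 < W \<and> Poly_Mapping.lookup e X21 < W}"
      by (simp add: xdeg_def ydeg_def)
  qed
  then have finE: "finite E" using monomials_finite finite_subset by blast
  have large: "f \<in> K" if f: "supported (\<lambda>e. W \<le> w e) f" for f
  proof -
    have "Poly_Mapping.single e c \<in> K" if "W \<le> w e" for e and c :: 'k
    proof -
      have "\<exists>v. N \<le> Poly_Mapping.lookup e v"
      proof (rule ccontr)
        assume "\<not> ?thesis"
        then have "Poly_Mapping.lookup e v < N" for v by (meson not_le)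
        from this[of X10] this[of X11] this[of X20] this[of X21]
        have "xdeg e < 2 * N" "ydeg e < 2 * N" by (auto simp: xdeg_def ydeg_def)
        then have "A * xdeg e + B * ydeg e < A * (2 * N) + B * (2 * N)"
          using w by (intro add_strict_mono) auto
        then show False using that by (simp add: W_def w algebra_simps)
      qed
      then obtain v where v: "N \<le> Poly_Mapping.lookup e v" by blast
      have "cox_gen v ^ N \<in> K" unfolding K_iff by (rule fin)
      then show ?thesis unfolding monomial_var_power[OF v] by (rule type_ideal_mult_right[OF K])
    qed
    then have "(\<Sum>e\<in>Poly_Mapping.keys f. Poly_Mapping.single e (Poly_Mapping.lookup f e)) \<in> K"
      using f by (intro type_ideal_sum[OF K]) (auto simp: supported_def)
    then show ?thesis by (simp only: sum_monomials)
  qed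
  \<comment> \<open>By induction on the weight, \<open>T n\<close> spans the part of weight at most \<open>n\<close> modulo \<open>\<bb>\<close>: a form of
    weight at least \<open>W\<close> is a combination of \<open>l\<close> and \<open>\<eta>\<close> with coefficients of smaller weight.\<close>
  define T where "T = (\<lambda>n. (\<lambda>(i, j, e). l ^ i * \<eta> ^ j * Poly_Mapping.single e (1::'k)) ` ({..n} \<times> {..n} \<times> E))"
  have finT: "finite (T n)" for n unfolding T_def using finE by simp
  have cardT: "card (T n) \<le> (n + 1) ^ 2 * card E" for n
  proof -
    have "card (T n) \<le> card ({..n} \<times> {..n} \<times> E)" unfolding T_def by (rule card_image_le) (use finE in simp)
    then show ?thesis by (simp add: card_cartesian_product power2_eq_square algebra_simps)
  qed
  have T_mono: "T m \<subseteq> T n" if "m \<le> n" for m n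
    unfolding T_def using that by (intro image_mono Sigma_mono) auto
  have T_l: "l * t \<in> cox_vs.span (T n)" if "t \<in> cox_vs.span (T m)" "m < n" for t m n
  proof (rule cox_vs.span_induct[OF that(1)])
    show "cox_vs.subspace {t. l * t \<in> cox_vs.span (T n)}"
      unfolding cox_vs.subspace_def
      using cox_vs.span_zero cox_vs.span_add cox_vs.span_scale by (auto simp: distrib_left mult.left_commute[of l "const c" for c])
    fix t assume "t \<in> T m"
    then obtain i j e where "t = l ^ i * \<eta> ^ j * Poly_Mapping.single e 1" "i \<le> m" "j \<le> m" "e \<in> E"
      by (auto simp: T_def)
    then have "l * t = l ^ Suc i * \<eta> ^ j * Poly_Mapping.single e 1" "Suc i \<le> n" "j \<le> n" "e \<in> E"
      using that(2) by (auto simp: mult_ac)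
    then have "l * t \<in> T n" unfolding T_def by (intro image_eqI[of _ _ "(Suc i, j, e)"]) auto
    then show "l * t \<in> cox_vs.span (T n)" by (rule cox_vs.span_base)
  qed
  have T_\<eta>: "\<eta> * t \<in> cox_vs.span (T n)" if "t \<in> cox_vs.span (T m)" "m < n" for t m n
  proof (rule cox_vs.span_induct[OF that(1)])
    show "cox_vs.subspace {t. \<eta> * t \<in> cox_vs.span (T n)}"
      unfolding cox_vs.subspace_def
      using cox_vs.span_zero cox_vs.span_add cox_vs.span_scale by (auto simp: distrib_left mult.left_commute[of \<eta> "const c" for c])
    fix t assume "t \<in> T m"
    then obtain i j e where "t = l ^ i * \<eta> ^ j * Poly_Mapping.single e 1" "i \<le> m" "j \<le> m" "e \<in> E"
      by (auto simp: T_def)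
    then have "\<eta> * t = l ^ i * \<eta> ^ Suc j * Poly_Mapping.single e 1" "i \<le> n" "Suc j \<le> n" "e \<in> E"
      using that(2) by (auto simp: mult_ac)
    then have "\<eta> * t \<in> T n" unfolding T_def by (intro image_eqI[of _ _ "(i, Suc j, e)"]) auto
    then show "\<eta> * t \<in> cox_vs.span (T n)" by (rule cox_vs.span_base)
  qed
  have span_homog: "\<exists>t\<in>cox_vs.span (T n). f - t \<in> \<bb>" if "homog w n f" for n f
    using that
  proof (induction n arbitrary: f rule: less_induct)
    case (less n)
    show ?case
    proof (cases "n < W")
      case True
      have "(\<Sum>e\<in>Poly_Mapping.keys f. const (Poly_Mapping.lookup f e) * Poly_Mapping.single e 1) \<in> cox_vs.span (T n)"
      proof (intro cox_vs.span_sum cox_vs.span_scale cox_vs.span_base)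
        fix e assume "e \<in> Poly_Mapping.keys f"
        then have "e \<in> E" using less.prems True by (auto simp: supported_def E_def)
        then show "Poly_Mapping.single e 1 \<in> T n"
          unfolding T_def by (intro image_eqI[of _ _ "(0, 0, e)"]) auto
      qed
      then have "f \<in> cox_vs.span (T n)" by (simp add: const_def mult_single sum_monomials)
      then show ?thesis using type_ideal_zero[OF b] by (intro bexI[of _ f]) auto
    next
      case False
      have "f \<in> K" by (rule large) (use less.prems False in \<open>auto simp: supported_def\<close>)
      then obtain j r s where f: "f = j + r * l + s * \<eta>" "j \<in> \<bb>" unfolding K_iff by blast
      have aux: "\<exists>t\<in>cox_vs.span (T n). gpart w n (r * z) - t \<in> \<bb>"
        if z: "homog w \<gamma> z" "\<gamma> > 0" and Tz: "\<And>t m. t \<in> cox_vs.span (T m) \<Longrightarrow> m < n \<Longrightarrow> z * t \<in> cox_vs.span (T n)"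
        for r z \<gamma>
      proof (cases "\<gamma> \<le> n")
        case True
        have "n - \<gamma> < n" using True z(2) by simp
        then obtain t where t: "t \<in> cox_vs.span (T (n - \<gamma>))" "gpart w (n - \<gamma>) r - t \<in> \<bb>"
          using less.IH supported_part by blast
        have "gpart w n (r * z) = z * gpart w (n - \<gamma>) r"
          using gpart_mult_homog[OF wt z(1), of "n - \<gamma>" r] True by (simp add: mult.commute)
        moreover have "z * (gpart w (n - \<gamma>) r - t) \<in> \<bb>" by (rule type_ideal_mult[OF b t(2)])
        ultimately have "gpart w n (r * z) - z * t \<in> \<bb>" by (simp only: right_diff_distrib)
        then show ?thesis using Tz[OF t(1) \<open>n - \<gamma> < n\<close>] by blast
      next
        case False
        then have "gpart w n (r * z) = 0" using gpart_mult_homog_less[OF wt z(1), of n r] by (simp add: mult.commute)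
        then show ?thesis using type_ideal_zero[OF b] cox_vs.span_zero by (intro bexI[of _ 0]) auto
      qed
      have "\<exists>t\<in>cox_vs.span (T n). gpart w n (r * l) - t \<in> \<bb>" by (rule aux[OF l]) (rule T_l)
      then obtain t where t: "t \<in> cox_vs.span (T n)" "gpart w n (r * l) - t \<in> \<bb>" by blast
      have "\<exists>t\<in>cox_vs.span (T n). gpart w n (s * \<eta>) - t \<in> \<bb>" by (rule aux[OF \<eta>]) (rule T_\<eta>)
      then obtain t' where t': "t' \<in> cox_vs.span (T n)" "gpart w n (s * \<eta>) - t' \<in> \<bb>" by blast
      have "f = gpart w n f" by (rule part_supported[OF less.prems, symmetric])
      also have "\<dots> = gpart w n j + gpart w n (r * l) + gpart w n (s * \<eta>)" by (simp only: f(1) part_add)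
      finally have "f - (t + t') = gpart w n j + ((gpart w n (r * l) - t) + (gpart w n (s * \<eta>) - t'))"
        by (simp add: algebra_simps)
      also have "\<dots> \<in> \<bb>" by (intro type_ideal_add[OF b] hom f(2) t(2) t'(2))
      finally show ?thesis using cox_vs.span_add[OF t(1) t'(1)] by blast
    qed
  qed
  have span_below: "\<exists>t\<in>cox_vs.span (T n). f - t \<in> \<bb>" if f: "supported (\<lambda>e. w e \<le> n) f" for n f
  proof -
    have "\<exists>t\<in>cox_vs.span (T n). gpart w i f - t \<in> \<bb>" if "i < Suc n" for i
      using span_homog[OF supported_part, of i f] cox_vs.span_mono[OF T_mono, of i n] that by auto
    then obtain t where t: "\<And>i. i < Suc n \<Longrightarrow> t i \<in> cox_vs.span (T n) \<and> gpart w i f - t i \<in> \<bb>" by metis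
    have "f = (\<Sum>i<Suc n. gpart w i f)"
      by (rule below_decompose) (use f in \<open>auto simp: supported_def less_Suc_eq_le\<close>)
    then have "f - (\<Sum>i<Suc n. t i) = (\<Sum>i<Suc n. gpart w i f - t i)" by (simp only: sum_subtractf)
    also have "\<dots> \<in> \<bb>" by (intro type_ideal_sum[OF b]) (use t in auto)
    finally show ?thesis using t by (intro bexI[of _ "\<Sum>i<Suc n. t i"] cox_vs.span_sum) auto
  qed
  obtain f1 f2 f3 where f: "f1 \<in> P1" "f1 \<notin> P0" "f2 \<in> P2" "f2 \<notin> P1" "f3 \<in> P3" "f3 \<notin> P2"
    using chain by blast
  have sub: "P0 \<subseteq> P1" "P1 \<subseteq> P2" "P2 \<subseteq> P3" using chain by auto
  have const0: "c = 0" if "const c \<in> P3" for c :: 'k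
  proof (rule ccontr)
    assume "c \<noteq> 0"
    have "const (inverse c) * const c \<in> P3" using P(4) that by (auto simp: type_primeideal_iff type_ideal_iff)
    then show False using P(4) \<open>c \<noteq> 0\<close> by (auto simp: const_inverse type_primeideal_iff)
  qed
  have indep: "c i j k = 0"
    if "(\<Sum>i\<le>m. (\<Sum>j\<le>m. (\<Sum>k\<le>m. const (c i j k) * f3 ^ k) * f2 ^ j) * f1 ^ i) \<in> P0"
      "i \<le> m" "j \<le> m" "k \<le> m" for c i j k m
  proof -
    have 3: "const (c i j k) = 0" if "(\<Sum>k\<le>m. const (c i j k) * f3 ^ k) \<in> P2" "k \<le> m" for i j k
      by (rule power_sum_in_prime[OF P(3,4) sub(3) f(5,6) that(1) _ that(2)]) (metis const0 const_0)
    have 2: "(\<Sum>k\<le>m. const (c i j k) * f3 ^ k) = 0"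
      if "(\<Sum>j\<le>m. (\<Sum>k\<le>m. const (c i j k) * f3 ^ k) * f2 ^ j) \<in> P1" "j \<le> m" for i j
      by (rule power_sum_in_prime[OF P(2,3) sub(2) f(3,4) that(1) _ that(2)]) (use 3 in \<open>auto intro!: sum.neutral\<close>)
    have 1: "(\<Sum>j\<le>m. (\<Sum>k\<le>m. const (c i j k) * f3 ^ k) * f2 ^ j) = 0"
      by (rule power_sum_in_prime[OF P(1,2) sub(1) f(1,2) that(1) _ that(2)]) (use 2 in \<open>auto intro!: sum.neutral\<close>)
    have 0: "0 \<in> P1" "0 \<in> P2" using P by (auto simp: type_primeideal_iff type_ideal_iff)
    have "(\<Sum>j\<le>m. (\<Sum>k\<le>m. const (c i j k) * f3 ^ k) * f2 ^ j) \<in> P1" unfolding 1 by (rule 0)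
    from 2[OF this that(3)] have "(\<Sum>k\<le>m. const (c i j k) * f3 ^ k) \<in> P2" using 0 by simp
    then have "const (c i j k) = 0" by (rule 3[OF _ that(4)])
    then show ?thesis by (metis const_def lookup_single_eq lookup_zero)
  qed
  obtain u where u: "below w u f1" "below w u f2" "below w u f3"
  proof -
    obtain a b c where "below w a f1" "below w b f2" "below w c f3" using below_exists by metis
    then show ?thesis by (intro that[of "a + b + c"]) (auto simp: supported_def)
  qed
  \<comment> \<open>The \<open>(m + 1)\<^sup>3\<close> products of powers of \<open>f1, f2, f3\<close> with exponents at most \<open>m\<close> have weight at
    most \<open>n\<close>, and the choice of \<open>m\<close> gives \<open>(n + 1)\<^sup>2 * card E < (m + 1)\<^sup>3\<close>.\<close>
  define m where "m = (3 * u + 1) ^ 2 * card E"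
  define n where "n = 3 * m * u"
  define \<phi> where "\<phi> = (\<lambda>(i, j, k). f3 ^ k * f2 ^ j * f1 ^ i)"
  let ?X = "{..m} \<times> {..m} \<times> {..m}"
  have pow: "supported (\<lambda>e. w e \<le> i * u) (f ^ i)" if "below w u f" for f and i :: nat
  proof (induction i)
    case 0 show ?case by (simp add: supported_def additive_zero[OF wt])
  next
    case (Suc i)
    show ?case unfolding power_Suc
      by (rule supported_mult[OF that Suc]) (simp add: additiveD[OF wt])
  qed
  have "\<exists>t\<in>cox_vs.span (T n). \<phi> x - t \<in> \<bb>" if x: "x \<in> ?X" for x
  proof (rule span_below)
    obtain i j k where x': "x = (i, j, k)" "i \<le> m" "j \<le> m" "k \<le> m" using x by auto
    have "supported (\<lambda>e. w e \<le> k * u + j * u + i * u) (\<phi> x)"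
      unfolding \<phi>_def x' prod.case
      by (rule supported_mult[OF supported_mult[OF pow[OF u(3)] pow[OF u(2)], where R = "\<lambda>e. w e \<le> k * u + j * u"] pow[OF u(1)]])
         (simp_all add: additiveD[OF wt])
    moreover have "k * u + j * u + i * u \<le> n"
      unfolding n_def using mult_le_mono1[OF x'(2), of u] mult_le_mono1[OF x'(3), of u]
        mult_le_mono1[OF x'(4), of u] by linarith
    ultimately show "supported (\<lambda>e. w e \<le> n) (\<phi> x)" by (auto simp: supported_def)
  qed
  then obtain t where t: "\<And>x. x \<in> ?X \<Longrightarrow> t x \<in> cox_vs.span (T n) \<and> \<phi> x - t x \<in> \<bb>" by metis
  have id0: "ideal P0 type_ring" using P by (simp add: type_primeideal_iff)
  have key: "c x = 0" if c: "(\<Sum>x\<in>?X. const (c x) * t x) \<in> P0" and x: "x \<in> ?X" for c x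
  proof -
    have "(\<Sum>x\<in>?X. const (c x) * (\<phi> x - t x)) \<in> P0"
      using t chain(1) by (intro type_ideal_sum[OF id0] type_ideal_mult[OF id0]) blast
    then have "(\<Sum>x\<in>?X. const (c x) * (\<phi> x - t x)) + (\<Sum>x\<in>?X. const (c x) * t x) \<in> P0"
      by (rule type_ideal_add[OF id0 _ c])
    also have "(\<Sum>x\<in>?X. const (c x) * (\<phi> x - t x)) + (\<Sum>x\<in>?X. const (c x) * t x) = (\<Sum>x\<in>?X. const (c x) * \<phi> x)"
      by (simp add: sum.distrib[symmetric] right_diff_distrib)
    also have "\<dots> = (\<Sum>i\<le>m. (\<Sum>j\<le>m. (\<Sum>k\<le>m. const (c (i, j, k)) * f3 ^ k) * f2 ^ j) * f1 ^ i)"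
      by (simp add: \<phi>_def sum.cartesian_product' sum_distrib_right mult.assoc)
    finally show ?thesis using indep[of "\<lambda>i j k. c (i, j, k)" m] x by auto
  qed
  have inj: "inj_on t ?X"
  proof (rule inj_onI, rule ccontr)
    fix x y assume xy: "x \<in> ?X" "y \<in> ?X" "t x = t y" "x \<noteq> y"
    define c where "c = (\<lambda>z. (if z = x then 1 else if z = y then -1 else 0) :: 'k)"
    have "(\<Sum>z\<in>?X. const (c z) * t z) = (\<Sum>z\<in>{x, y}. const (c z) * t z)"
      by (rule sum.mono_neutral_right) (use xy in \<open>auto simp: c_def\<close>)
    also have "\<dots> = 0" using xy const_add[of 1 "-1"] by (simp add: c_def flip: distrib_right)
    finally have "c x = 0" using key[OF _ xy(1)] type_ideal_zero[OF id0] by metis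
    then show False by (simp add: c_def)
  qed
  have "\<not> cox_vs.dependent (t ` ?X)"
  proof (rule cox_vs.independent_if_scalars_zero)
    fix c y assume c: "(\<Sum>z\<in>t ` ?X. const (c z) * z) = 0" and y: "y \<in> t ` ?X"
    have "(\<Sum>x\<in>?X. const (c (t x)) * t x) = 0" using c inj by (simp add: sum.reindex)
    then have "(\<Sum>x\<in>?X. const (c (t x)) * t x) \<in> P0" using type_ideal_zero[OF id0] by metis
    then show "c y = 0" using key[of "\<lambda>x. c (t x)"] y by blast
  qed simp
  moreover have "t ` ?X \<subseteq> cox_vs.span (T n)" using t by blast
  ultimately have "card (t ` ?X) \<le> card (T n)" using cox_vs.independent_span_bound[OF finT] by blast
  moreover have "card (t ` ?X) = (m + 1) ^ 3"
    by (simp add: card_image[OF inj] card_cartesian_product power3_eq_cube algebra_simps)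
  ultimately have "(m + 1) ^ 3 \<le> (n + 1) ^ 2 * card E" using cardT[of n] by linarith
  moreover have "(n + 1) ^ 2 * card E < (m + 1) ^ 3"
  proof -
    have "n + 1 \<le> (3 * u + 1) * (m + 1)" unfolding n_def by (simp add: algebra_simps)
    then have "(n + 1) ^ 2 \<le> ((3 * u + 1) * (m + 1)) ^ 2" by (rule power_mono) simp
    then have "(n + 1) ^ 2 * card E \<le> ((3 * u + 1) * (m + 1)) ^ 2 * card E" by (rule mult_right_mono) simp
    also have "\<dots> = ((3 * u + 1) ^ 2 * card E) * (m + 1) ^ 2" by (simp only: power_mult_distrib mult_ac)
    also have "\<dots> = m * (m + 1) ^ 2" by (simp only: m_def[symmetric])
    also have "\<dots> < (m + 1) * (m + 1) ^ 2" by simp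
    finally show ?thesis by (simp only: power3_eq_cube power2_eq_square mult.assoc)
  qed
  ultimately show False by linarith
qed


section \<open>Parameters for the quotient by the truncated ideal\<close>

text \<open>The element \<open>u\<^sup>b (u\<^sup>d + G) - u\<^sup>b G\<close> is a power of \<open>u\<close>, and modulo \<open>u\<close> the element \<open>u\<^sup>d + G\<close> is
  a unit times \<open>v\<^sup>d\<close>. So the ideal of \<open>u\<^sup>d + G\<close> and \<open>u\<^sup>b G\<close> contains powers of \<open>u\<close> and of \<open>v\<close>:
  over any field the two forms have no common zero on the projective line.\<close>

lemma form_cancel:
  fixes u v :: "'a::comm_ring_1"
  assumes b: "ideal \<bb> type_ring" and G: "G = \<kappa> * v ^ d + u * h" "\<kappa>' * \<kappa> = 1" "d > 0"
    and f: "(u ^ d + G) * f \<in> \<bb>" "(u ^ b * G) * f \<in> \<bb>"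
  shows "u ^ (b + d) * f \<in> \<bb>" "v ^ (d * (b + d)) * f \<in> \<bb>"
proof -
  have "u ^ b * ((u ^ d + G) * f) - (u ^ b * G) * f \<in> \<bb>"
    by (intro type_ideal_diff[OF b] type_ideal_mult[OF b] f)
  then show ub: "u ^ (b + d) * f \<in> \<bb>" by (simp add: algebra_simps power_add)
  \<comment> \<open>Modulo \<open>u\<^sup>d + G\<close> the element \<open>v\<^sup>d\<close> is the multiple \<open>z\<close> of \<open>u\<close>.\<close>
  define z where "z = - \<kappa>' * u * (u ^ (d - 1) + h)"
  have "u ^ d = u * u ^ (d - 1)" using G(3) by (cases d) auto
  then have "u ^ d + G = \<kappa> * v ^ d + u * (u ^ (d - 1) + h)" using G(1) by (simp add: algebra_simps)
  then have "\<kappa>' * (u ^ d + G) = (\<kappa>' * \<kappa>) * v ^ d - z" by (simp add: z_def algebra_simps)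
  then have vd: "v ^ d = \<kappa>' * (u ^ d + G) + z" using G(2) by simp
  have "v ^ (d * m) * f - z ^ m * f \<in> \<bb>" for m
  proof (induction m)
    case 0 show ?case using type_ideal_zero[OF b] by simp
  next
    case (Suc m)
    have "v ^ (d * Suc m) * f - z ^ Suc m * f = v ^ d * (v ^ (d * m) * f - z ^ m * f) + (z ^ m * (v ^ d - z)) * f"
      by (simp add: power_add algebra_simps)
    also have "(z ^ m * (v ^ d - z)) * f = (z ^ m * \<kappa>') * ((u ^ d + G) * f)"
      by (simp add: vd algebra_simps)
    finally show ?case
      using type_ideal_add[OF b type_ideal_mult[OF b Suc] type_ideal_mult[OF b f(1)]] by metis
  qed
  moreover have "z ^ (b + d) * f \<in> \<bb>"
  proof -
    have "z = (- \<kappa>' * (u ^ (d - 1) + h)) * u" by (simp add: z_def mult_ac)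
    then have "z ^ (b + d) * f = (- \<kappa>' * (u ^ (d - 1) + h)) ^ (b + d) * (u ^ (b + d) * f)"
      by (simp only: power_mult_distrib mult.assoc)
    then show ?thesis using type_ideal_mult[OF b ub] by metis
  qed
  ultimately show "v ^ (d * (b + d)) * f \<in> \<bb>" using type_ideal_cong[OF b] by blast
qed

lemma lookup_single_mult:
  "Poly_Mapping.lookup (Poly_Mapping.single a (1 :: 'k::field) * f) (a + e) =
     Poly_Mapping.lookup (f :: (cox_var \<Rightarrow>\<^sub>0 nat) \<Rightarrow>\<^sub>0 'k) e"
proof -
  have "Poly_Mapping.single a 1 * f =
      (\<Sum>e'\<in>Poly_Mapping.keys f. Poly_Mapping.single (a + e') (Poly_Mapping.lookup f e'))"
    by (subst sum_monomials[of f, symmetric]) (simp add: sum_distrib_left mult_single)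
  then have "Poly_Mapping.lookup (Poly_Mapping.single a 1 * f) (a + e) =
      (\<Sum>e'\<in>Poly_Mapping.keys f. Poly_Mapping.lookup f e' when e' = e)"
    by (simp add: lookup_sum lookup_single)
  also have "\<dots> = Poly_Mapping.lookup f e"
    by (cases "e \<in> Poly_Mapping.keys f") (auto simp: when_def sum.delta not_in_keys_iff_lookup_eq_zero)
  finally show ?thesis .
qed

lemma var_power_factor:
  "supported (\<lambda>e. n \<le> Poly_Mapping.lookup e v) f \<longleftrightarrow> (\<exists>r. f = cox_gen v ^ n * (r :: 'k::field cox))"
proof
  assume f: "supported (\<lambda>e. n \<le> Poly_Mapping.lookup e v) f"
  have "f = (\<Sum>e\<in>Poly_Mapping.keys f. cox_gen v ^ n * Poly_Mapping.single (e - Poly_Mapping.single v n) (Poly_Mapping.lookup f e))"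
    using f by (subst sum_monomials[of f, symmetric]) (intro sum.cong, auto simp: supported_def monomial_var_power)
  then have "f = cox_gen v ^ n *
      (\<Sum>e\<in>Poly_Mapping.keys f. Poly_Mapping.single (e - Poly_Mapping.single v n) (Poly_Mapping.lookup f e))"
    by (simp only: sum_distrib_left)
  then show "\<exists>r. f = cox_gen v ^ n * r" by (rule exI)
next
  assume "\<exists>r. f = cox_gen v ^ n * r"
  then obtain r where "f = cox_gen v ^ n * r" by blast
  then show "supported (\<lambda>e. n \<le> Poly_Mapping.lookup e v) f"
    unfolding cox_gen_power
    using supported_mult[of "\<lambda>e. n \<le> Poly_Mapping.lookup e v" "Poly_Mapping.single (Poly_Mapping.single v n) (1::'k)" "\<lambda>_. True" r
        "\<lambda>e. n \<le> Poly_Mapping.lookup e v"]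
    by (simp add: supported_def lookup_add)
qed

lemma var_power_cancel:
  assumes "u \<noteq> v" "cox_gen v ^ n * r = cox_gen u ^ m * (s :: 'k::field cox)"
  shows "\<exists>t. r = cox_gen u ^ m * t"
proof -
  have "supported (\<lambda>e. m \<le> Poly_Mapping.lookup e u) r"
    unfolding supported_def
  proof
    fix e assume "e \<in> Poly_Mapping.keys r"
    then have "Poly_Mapping.single v n + e \<in> Poly_Mapping.keys (cox_gen v ^ n * r)"
      by (simp add: in_keys_iff cox_gen_power lookup_single_mult)
    moreover have "supported (\<lambda>e. m \<le> Poly_Mapping.lookup e u) (cox_gen v ^ n * r)"
      unfolding assms(2) by (subst var_power_factor) blast
    ultimately have "m \<le> Poly_Mapping.lookup (Poly_Mapping.single v n + e) u" by (auto simp: supported_def)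
    then show "m \<le> Poly_Mapping.lookup e u" using assms(1) by (simp add: lookup_add lookup_single)
  qed
  then show ?thesis by (simp only: var_power_factor)
qed

text \<open>Comparing the two equations, \<open>u\<^sup>m\<close> divides \<open>v\<^sup>n r\<close>, hence \<open>r\<close>.\<close>

lemma principal_saturated:
  fixes F :: "'k::field cox"
  assumes "u \<noteq> v" "F \<noteq> 0" "cox_gen u ^ m * f = F * r" "cox_gen v ^ n * f = F * s"
  shows "\<exists>t. f = F * t"
proof -
  have "F * (cox_gen v ^ n * r) = cox_gen v ^ n * (cox_gen u ^ m * f)" by (simp only: assms(3) mult.left_commute)
  also have "\<dots> = F * (cox_gen u ^ m * s)" by (simp only: assms(4) mult.left_commute)
  finally have "cox_gen v ^ n * r = cox_gen u ^ m * s" using assms(2) by simp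
  then obtain t where "r = cox_gen u ^ m * t" using var_power_cancel[OF assms(1)] by blast
  then have "cox_gen u ^ m * f = cox_gen u ^ m * (F * t)" using assms(3) by (simp add: mult_ac)
  moreover have "cox_gen u \<noteq> (0 :: 'k cox)" by (simp add: cox_gen_def) (metis lookup_single_eq lookup_zero zero_neq_one)
  ultimately show ?thesis by auto
qed

lemma monic_form_nonzero:
  assumes "c \<noteq> 0" "u \<noteq> v"
  shows "const c * cox_gen v ^ d + cox_gen u * (h :: 'k::field cox) \<noteq> 0"
proof
  assume "const c * cox_gen v ^ d + cox_gen u * h = 0"
  then have "Poly_Mapping.lookup (const c * cox_gen v ^ d + cox_gen u * h) (Poly_Mapping.single v d) = 0" by simp
  moreover have "supported (\<lambda>e. 1 \<le> Poly_Mapping.lookup e u) (cox_gen u * h)"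
    using var_power_factor[of 1 u "cox_gen u * h"] by auto
  then have "Poly_Mapping.lookup (cox_gen u * h) (Poly_Mapping.single v d) = 0"
    using assms(2) by (force simp: supported_def in_keys_iff lookup_single)
  ultimately show False using assms(1) by (simp add: lookup_add const_def cox_gen_power mult_single)
qed

lemma xdeg_large_in_ideal:
  assumes b: "ideal \<bb> (cox_ring :: 'k::field cox ring)" and "cox_gen X10 ^ m \<in> \<bb>" "cox_gen X11 ^ n \<in> \<bb>"
    and f: "supported (\<lambda>e. m + n \<le> xdeg e) f"
  shows "f \<in> \<bb>"
proof -
  have "Poly_Mapping.single e c \<in> \<bb>" if e: "m + n \<le> xdeg e" for e c
  proof -
    consider "m \<le> Poly_Mapping.lookup e X10" | "n \<le> Poly_Mapping.lookup e X11"
      using e unfolding xdeg_def by linarith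
    then show ?thesis
      by cases (use assms in \<open>simp_all add: monomial_var_power type_ideal_mult_right\<close>)
  qed
  then have "(\<Sum>e\<in>Poly_Mapping.keys f. Poly_Mapping.single e (Poly_Mapping.lookup f e)) \<in> \<bb>"
    using f by (intro type_ideal_sum[OF b]) (auto simp: supported_def)
  then show ?thesis by (simp only: sum_monomials)
qed

text \<open>The power \<open>(x\<^sub>0, x\<^sub>1)\<^sup>a\<close>, in the form of the span of its monomials.\<close>

definition xpower :: "nat \<Rightarrow> 'k::field cox set" where
  "xpower a = {f. supported (\<lambda>e. a \<le> xdeg e) f}"

lemma xpower_ideal: "ideal (xpower a) cox_ring"
  unfolding xpower_def by (rule weight_ideal[OF additive_xdeg])

lemma xpower_below:
  "f \<in> xpower a \<longleftrightarrow> (\<forall>i<a. gpart xdeg i f = 0)"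
proof
  assume *: "\<forall>i<a. gpart xdeg i f = 0"
  have "Poly_Mapping.lookup f e = 0" if "xdeg e < a" for e
  proof -
    have "Poly_Mapping.lookup (gpart xdeg (xdeg e) f) e = 0" using * that by simp
    then show ?thesis by (simp add: lookup_part)
  qed
  then show "f \<in> xpower a" unfolding xpower_def supported_def
    by (auto simp: in_keys_iff not_less[symmetric])
next
  assume "f \<in> xpower a"
  then show "\<forall>i<a. gpart xdeg i f = 0"
    using part_supported_none[of "\<lambda>e. a \<le> xdeg e" f] by (auto simp: xpower_def)
qed

text \<open>The properties of the ideal of a zero-dimensional subscheme from which both conclusions
  follow. The form \<open>F = y\<^sub>0\<^sup>b F'\<close> has no zero in common with \<open>l = y\<^sub>0\<^sup>d + F'\<close>, which makes \<open>l\<close> a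
  nonzerodivisor modulo \<open>I\<close>; likewise for \<open>G\<close> and \<open>g\<close>.\<close>

locale saturated_points =
  fixes I :: "'k::field cox set" and F' G' :: "'k cox" and b c d e :: nat
  assumes hom_ideal: "homogeneous_ideal I"
    and satx: "cox_gen X10 ^ m * f \<in> I \<Longrightarrow> cox_gen X11 ^ n * f \<in> I \<Longrightarrow> f \<in> I"
    and saty: "cox_gen X20 ^ m * f \<in> I \<Longrightarrow> cox_gen X21 ^ n * f \<in> I \<Longrightarrow> f \<in> I"
    and F': "monic_form X20 X21 d F'" "d > 0" "cox_gen X20 ^ b * F' \<in> I"
    and G': "monic_form X10 X11 e G'" "e > 0" "cox_gen X10 ^ c * G' \<in> I"
begin

definition F where "F = cox_gen X20 ^ b * F'"
definition G where "G = cox_gen X10 ^ c * G'"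
definition l where "l = cox_gen X20 ^ d + F'"
definition g where "g = cox_gen X10 ^ e + G'"

lemma id: "ideal I cox_ring"
  using hom_ideal by (simp add: homogeneous_ideal_def)

lemma F_in: "F \<in> I" and G_in: "G \<in> I"
  using F'(3) G'(3) by (simp_all add: F_def G_def)

lemma bideg:
  "supported (\<lambda>\<epsilon>. xdeg \<epsilon> = 0 \<and> ydeg \<epsilon> = b + d) F" "supported (\<lambda>\<epsilon>. xdeg \<epsilon> = 0 \<and> ydeg \<epsilon> = d) l"
  "supported (\<lambda>\<epsilon>. xdeg \<epsilon> = c + e \<and> ydeg \<epsilon> = 0) G" "supported (\<lambda>\<epsilon>. xdeg \<epsilon> = e \<and> ydeg \<epsilon> = 0) g"
proof -
  have f: "supported (\<lambda>\<epsilon>. xdeg \<epsilon> = 0 \<and> ydeg \<epsilon> = d) F'" "supported (\<lambda>\<epsilon>. xdeg \<epsilon> = e \<and> ydeg \<epsilon> = 0) G'"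
    using F'(1) G'(1) unfolding monic_form_def
    by (auto elim!: supported_mono simp: xdeg_def ydeg_def)
  have y: "supported (\<lambda>\<epsilon>. xdeg \<epsilon> = 0 \<and> ydeg \<epsilon> = n) (cox_gen X20 ^ n :: 'k cox)"
    and x: "supported (\<lambda>\<epsilon>. xdeg \<epsilon> = n \<and> ydeg \<epsilon> = 0) (cox_gen X10 ^ n :: 'k cox)" for n
    by (simp_all add: cox_gen_power supported_def xdeg_def ydeg_def lookup_single)
  show "supported (\<lambda>\<epsilon>. xdeg \<epsilon> = 0 \<and> ydeg \<epsilon> = b + d) F"
    unfolding F_def by (rule supported_mult[OF y f(1)]) (simp add: additiveD additive_xdeg additive_ydeg)
  show "supported (\<lambda>\<epsilon>. xdeg \<epsilon> = c + e \<and> ydeg \<epsilon> = 0) G"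
    unfolding G_def by (rule supported_mult[OF x f(2)]) (simp add: additiveD additive_xdeg additive_ydeg)
  show "supported (\<lambda>\<epsilon>. xdeg \<epsilon> = 0 \<and> ydeg \<epsilon> = d) l" unfolding l_def by (intro supported_add y f)
  show "supported (\<lambda>\<epsilon>. xdeg \<epsilon> = e \<and> ydeg \<epsilon> = 0) g" unfolding g_def by (intro supported_add x f)
qed

lemma xdeg_homog: "homog xdeg 0 F" "homog xdeg 0 l" "homog xdeg (c + e) G" "homog xdeg e g"
  using bideg by (auto elim: supported_mono)

lemma y_cancel:
  assumes "ideal \<bb> type_ring" "l * f \<in> \<bb>" "F * f \<in> \<bb>"
  shows "cox_gen X20 ^ (b + d) * f \<in> \<bb>" "cox_gen X21 ^ (d * (b + d)) * f \<in> \<bb>"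
proof -
  obtain \<kappa> h where *: "\<kappa> \<noteq> 0" "F' = const \<kappa> * cox_gen X21 ^ d + cox_gen X20 * h"
    using F'(1) by (auto simp: monic_form_def)
  note r = form_cancel[OF assms(1) *(2) const_inverse[OF *(1)] F'(2), of f b]
  show "cox_gen X20 ^ (b + d) * f \<in> \<bb>" "cox_gen X21 ^ (d * (b + d)) * f \<in> \<bb>"
    using r assms(2,3) by (simp_all add: l_def F_def)
qed

lemma x_cancel:
  assumes "ideal \<bb> type_ring" "g * f \<in> \<bb>" "G * f \<in> \<bb>"
  shows "cox_gen X10 ^ (c + e) * f \<in> \<bb>" "cox_gen X11 ^ (e * (c + e)) * f \<in> \<bb>"
proof -
  obtain \<kappa> h where *: "\<kappa> \<noteq> 0" "G' = const \<kappa> * cox_gen X11 ^ e + cox_gen X10 * h"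
    using G'(1) by (auto simp: monic_form_def)
  note r = form_cancel[OF assms(1) *(2) const_inverse[OF *(1)] G'(2), of f c]
  show "cox_gen X10 ^ (c + e) * f \<in> \<bb>" "cox_gen X11 ^ (e * (c + e)) * f \<in> \<bb>"
    using r assms(2,3) by (simp_all add: g_def G_def)
qed

lemma l_cancel: "l * f \<in> I \<Longrightarrow> f \<in> I"
  using saty y_cancel[OF id] type_ideal_mult_right[OF id F_in] by blast

lemma g_cancel: "g * f \<in> I \<Longrightarrow> f \<in> I"
  using satx x_cancel[OF id] type_ideal_mult_right[OF id G_in] by blast

lemma nonzero: "F \<noteq> 0" "l \<noteq> 0"
proof -
  obtain \<kappa> h where *: "\<kappa> \<noteq> 0" "F' = const \<kappa> * cox_gen X21 ^ d + cox_gen X20 * h"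
    using F'(1) by (auto simp: monic_form_def)
  have "cox_gen X20 \<noteq> (0 :: 'k cox)" by (simp add: cox_gen_def) (metis lookup_single_eq lookup_zero zero_neq_one)
  moreover have "F' \<noteq> 0" unfolding *(2) by (rule monic_form_nonzero[OF *(1)]) simp
  ultimately show "F \<noteq> 0" by (simp add: F_def)
  have "cox_gen X20 ^ d = cox_gen X20 * (cox_gen X20 ^ (d - 1) :: 'k cox)" using F'(2) by (cases d) auto
  then have "l = const \<kappa> * cox_gen X21 ^ d + cox_gen X20 * (cox_gen X20 ^ (d - 1) + h)"
    unfolding l_def using *(2) by (simp add: algebra_simps)
  then show "l \<noteq> 0" using monic_form_nonzero[OF *(1), of X20 X21 d] by simp
qed

lemma principal_ideal: "ideal {F * r |r. True} cox_ring"
proof (rule type_idealI)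
  show "0 \<in> {F * r |r. True}" by (auto intro: exI[of _ 0])
  show "x + y \<in> {F * r |r. True}" if "x \<in> {F * r |r. True}" "y \<in> {F * r |r. True}" for x y
    using that by (auto simp flip: distrib_left)
  show "r * x \<in> {F * r |r. True}" if "x \<in> {F * r |r. True}" for x r
    using that by (auto simp: mult.left_commute)
qed

lemma F_l_regular:
  assumes "F * f = l * r"
  shows "\<exists>s. f = l * s"
proof -
  have r: "l * r \<in> {F * r |r. True}" "F * r \<in> {F * r |r. True}" using assms by (metis (mono_tags, lifting) mem_Collect_eq)+
  obtain t where t: "r = F * t"
    using y_cancel[OF principal_ideal r] principal_saturated[of X20 X21 F] nonzero(1) by blast
  then have "F * f = F * (l * t)" using assms by (simp add: mult.left_commute)
  then show ?thesis using nonzero(1) by auto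
qed

text \<open>The ideal generated by \<open>g\<close> and \<open>G\<close> contains \<open>x\<^sub>0\<^bsup>c+e\<^esup>\<close> and \<open>x\<^sub>1\<^bsup>e(c+e)\<^esup>\<close>, hence all monomials
  of degree at least \<open>N\<^sub>0\<close> in \<open>x\<^sub>0, x\<^sub>1\<close>.\<close>

definition N\<^sub>0 :: nat where "N\<^sub>0 = (c + e) + e * (c + e)"

text \<open>Since \<open>G \<in> I\<close>, multiplication by \<open>g\<close> is onto the part of \<open>S / I\<close> of \<open>x\<close>-degree \<open>i\<close>; it is also
  injective, by \<open>g_cancel\<close>.\<close>

lemma g_surjective:
  assumes f: "homog xdeg i f" and i: "N\<^sub>0 \<le> i"
  shows "\<exists>k. homog xdeg (i - e) k \<and> f - g * k \<in> I"
proof -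
  let ?B = "{j + r * g |j r. j \<in> I}"
  have B: "ideal ?B cox_ring" by (rule type_ideal_plus_principal[OF id])
  have "g = 0 + 1 * g" "0 \<in> I" using type_ideal_zero[OF id] by auto
  then have gB: "g * 1 \<in> ?B" by (metis (mono_tags, lifting) mem_Collect_eq mult_1_right)
  have "G * 1 = G + 0 * g" by simp
  then have GB: "G * 1 \<in> ?B" using G_in by blast
  have "cox_gen X10 ^ (c + e) \<in> ?B" "cox_gen X11 ^ (e * (c + e)) \<in> ?B"
    using x_cancel[OF B gB GB] by simp_all
  then have "f \<in> ?B"
    by (rule xdeg_large_in_ideal[OF B]) (use f i in \<open>auto simp: supported_def N\<^sub>0_def\<close>)
  then obtain j r where jr: "f = j + r * g" "j \<in> I" by blast
  have ie: "i = e + (i - e)" using i by (simp add: N\<^sub>0_def)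
  have "f = gpart xdeg i j + gpart xdeg i (g * r)"
    using part_supported[OF f] jr(1) by (metis mult.commute part_add)
  also have "gpart xdeg i (g * r) = g * gpart xdeg (i - e) r"
    by (subst ie) (rule gpart_mult_homog[OF additive_xdeg xdeg_homog(4)])
  finally have "f - g * gpart xdeg (i - e) r \<in> I"
    using homogeneous_ideal_part[OF hom_ideal jr(2), of "\<lambda>x y. x = i"] by simp
  then show ?thesis using supported_part by blast
qed

lemma l_cancel_xpower: "l * f \<in> xpower a \<Longrightarrow> f \<in> xpower a"
  using gpart_mult_homog[OF additive_xdeg xdeg_homog(2), of _ f] nonzero(2)
  unfolding xpower_below by auto

abbreviation J :: "nat \<Rightarrow> 'k cox set" where "J a \<equiv> I \<inter> xpower a"

lemma J_ideal: "ideal (J a) cox_ring"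
  using id xpower_ideal[of a] unfolding type_ideal_iff by blast

text \<open>The ring \<open>S / (I \<inter> (x)\<^sup>a)\<close> is an extension of \<open>S / (x)\<^sup>a\<close> by \<open>N = (x)\<^sup>a / (I \<inter> (x)\<^sup>a)\<close>, the
  part of \<open>S / I\<close> of \<open>x\<close>-degree at least \<open>a\<close>. On the former \<open>g\<close> is nilpotent and \<open>l, F\<close> is a
  regular pair. On the latter \<open>F\<close> is zero, and \<open>g\<close> maps the part of \<open>x\<close>-degree \<open>i\<close>
  isomorphically to the part of degree \<open>i + e\<close> because \<open>a\<close> is large, so that \<open>N / g N\<close> consists
  of parts of \<open>S / I\<close>, where \<open>l\<close> is a nonzerodivisor.\<close>

theorem parameters_regular:
  assumes a: "N\<^sub>0 \<le> a"
  shows "regular_pair (J a) l (g + F)"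
proof -
  have nzd: "f \<in> J a" if "l * f \<in> J a" for f
    using that l_cancel l_cancel_xpower by blast
  \<comment> \<open>The argument in \<open>S / (x)\<^sup>a\<close>, one \<open>x\<close>-degree after the other.\<close>
  have stepA: "\<exists>f'. f - l * f' \<in> xpower i" if fh: "(g + F) * f - l * h \<in> xpower a" and "i \<le> a" for f h i
    using \<open>i \<le> a\<close>
  proof (induction i)
    case 0
    have "f - l * 0 \<in> xpower 0" by (simp add: xpower_def supported_def)
    then show ?case by blast
  next
    case (Suc i)
    then obtain f' where f': "f - l * f' \<in> xpower i" by auto
    define f1 where "f1 = f - l * f'"
    have eq: "(g + F) * f - l * h = g * f1 + F * f1 - l * (h - (g + F) * f')"
      by (simp add: f1_def algebra_simps)
    have "supported (\<lambda>\<epsilon>. i < xdeg \<epsilon>) (g * f1)"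
      by (rule supported_mult[OF xdeg_homog(4) f'[unfolded xpower_def mem_Collect_eq, folded f1_def]])
         (use G'(2) in \<open>simp add: additiveD[OF additive_xdeg]\<close>)
    then have "gpart xdeg i (g * f1) = 0" by (rule part_supported_none) auto
    moreover have "gpart xdeg i ((g + F) * f - l * h) = 0" using fh Suc.prems by (simp add: xpower_below)
    ultimately have "F * gpart xdeg i f1 = l * gpart xdeg i (h - (g + F) * f')"
      using gpart_mult_homog[OF additive_xdeg xdeg_homog(1), of i] gpart_mult_homog[OF additive_xdeg xdeg_homog(2), of i]
      unfolding eq by (simp add: part_add part_diff)
    then obtain s where s: "gpart xdeg i f1 = l * s" using F_l_regular by blast
    have "gpart xdeg j (f1 - l * s) = 0" if "j < Suc i" for j
    proof (cases "j = i")
      case True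
      have "gpart xdeg i (gpart xdeg i f1) = gpart xdeg i f1" by (rule part_supported[OF supported_part])
      then show ?thesis using True by (simp add: part_diff flip: s)
    next
      case False
      then have "j < i" using that by simp
      then have "gpart xdeg j f1 = 0" using f' by (simp add: f1_def xpower_below)
      moreover have "gpart xdeg j (gpart xdeg i f1) = 0"
        by (rule part_supported_none[OF supported_part]) (use \<open>j < i\<close> in auto)
      ultimately show ?thesis by (simp add: part_diff flip: s)
    qed
    then have "f1 - l * s \<in> xpower (Suc i)" unfolding xpower_below by blast
    then have "f - l * (f' + s) \<in> xpower (Suc i)" by (simp add: f1_def algebra_simps)
    then show ?case by blast
  qed
  \<comment> \<open>The argument in \<open>N\<close>: by surjectivity, replace \<open>h\<close> by a multiple of \<open>g\<close> and cancel \<open>g\<close>.\<close>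
  have stepB: "\<exists>k. q - l * k \<in> J a" if q: "q \<in> xpower a" and qh: "(g + F) * q - l * h \<in> J a" for q h
  proof -
    have "((g + F) * q - l * h) - q * F \<in> I"
      by (rule type_ideal_diff[OF id IntD1[OF qh] type_ideal_mult[OF id F_in]])
    then have gq: "g * q - l * h \<in> I" by (simp add: algebra_simps)
    have ex: "\<exists>k. homog xdeg i k \<and> gpart xdeg i q - l * k \<in> I" if ai: "a \<le> i" for i
    proof -
      have "gpart xdeg (e + i) (g * q - l * h) \<in> I"
        by (rule homogeneous_ideal_part[OF hom_ideal gq, of "\<lambda>x y. x = e + i"])
      then have 1: "g * gpart xdeg i q - l * gpart xdeg (e + i) h \<in> I"
        using gpart_mult_homog[OF additive_xdeg xdeg_homog(4), of i q]
          gpart_mult_homog[OF additive_xdeg xdeg_homog(2), of "e + i" h] by (simp add: part_diff)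
      obtain k where k: "homog xdeg i k" "gpart xdeg (e + i) h - g * k \<in> I"
        using g_surjective[OF supported_part, of "e + i" h] ai a by auto
      have "(g * gpart xdeg i q - l * gpart xdeg (e + i) h) + l * (gpart xdeg (e + i) h - g * k) \<in> I"
        by (rule type_ideal_add[OF id 1 type_ideal_mult[OF id k(2)]])
      also have "(g * gpart xdeg i q - l * gpart xdeg (e + i) h) + l * (gpart xdeg (e + i) h - g * k) =
          g * (gpart xdeg i q - l * k)" by (simp add: algebra_simps)
      finally show ?thesis using g_cancel k(1) by blast
    qed
    then obtain k where k: "\<And>i. a \<le> i \<Longrightarrow> homog xdeg i (k i) \<and> gpart xdeg i q - l * k i \<in> I" by metis
    obtain n where n: "below xdeg n q" using below_exists by blast
    have "q = (\<Sum>i<n. gpart xdeg i q)" by (rule below_decompose[OF n])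
    also have "\<dots> = (\<Sum>i\<in>{a..<n}. gpart xdeg i q)"
      by (rule sum.mono_neutral_right) (use q in \<open>auto simp: xpower_below\<close>)
    finally have "q - l * (\<Sum>i\<in>{a..<n}. k i) = (\<Sum>i\<in>{a..<n}. gpart xdeg i q - l * k i)"
      by (simp add: sum_subtractf sum_distrib_left)
    also have "\<dots> \<in> I" by (rule type_ideal_sum[OF id]) (use k in auto)
    finally have "q - l * (\<Sum>i\<in>{a..<n}. k i) \<in> I" .
    moreover have "(\<Sum>i\<in>{a..<n}. k i) \<in> xpower a"
      by (rule type_ideal_sum[OF xpower_ideal]) (use k in \<open>force simp: xpower_def supported_def\<close>)
    then have "q - l * (\<Sum>i\<in>{a..<n}. k i) \<in> xpower a"
      by (intro type_ideal_diff[OF xpower_ideal q] type_ideal_mult[OF xpower_ideal])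
    ultimately show ?thesis by blast
  qed
  have "\<exists>k. f - l * k \<in> J a" if fh: "(g + F) * f - l * h \<in> J a" for f h
  proof -
    obtain f' where f': "f - l * f' \<in> xpower a" using stepA[of f h a] fh by blast
    have "(g + F) * (f - l * f') - l * (h - (g + F) * f') \<in> J a" using fh by (simp add: algebra_simps)
    then obtain k where "(f - l * f') - l * k \<in> J a" using stepB[OF f'] by blast
    then have "f - l * (f' + k) \<in> J a" by (simp add: algebra_simps)
    then show ?thesis by blast
  qed
  then show ?thesis unfolding regular_pair_def using nzd by blast
qed

text \<open>With these coefficients, \<open>g\<close> and \<open>F\<close> have the same weight.\<close>

definition weight where "weight \<epsilon> = (b + d) * xdeg \<epsilon> + e * ydeg \<epsilon>"

lemma additive_weight: "additive_weight weight"
  unfolding weight_def by (rule additive_weighted[OF additive_xdeg additive_ydeg])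

lemma weight_homog: "homog weight (e * d) l" "homog weight (e * (b + d)) (g + F)"
proof -
  show "homog weight (e * d) l" using bideg(2) by (rule supported_mono) (simp add: weight_def)
  show "homog weight (e * (b + d)) (g + F)"
    using bideg(4,1) by (intro supported_add; elim supported_mono) (simp_all add: weight_def)
qed

lemma weight_part: "f \<in> I \<Longrightarrow> gpart weight n f \<in> I" "f \<in> xpower a \<Longrightarrow> gpart weight n f \<in> xpower a"
  using homogeneous_ideal_part[OF hom_ideal, of f "\<lambda>x y. (b + d) * x + e * y = n"]
  by (auto simp: weight_def xpower_def intro: supported_partI)

text \<open>A prime containing \<open>I \<inter> (x)\<^sup>a\<close> contains \<open>I\<close> or \<open>(x)\<close>. Together with \<open>l\<close> and \<open>g + F\<close>, either of
  these ideals generates an ideal that contains \<open>F\<close>, because \<open>F \<in> I\<close> or \<open>g \<in> (x)\<close>, and hence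
  powers of all four variables.\<close>

lemma quotient_height_le_2:
  assumes P: "primeideal P0 cox_ring" "primeideal P1 cox_ring" "primeideal P2 cox_ring" "primeideal P3 cox_ring"
    and chain: "J a \<subseteq> P0" "P0 \<subset> P1" "P1 \<subset> P2" "P2 \<subset> P3" and a: "a > 0"
  shows False
proof -
  have pr: "\<And>x y. x * y \<in> P0 \<Longrightarrow> x \<in> P0 \<or> y \<in> P0" and id0: "ideal P0 cox_ring"
    using P(1) by (auto simp: type_primeideal_iff)
  have "I \<subseteq> P0 \<or> xpower a \<subseteq> P0"
  proof (rule ccontr)
    assume "\<not> ?thesis"
    then obtain x y where xy: "x \<in> I" "x \<notin> P0" "y \<in> xpower a" "y \<notin> P0" by blast
    then have "x * y \<in> J a" using type_ideal_mult_right[OF id] type_ideal_mult[OF xpower_ideal] by blast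
    then show False using pr chain(1) xy by blast
  qed
  moreover have "xpower 1 \<subseteq> P0" if xa: "xpower a \<subseteq> P0"
  proof -
    have "cox_gen v ^ 1 \<in> P0" if "v = X10 \<or> v = X11" for v
    proof -
      have "cox_gen v ^ a \<in> xpower a"
        using that by (auto simp: xpower_def cox_gen_power supported_def xdeg_def lookup_single)
      then show ?thesis using type_prime_power[OF P(1)] xa by auto
    qed
    then have "f \<in> P0" if "supported (\<lambda>\<epsilon>. 1 \<le> xdeg \<epsilon>) f" for f
    proof -
      have "Poly_Mapping.single \<epsilon> c \<in> P0" if \<epsilon>: "1 \<le> xdeg \<epsilon>" for \<epsilon> c
      proof -
        consider "1 \<le> Poly_Mapping.lookup \<epsilon> X10" | "1 \<le> Poly_Mapping.lookup \<epsilon> X11"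
          using \<epsilon> unfolding xdeg_def by linarith
        then show ?thesis
          by cases (metis \<open>\<And>v. v = X10 \<or> v = X11 \<Longrightarrow> cox_gen v ^ 1 \<in> P0\<close> monomial_var_power type_ideal_mult_right[OF id0])+
      qed
      then have "(\<Sum>e\<in>Poly_Mapping.keys f. Poly_Mapping.single e (Poly_Mapping.lookup f e)) \<in> P0"
        using that by (intro type_ideal_sum[OF id0]) (auto simp: supported_def)
      then show ?thesis by (simp only: sum_monomials)
    qed
    then show ?thesis by (auto simp: xpower_def)
  qed
  ultimately obtain \<bb> where bb: "\<bb> = I \<or> \<bb> = xpower 1" and sub: "\<bb> \<subseteq> P0" by blast
  have b: "ideal \<bb> cox_ring" using bb id xpower_ideal by blast
  define K where "K = {j + s * (g + F) |j s. j \<in> {j + r * l |j r. j \<in> \<bb>}}"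
  have K: "ideal K type_ring" unfolding K_def by (intro type_ideal_plus_principal b)
  have bK: "x \<in> K" if "x \<in> \<bb>" for x
  proof -
    have "x = (x + 0 * l) + 0 * (g + F)" by simp
    then show ?thesis unfolding K_def using that by blast
  qed
  have lK: "l \<in> K"
  proof -
    have "l = (0 + 1 * l) + 0 * (g + F)" by simp
    then show ?thesis unfolding K_def using type_ideal_zero[OF b] by blast
  qed
  have \<eta>K: "g + F \<in> K"
  proof -
    have "g + F = (0 + 0 * l) + 1 * (g + F)" by simp
    then show ?thesis unfolding K_def using type_ideal_zero[OF b] by blast
  qed
  have "F \<in> K \<and> cox_gen X10 ^ (c + e) \<in> K \<and> cox_gen X11 ^ (e * (c + e)) \<in> K"
    using bb
  proof
    assume "\<bb> = I"
    then have "F \<in> K" "G \<in> K" using bK F_in G_in by auto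
    moreover have "g \<in> K" using type_ideal_diff[OF K \<eta>K \<open>F \<in> K\<close>] by simp
    ultimately show ?thesis using x_cancel[OF K, of 1] by simp
  next
    assume "\<bb> = xpower 1"
    moreover have "g \<in> xpower 1" using xdeg_homog(4) G'(2) by (auto simp: xpower_def supported_def)
    ultimately have "g \<in> K" by (auto intro: bK)
    then have "F \<in> K" using type_ideal_diff[OF K \<eta>K] by force
    moreover have "cox_gen X10 ^ (c + e) \<in> xpower 1" "cox_gen X11 ^ (e * (c + e)) \<in> xpower 1"
      using G'(2) by (auto simp: xpower_def cox_gen_power supported_def xdeg_def lookup_single)
    ultimately show ?thesis using bK \<open>\<bb> = xpower 1\<close> by auto
  qed
  then have x: "cox_gen X10 ^ (c + e) \<in> K" "cox_gen X11 ^ (e * (c + e)) \<in> K"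
    and y: "cox_gen X20 ^ (b + d) \<in> K" "cox_gen X21 ^ (d * (b + d)) \<in> K"
    using y_cancel[OF K, of 1] lK by simp_all
  have pow: "v ^ n \<in> K" if "v ^ m \<in> K" "m \<le> n" for v m n
    using type_ideal_mult[OF K that(1), of "v ^ (n - m)"] that(2) by (simp flip: power_add)
  define N where "N = (c + e) + e * (c + e) + (b + d) + d * (b + d)"
  have "cox_gen v ^ N \<in> K" for v
    by (cases v) (auto intro: pow[OF x(1)] pow[OF x(2)] pow[OF y(1)] pow[OF y(2)] simp: N_def)
  then have fin: "\<exists>j r s. cox_gen v ^ N = j + r * l + s * (g + F) \<and> j \<in> \<bb>" for v
    unfolding K_def by blast
  have hom: "gpart weight n f \<in> \<bb>" if "f \<in> \<bb>" for f n
    using bb that weight_part by blast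
  have pos: "b + d > 0" "e > 0" "e * d > 0" "e * (b + d) > 0" using F'(2) G'(2) by auto
  show False
    by (rule no_prime_chain_of_length_three[OF b hom _ pos(1,2) weight_homog(1) pos(3) weight_homog(2) pos(4) fin P sub chain(2-4)])
       (auto simp: weight_def fun_eq_iff)
qed

text \<open>A maximal ideal contains \<open>p(l)\<close> and \<open>q(g + F)\<close> for suitable monic \<open>p\<close> and \<open>q\<close>, so its depth is
  at least \<open>2\<close>, which is also the upper bound for its height.\<close>

theorem quotient_cohen_macaulay:
  assumes a: "N\<^sub>0 \<le> a" "a > 0"
  shows "cohen_macaulay (cox_ring Quot J a)"
proof -
  let ?R = "cox_ring Quot J a"
  interpret ring_surjection "\<lambda>f. J a +>\<^bsub>cox_ring\<^esub> f" ?R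
    by (rule type_quotient_surjection(1)[OF J_ideal])
  have ker: "kernel = J a" by (rule type_quotient_surjection(2)[OF J_ideal])
  have noeth: "noetherian_ring ?R"
    by (rule noetherian_surj[OF noetherian_cox S.ring_axioms hom]) (simp add: surj)
  have "depth ?R P = height ?R P" if P: "maximalideal P ?R" for P
  proof (rule antisym)
    have prime: "primeideal P ?R" by (rule S.maximalideal_prime[OF P])
    show "depth ?R P \<le> height ?R P" by (rule S.depth_le_height[OF prime])
    have "height ?R P \<le> enat 2"
      unfolding height_def
    proof (rule Sup_least, clarify)
      fix Ps assume Ps: "prime_chain ?R Ps"
      show "enat (length Ps - 1) \<le> enat 2"
      proof (rule ccontr)
        assume "\<not> ?thesis"
        then have "length Ps \<ge> 4" by simp
        then have len: "0 < length Ps" "1 < length Ps" "2 < length Ps" "3 < length Ps" by linarith+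
        note ch = vimage_prime_chain[OF Ps]
        show False
          by (rule quotient_height_le_2[OF ch(1)[OF len(1)] ch(1)[OF len(2)] ch(1)[OF len(3)] ch(1)[OF len(4)], of a])
             (use len ch(2)[of 0] ch(3)[of 0] ch(3)[of 1] ch(3)[of 2] a(2) in
               \<open>auto simp: ker numeral_2_eq_2 numeral_3_eq_3\<close>)
      qed
    qed
    also have "enat 2 \<le> depth ?R P"
    proof -
      have max: "maximalideal ((\<lambda>f. J a +>\<^bsub>cox_ring\<^esub> f) -` P) cox_ring" by (rule vimage_maximal[OF P])
      obtain p where p: "lead_coeff p = 1" "J a +>\<^bsub>cox_ring\<^esub> eval_poly const l p \<in> P"
        by (rule weak_nullstellensatz[OF max, of l]) auto
      obtain q where q: "lead_coeff q = 1" "J a +>\<^bsub>cox_ring\<^esub> eval_poly const (g + F) q \<in> P"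
        by (rule weak_nullstellensatz[OF max, of "g + F"]) auto
      have pos: "e * d > 0" "e * (b + d) > 0" using F'(2) G'(2) by auto
      have "regular_pair (J a) (eval_poly const l p) (eval_poly const (g + F) q)"
        by (rule regular_pair_eval_poly[OF J_ideal _ additive_weight weight_homog(1) pos(1) weight_homog(2) pos(2)
            parameters_regular[OF a(1)] p(1) q(1)])
           (use weight_part in auto)
      moreover have "ideal P ?R" "P \<noteq> carrier ?R"
        using prime by (auto simp: primeideal.axioms dest: primeideal.I_notcarr)
      ultimately have "regular_sequence ?R [J a +>\<^bsub>cox_ring\<^esub> eval_poly const l p, J a +>\<^bsub>cox_ring\<^esub> eval_poly const (g + F) q]"
        using regular_pair_imp_regular_sequence p(2) q(2) unfolding ker by blast
      then show ?thesis unfolding depth_def using p(2) q(2)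
        by (intro Sup_upper CollectI exI[of _ "[J a +>\<^bsub>cox_ring\<^esub> eval_poly const l p, J a +>\<^bsub>cox_ring\<^esub> eval_poly const (g + F) q]"])
           (simp add: numeral_2_eq_2)
    qed
    finally show "height ?R P \<le> depth ?R P" .
  qed
  then show ?thesis unfolding cohen_macaulay_def using noeth cring by blast
qed

end


section \<open>Coefficients with respect to the first pair of variables\<close>

text \<open>The monomials \<open>xmon i s\<close> with \<open>s \<le> i\<close> are a basis of the forms of \<open>x\<close>-degree \<open>i\<close> over the ring
  \<open>k[y\<^sub>0, y\<^sub>1]\<close> of elements of \<open>x\<close>-degree \<open>0\<close>.\<close>

definition xmon :: "nat \<Rightarrow> nat \<Rightarrow> 'k::field cox" where
  "xmon i s = cox_gen X10 ^ (i - s) * cox_gen X11 ^ s"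

lemma cox_gen_nonzero [simp]: "cox_gen v \<noteq> (0 :: 'k::field cox)"
  by (simp add: cox_gen_def) (metis lookup_single_eq lookup_zero zero_neq_one)

lemma xmon_nonzero [simp]: "xmon i s \<noteq> (0 :: 'k::field cox)"
  by (simp add: xmon_def)

lemma xmon_supported:
  "s \<le> i \<Longrightarrow> supported (\<lambda>\<epsilon>. xdeg \<epsilon> = i \<and> ydeg \<epsilon> = 0 \<and> Poly_Mapping.lookup \<epsilon> X11 = s) (xmon i s :: 'k::field cox)"
  by (simp add: xmon_def cox_gen_power mult_single supported_def xdeg_def ydeg_def lookup_add lookup_single)

lemma xmon_homog: "s \<le> i \<Longrightarrow> homog xdeg i (xmon i s)"
  using xmon_supported by (rule supported_mono) auto

lemma x0_xmon: "s \<le> i \<Longrightarrow> cox_gen X10 * xmon i s = xmon (Suc i) s"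
  by (simp add: xmon_def Suc_diff_le mult_ac)

lemma x1_xmon: "cox_gen X11 * xmon i s = xmon (Suc i) (Suc s)"
  by (simp add: xmon_def mult_ac)

lemma xmon_x1_part:
  assumes "homog xdeg 0 a" "s \<le> i"
  shows "supported (\<lambda>\<epsilon>. Poly_Mapping.lookup \<epsilon> X11 = s) (a * xmon i s :: 'k::field cox)"
  by (rule supported_mult[OF assms(1) xmon_supported[OF assms(2)]]) (simp add: lookup_add xdeg_def)

lemma x_coefficients_unique:
  fixes a :: "nat \<Rightarrow> 'k::field cox"
  assumes a: "\<And>s. s \<le> i \<Longrightarrow> homog xdeg 0 (a s)" and b: "\<And>s. s \<le> i \<Longrightarrow> homog xdeg 0 (b s)"
    and eq: "(\<Sum>s\<le>i. a s * xmon i s) = (\<Sum>s\<le>i. b s * xmon i s)" and s: "s \<le> i"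
  shows "a s = b s"
proof -
  have "part (\<lambda>\<epsilon>. Poly_Mapping.lookup \<epsilon> X11 = s) (\<Sum>t\<le>i. c t * xmon i t) = c s * xmon i s"
    if c: "\<And>s. s \<le> i \<Longrightarrow> homog xdeg 0 (c s)" for c :: "nat \<Rightarrow> 'k cox"
  proof -
    have "part (\<lambda>\<epsilon>. Poly_Mapping.lookup \<epsilon> X11 = s) (\<Sum>t\<le>i. c t * xmon i t) =
        (\<Sum>t\<le>i. if t = s then c t * xmon i t else 0)"
      unfolding part_sum
    proof (rule sum.cong)
      fix t assume "t \<in> {..i}"
      then have supp: "supported (\<lambda>\<epsilon>. Poly_Mapping.lookup \<epsilon> X11 = t) (c t * xmon i t)"
        using xmon_x1_part c by auto
      show "part (\<lambda>\<epsilon>. Poly_Mapping.lookup \<epsilon> X11 = s) (c t * xmon i t) = (if t = s then c t * xmon i t else 0)"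
      proof (cases "t = s")
        case True then show ?thesis using part_supported[OF supp] by simp
      next
        case False then show ?thesis using part_supported_none[OF supp] by simp
      qed
    qed simp
    then show ?thesis using s by simp
  qed
  from this[of a, OF a] this[of b, OF b] have "a s * xmon i s = b s * xmon i s" using eq by simp
  then show ?thesis by simp
qed

lemma x_coefficients_exist:
  fixes f :: "'k::field cox"
  assumes f: "homog xdeg i f"
  obtains a where "\<And>s. homog xdeg 0 (a s)" "f = (\<Sum>s\<le>i. a s * xmon i s)"
proof -
  have "\<exists>a. homog xdeg 0 a \<and> part (\<lambda>\<epsilon>. Poly_Mapping.lookup \<epsilon> X11 = s) f = a * xmon i s" if s: "s \<le> i" for s
  proof -
    let ?f = "part (\<lambda>\<epsilon>. Poly_Mapping.lookup \<epsilon> X11 = s) f"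
    have supp: "supported (\<lambda>\<epsilon>. xdeg \<epsilon> = i \<and> Poly_Mapping.lookup \<epsilon> X11 = s) ?f"
      using f by (auto simp: supported_def keys_part)
    then have "supported (\<lambda>\<epsilon>. i - s \<le> Poly_Mapping.lookup \<epsilon> X10) ?f" "supported (\<lambda>\<epsilon>. s \<le> Poly_Mapping.lookup \<epsilon> X11) ?f"
      by (auto simp: xdeg_def elim!: supported_mono)
    then obtain r t where r: "?f = cox_gen X10 ^ (i - s) * r" and t: "?f = cox_gen X11 ^ s * t"
      unfolding var_power_factor by blast
    have "cox_gen X10 ^ (i - s) * r = cox_gen X11 ^ s * t" using r t by simp
    from var_power_cancel[OF _ this] obtain q where "r = cox_gen X11 ^ s * q" by auto
    then have q: "?f = xmon i s * q" using r by (simp add: xmon_def mult_ac)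
    have "?f = gpart xdeg (i + 0) ?f"
      by (rule part_supported[symmetric]) (use supp in \<open>auto elim: supported_mono\<close>)
    also have "\<dots> = xmon i s * gpart xdeg 0 q"
      unfolding q by (rule gpart_mult_homog[OF additive_xdeg xmon_homog[OF s]])
    finally have "?f = gpart xdeg 0 q * xmon i s" by (simp add: mult.commute)
    then show ?thesis using supported_part by blast
  qed
  then obtain a where a: "\<And>s. s \<le> i \<Longrightarrow> homog xdeg 0 (a s) \<and> part (\<lambda>\<epsilon>. Poly_Mapping.lookup \<epsilon> X11 = s) f = a s * xmon i s"
    by metis
  have "f = part (\<lambda>\<epsilon>. Poly_Mapping.lookup \<epsilon> X11 \<in> {..i}) f"
    by (rule part_supported[symmetric]) (use f in \<open>auto simp: xdeg_def elim: supported_mono\<close>)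
  also have "\<dots> = (\<Sum>s\<le>i. part (\<lambda>\<epsilon>. Poly_Mapping.lookup \<epsilon> X11 = s) f)" by (rule part_disjoint_sum) simp
  also have "\<dots> = (\<Sum>s\<le>i. (if s \<le> i then a s else 0) * xmon i s)" using a by (intro sum.cong) auto
  finally show ?thesis using a by (intro that[of "\<lambda>s. if s \<le> i then a s else 0"]) auto
qed

definition xcoeff :: "nat \<Rightarrow> 'k::field cox \<Rightarrow> nat \<Rightarrow> 'k cox" where
  "xcoeff i f = (SOME a. (\<forall>s. homog xdeg 0 (a s)) \<and> f = (\<Sum>s\<le>i. a s * xmon i s))"

lemma xcoeff:
  assumes "homog xdeg i f"
  shows "homog xdeg 0 (xcoeff i f s)" "f = (\<Sum>s\<le>i. xcoeff i f s * xmon i s)"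
proof -
  have "\<exists>a. (\<forall>s. homog xdeg 0 (a s)) \<and> f = (\<Sum>s\<le>i. a s * xmon i s)"
    by (rule x_coefficients_exist[OF assms]) blast
  then have "(\<forall>s. homog xdeg 0 (xcoeff i f s)) \<and> f = (\<Sum>s\<le>i. xcoeff i f s * xmon i s)"
    unfolding xcoeff_def by (rule someI_ex)
  then show "homog xdeg 0 (xcoeff i f s)" "f = (\<Sum>s\<le>i. xcoeff i f s * xmon i s)" by auto
qed

lemma xcoeff_eqI:
  assumes a: "\<And>s. s \<le> i \<Longrightarrow> homog xdeg 0 (a s)" and f: "f = (\<Sum>s\<le>i. a s * xmon i s)" and s: "s \<le> i"
  shows "xcoeff i f s = a s"
proof -
  have "homog xdeg (0 + i) f"
    unfolding f by (intro supported_sum homog_mult[OF additive_xdeg] a xmon_homog) auto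
  then have h: "homog xdeg i f" by simp
  show ?thesis by (rule x_coefficients_unique[OF xcoeff(1)[OF h] a _ s]) (use xcoeff(2)[OF h] f in auto)
qed

lemma xcoeff_sum:
  fixes r w :: "'b \<Rightarrow> 'k::field cox"
  assumes r: "\<And>k. k \<in> A \<Longrightarrow> homog xdeg 0 (r k)" and w: "\<And>k. k \<in> A \<Longrightarrow> homog xdeg i (w k)" and s: "s \<le> i"
  shows "xcoeff i (\<Sum>k\<in>A. r k * w k) s = (\<Sum>k\<in>A. r k * xcoeff i (w k) s)"
proof (rule xcoeff_eqI[OF _ _ s])
  show "homog xdeg 0 (\<Sum>k\<in>A. r k * xcoeff i (w k) s)" for s
    using homog_mult[OF additive_xdeg r xcoeff(1)[OF w]] by (intro supported_sum) auto
  have "(\<Sum>k\<in>A. r k * w k) = (\<Sum>k\<in>A. \<Sum>s\<le>i. r k * xcoeff i (w k) s * xmon i s)"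
    by (rule sum.cong[OF refl], subst xcoeff(2)[OF w]) (auto simp: sum_distrib_left mult.assoc)
  also have "\<dots> = (\<Sum>s\<le>i. (\<Sum>k\<in>A. r k * xcoeff i (w k) s) * xmon i s)"
    by (subst sum.swap) (simp add: sum_distrib_right)
  finally show "(\<Sum>k\<in>A. r k * w k) = (\<Sum>s\<le>i. (\<Sum>k\<in>A. r k * xcoeff i (w k) s) * xmon i s)" .
qed

lemma xcoeff_x0:
  assumes w: "homog xdeg i w" and s: "s \<le> Suc i"
  shows "xcoeff (Suc i) (cox_gen X10 * w) s = (if s \<le> i then xcoeff i w s else 0)"
proof (rule xcoeff_eqI[OF _ _ s])
  have "cox_gen X10 * w = (\<Sum>s\<le>i. xcoeff i w s * xmon (Suc i) s)"
    by (subst xcoeff(2)[OF w]) (auto simp: sum_distrib_left mult.left_commute x0_xmon intro!: sum.cong)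
  then show "cox_gen X10 * w = (\<Sum>s\<le>Suc i. (if s \<le> i then xcoeff i w s else 0) * xmon (Suc i) s)" by simp
qed (use xcoeff(1)[OF w] in auto)

lemma xcoeff_x1:
  assumes w: "homog xdeg i w" and s: "s \<le> Suc i"
  shows "xcoeff (Suc i) (cox_gen X11 * w) s = (if s = 0 then 0 else xcoeff i w (s - 1))"
proof (rule xcoeff_eqI[OF _ _ s])
  have "cox_gen X11 * w = (\<Sum>s\<le>i. xcoeff i w s * xmon (Suc i) (Suc s))"
    by (subst xcoeff(2)[OF w]) (auto simp: sum_distrib_left mult.left_commute x1_xmon intro!: sum.cong)
  then show "cox_gen X11 * w = (\<Sum>s\<le>Suc i. (if s = 0 then 0 else xcoeff i w (s - 1)) * xmon (Suc i) s)"
    by (subst sum.atMost_Suc_shift) simp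
qed (use xcoeff(1)[OF w] in auto)

lemma xcoeff_times_xmon:
  assumes "homog xdeg 0 a" "t \<le> i" "s \<le> i"
  shows "xcoeff i (a * xmon i t) s = (if s = t then a else 0)"
  by (rule xcoeff_eqI[OF _ _ assms(3)]) (use assms in \<open>auto simp: if_distrib[of "\<lambda>z. z * _"] cong: if_cong\<close>)

lemma y_form_split:
  fixes a :: "'k::field cox"
  assumes a: "supported (\<lambda>\<epsilon>. xdeg \<epsilon> = 0 \<and> ydeg \<epsilon> = m) a"
  obtains \<kappa> a' where "a = const \<kappa> * cox_gen X21 ^ m + cox_gen X20 * a'"
    "supported (\<lambda>\<epsilon>. xdeg \<epsilon> = 0 \<and> Suc (ydeg \<epsilon>) = m) a'"
proof -
  define \<kappa> where "\<kappa> = Poly_Mapping.lookup a (Poly_Mapping.single X21 m)"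
  define r where "r = a - const \<kappa> * cox_gen X21 ^ m"
  have mono: "const \<kappa> * cox_gen X21 ^ m = Poly_Mapping.single (Poly_Mapping.single X21 m) \<kappa>"
    by (simp add: const_def cox_gen_power mult_single)
  have r: "supported (\<lambda>\<epsilon>. xdeg \<epsilon> = 0 \<and> ydeg \<epsilon> = m) r"
    unfolding r_def mono by (intro supported_diff a supported_single) (simp add: xdeg_def ydeg_def lookup_single)
  have "supported (\<lambda>\<epsilon>. 1 \<le> Poly_Mapping.lookup \<epsilon> X20) r"
    unfolding supported_def
  proof (rule ballI, rule ccontr)
    fix \<epsilon> assume \<epsilon>: "\<epsilon> \<in> Poly_Mapping.keys r" "\<not> 1 \<le> Poly_Mapping.lookup \<epsilon> X20"
    then have "xdeg \<epsilon> = 0" "ydeg \<epsilon> = m" using r by (auto simp: supported_def)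
    then have "Poly_Mapping.lookup \<epsilon> v = Poly_Mapping.lookup (Poly_Mapping.single X21 m) v" for v
      using \<epsilon>(2) by (cases v) (auto simp: xdeg_def ydeg_def lookup_single)
    then have "\<epsilon> = Poly_Mapping.single X21 m" by (rule poly_mapping_eqI)
    then have "Poly_Mapping.lookup r \<epsilon> = 0" unfolding r_def mono by (simp add: \<kappa>_def lookup_minus)
    then show False using \<epsilon>(1) by (simp add: in_keys_iff)
  qed
  then obtain a' where a': "r = cox_gen X20 ^ 1 * a'" unfolding var_power_factor by blast
  have "supported (\<lambda>\<epsilon>. xdeg \<epsilon> = 0 \<and> Suc (ydeg \<epsilon>) = m) a'"
    unfolding supported_def
  proof
    fix \<epsilon> assume "\<epsilon> \<in> Poly_Mapping.keys a'"
    then have "Poly_Mapping.single X20 1 + \<epsilon> \<in> Poly_Mapping.keys r"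
      unfolding a' cox_gen_power by (simp add: in_keys_iff lookup_single_mult)
    then have "xdeg (Poly_Mapping.single X20 1 + \<epsilon>) = 0" "ydeg (Poly_Mapping.single X20 1 + \<epsilon>) = m"
      using r by (auto simp: supported_def)
    then show "xdeg \<epsilon> = 0 \<and> Suc (ydeg \<epsilon>) = m" by (simp add: xdeg_def ydeg_def lookup_add lookup_single)
  qed
  moreover have "a = const \<kappa> * cox_gen X21 ^ m + cox_gen X20 * a'" using a' by (simp add: r_def algebra_simps)
  ultimately show ?thesis using that by blast
qed


section \<open>The graded pieces are free\<close>

lemma finite_span_ideal:
  fixes H :: "'a::comm_ring_1 set"
  assumes "finite H"
  shows "ideal {x. \<exists>r. x = (\<Sum>h\<in>H. r h * h)} type_ring" "H \<subseteq> {x. \<exists>r. x = (\<Sum>h\<in>H. r h * h)}"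
proof -
  show "ideal {x. \<exists>r. x = (\<Sum>h\<in>H. r h * h)} type_ring"
  proof (rule type_idealI)
    show "0 \<in> {x. \<exists>r. x = (\<Sum>h\<in>H. r h * h)}" by (auto intro!: exI[of _ "\<lambda>_. 0"])
    show "x + y \<in> {x. \<exists>r. x = (\<Sum>h\<in>H. r h * h)}"
      if "x \<in> {x. \<exists>r. x = (\<Sum>h\<in>H. r h * h)}" "y \<in> {x. \<exists>r. x = (\<Sum>h\<in>H. r h * h)}" for x y
    proof -
      obtain r s where "x = (\<Sum>h\<in>H. r h * h)" "y = (\<Sum>h\<in>H. s h * h)" using \<open>x \<in> _\<close> \<open>y \<in> _\<close> by blast
      then have "x + y = (\<Sum>h\<in>H. (r h + s h) * h)" by (simp add: distrib_right sum.distrib)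
      then show ?thesis by (intro CollectI exI[of _ "\<lambda>h. r h + s h"])
    qed
    show "c * x \<in> {x. \<exists>r. x = (\<Sum>h\<in>H. r h * h)}" if "x \<in> {x. \<exists>r. x = (\<Sum>h\<in>H. r h * h)}" for x c
    proof -
      obtain r where "x = (\<Sum>h\<in>H. r h * h)" using \<open>x \<in> _\<close> by blast
      then have "c * x = (\<Sum>h\<in>H. (c * r h) * h)" by (simp add: sum_distrib_left mult.assoc)
      then show ?thesis by (intro CollectI exI[of _ "\<lambda>h. c * r h"])
    qed
  qed
  have "h = (\<Sum>h'\<in>H. (if h' = h then 1 else 0) * h')" if "h \<in> H" for h
    using that assms by (subst sum.cong[OF refl, of _ _ "\<lambda>h'. if h' = h then h' else 0"]) auto
  then show "H \<subseteq> {x. \<exists>r. x = (\<Sum>h\<in>H. r h * h)}"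
    by (intro subsetI CollectI exI[of _ "\<lambda>h'. if h' = h then 1 else 0" for h])
qed

context saturated_points
begin

lemma homogeneous_generators:
  obtains H where "finite H" "H \<subseteq> I" "\<And>h. h \<in> H \<Longrightarrow> \<exists>j \<delta>. supported (\<lambda>\<epsilon>. xdeg \<epsilon> = j \<and> ydeg \<epsilon> = \<delta>) h"
    "\<And>f. f \<in> I \<Longrightarrow> \<exists>r. f = (\<Sum>h\<in>H. r h * h)"
proof -
  interpret noetherian_ring "cox_ring :: 'k cox ring" by (rule noetherian_cox)
  obtain A where A: "finite A" "I = Idl\<^bsub>cox_ring\<^esub> A" using finetely_gen[OF id] by blast
  define H where "H = (\<Union>f\<in>A. (\<lambda>(j, \<delta>). part (\<lambda>\<epsilon>. (xdeg \<epsilon>, ydeg \<epsilon>) = (j, \<delta>)) f) ` (\<lambda>\<epsilon>. (xdeg \<epsilon>, ydeg \<epsilon>)) ` Poly_Mapping.keys f)"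
  have AI: "A \<subseteq> I" using A(2) genideal_type_self by blast
  have fin: "finite H" using A(1) by (simp add: H_def)
  have HI: "H \<subseteq> I"
  proof
    fix h assume "h \<in> H"
    then obtain f j \<delta> where "f \<in> A" "h = part (\<lambda>\<epsilon>. xdeg \<epsilon> = j \<and> ydeg \<epsilon> = \<delta>) f" by (auto simp: H_def)
    then show "h \<in> I" using homogeneous_ideal_part[OF hom_ideal, of f "\<lambda>x y. x = j \<and> y = \<delta>"] AI by auto
  qed
  have "A \<subseteq> {x. \<exists>r. x = (\<Sum>h\<in>H. r h * h)}"
  proof
    fix f assume f: "f \<in> A"
    let ?D = "(\<lambda>\<epsilon>. (xdeg \<epsilon>, ydeg \<epsilon>)) ` Poly_Mapping.keys f"
    have "f = part (\<lambda>\<epsilon>. (xdeg \<epsilon>, ydeg \<epsilon>) \<in> ?D) f" by (rule part_id[symmetric]) auto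
    also have "\<dots> = (\<Sum>p\<in>?D. part (\<lambda>\<epsilon>. (xdeg \<epsilon>, ydeg \<epsilon>) = p) f)" by (rule part_disjoint_sum) simp
    also have "\<dots> \<in> {x. \<exists>r. x = (\<Sum>h\<in>H. r h * h)}"
      by (rule type_ideal_sum[OF finite_span_ideal(1)[OF fin]])
         (use f finite_span_ideal(2)[OF fin] in \<open>force simp: H_def\<close>)
    finally show "f \<in> {x. \<exists>r. x = (\<Sum>h\<in>H. r h * h)}" .
  qed
  then have "I \<subseteq> {x. \<exists>r. x = (\<Sum>h\<in>H. r h * h)}"
    unfolding A(2) by (rule genideal_mono_type[OF finite_span_ideal(1)[OF fin]])
  moreover have "\<exists>j \<delta>. supported (\<lambda>\<epsilon>. xdeg \<epsilon> = j \<and> ydeg \<epsilon> = \<delta>) h" if h: "h \<in> H" for h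
  proof -
    obtain f j \<delta> where "h = part (\<lambda>\<epsilon>. xdeg \<epsilon> = j \<and> ydeg \<epsilon> = \<delta>) f" using h by (auto simp: H_def)
    then show ?thesis using supported_part by blast
  qed
  ultimately show ?thesis using that[OF fin HI] by blast
qed

text \<open>Finite sets of bihomogeneous generators of the \<open>k[y\<^sub>0, y\<^sub>1]\<close>-module \<open>I\<^sub>i\<close>.\<close>

definition generates :: "nat \<Rightarrow> 'k cox set \<Rightarrow> bool" where
  "generates i W \<longleftrightarrow> finite W \<and> W \<subseteq> I \<and> (\<forall>w\<in>W. \<exists>\<delta>. supported (\<lambda>\<epsilon>. xdeg \<epsilon> = i \<and> ydeg \<epsilon> = \<delta>) w) \<and>
     (\<forall>f\<in>I. homog xdeg i f \<longrightarrow> (\<exists>a. (\<forall>w. homog xdeg 0 (a w)) \<and> f = (\<Sum>w\<in>W. a w * w)))"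

text \<open>Multiply bihomogeneous generators of \<open>I\<close> by the monomials in \<open>x\<^sub>0, x\<^sub>1\<close> that bring them into
  \<open>x\<close>-degree \<open>i\<close>.\<close>

lemma generates_exists: "\<exists>W. generates i W"
proof -
  obtain H where H: "finite H" "H \<subseteq> I" "\<And>h. h \<in> H \<Longrightarrow> \<exists>j \<delta>. supported (\<lambda>\<epsilon>. xdeg \<epsilon> = j \<and> ydeg \<epsilon> = \<delta>) h"
    and span: "\<And>f. f \<in> I \<Longrightarrow> \<exists>r. f = (\<Sum>h\<in>H. r h * h)" by (rule homogeneous_generators) blast
  obtain j \<delta> where deg: "\<And>h. h \<in> H \<Longrightarrow> supported (\<lambda>\<epsilon>. xdeg \<epsilon> = j h \<and> ydeg \<epsilon> = \<delta> h) h" using H(3) by metis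
  define W where "W = (\<Union>h\<in>{h \<in> H. j h \<le> i}. (\<lambda>s. xmon (i - j h) s * h) ` {..i - j h})"
  have fin: "finite W" using H(1) by (simp add: W_def)
  have WI: "W \<subseteq> I" using H(2) type_ideal_mult[OF id] by (auto simp: W_def)
  have Wdeg: "\<exists>\<delta>. supported (\<lambda>\<epsilon>. xdeg \<epsilon> = i \<and> ydeg \<epsilon> = \<delta>) w" if w: "w \<in> W" for w
  proof -
    obtain h s where h: "h \<in> H" "j h \<le> i" "s \<le> i - j h" "w = xmon (i - j h) s * h" using w by (auto simp: W_def)
    have "supported (\<lambda>\<epsilon>. xdeg \<epsilon> = i \<and> ydeg \<epsilon> = \<delta> h) w"
      unfolding h(4) by (rule supported_mult[OF xmon_supported[OF h(3)] deg[OF h(1)]])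
        (use h(2) in \<open>simp add: additiveD additive_xdeg additive_ydeg\<close>)
    then show ?thesis by blast
  qed
  define V where "V = {f. \<exists>a. (\<forall>w. homog xdeg 0 (a w)) \<and> f = (\<Sum>w\<in>W. a w * w)}"
  have V_add: "f + f' \<in> V" if ff: "f \<in> V" "f' \<in> V" for f f'
  proof -
    obtain a b where "\<forall>w. homog xdeg 0 (a w)" "f = (\<Sum>w\<in>W. a w * w)" "\<forall>w. homog xdeg 0 (b w)" "f' = (\<Sum>w\<in>W. b w * w)"
      using ff unfolding V_def by blast
    then show ?thesis unfolding V_def
      by (intro CollectI exI[of _ "\<lambda>w. a w + b w"]) (auto simp: distrib_right sum.distrib intro: supported_add)
  qed
  have V_0: "0 \<in> V" unfolding V_def by (intro CollectI exI[of _ "\<lambda>w. 0"]) simp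
  have V_sum: "sum q B \<in> V" if "\<And>z. z \<in> B \<Longrightarrow> q z \<in> V" for B and q :: "'b \<Rightarrow> 'k cox"
    using that by (induction B rule: infinite_finite_induct) (auto intro: V_0 V_add)
  have V_base: "a * w \<in> V" if "homog xdeg 0 a" "w \<in> W" for a w
  proof -
    have "a * w = (\<Sum>w'\<in>W. if w' = w then a * w' else 0)" using that fin by simp
    also have "\<dots> = (\<Sum>w'\<in>W. (if w' = w then a else 0) * w')" by (rule sum.cong) auto
    finally show ?thesis unfolding V_def using that
      by (intro CollectI exI[of _ "\<lambda>w'. if w' = w then a else 0"]) auto
  qed
  have "f \<in> V" if f: "f \<in> I" "homog xdeg i f" for f
  proof -
    obtain r where r: "f = (\<Sum>h\<in>H. r h * h)" using span f(1) by blast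
    have "f = gpart xdeg i f" by (rule part_supported[OF f(2), symmetric])
    also have "\<dots> = (\<Sum>h\<in>H. gpart xdeg i (h * r h))" unfolding r part_sum by (simp only: mult.commute)
    also have "\<dots> \<in> V"
    proof (rule V_sum)
      fix h assume h: "h \<in> H"
      have hh: "homog xdeg (j h) h" using deg[OF h] by (rule supported_mono) auto
      show "gpart xdeg i (h * r h) \<in> V"
      proof (cases "j h \<le> i")
        case True
        have "gpart xdeg i (h * r h) = h * gpart xdeg (i - j h) (r h)"
          using gpart_mult_homog[OF additive_xdeg hh, of "i - j h"] True by simp
        also have "\<dots> = (\<Sum>s\<le>i - j h. xcoeff (i - j h) (gpart xdeg (i - j h) (r h)) s * (xmon (i - j h) s * h))"
          by (subst xcoeff(2)[OF supported_part[of "\<lambda>\<epsilon>. xdeg \<epsilon> = i - j h" "r h"]]) (simp add: sum_distrib_left mult_ac)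
        also have "\<dots> \<in> V"
          by (intro V_sum V_base xcoeff(1) supported_part) (use h True in \<open>auto simp: W_def\<close>)
        finally show ?thesis .
      next
        case False
        then show ?thesis using gpart_mult_homog_less[OF additive_xdeg hh] V_0 by simp
      qed
    qed
    finally show ?thesis .
  qed
  then have "generates i W" unfolding generates_def V_def using fin WI Wdeg by blast
  then show ?thesis by blast
qed

text \<open>Split the coefficients of a homogeneous relation as \<open>c y\<^sub>1\<^sup>m + y\<^sub>0 a'\<close>. If all \<open>c\<close> vanish,
  divide the relation by \<open>y\<^sub>0\<close>. Otherwise saturation with respect to \<open>(y\<^sub>0, y\<^sub>1)\<close> shows that the
  combination \<open>v\<close> of the generators with the coefficients \<open>c\<close> and suitable powers of \<open>y\<^sub>1\<close> has
  the form \<open>y\<^sub>0 v'\<close> with \<open>v' \<in> I\<^sub>i\<close>. For degree reasons \<open>v'\<close> does not involve a generator of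
  highest degree occurring in \<open>v\<close>, which is therefore redundant.\<close>

theorem minimal_generators_independent:
  assumes W: "generates i W" and min: "\<And>W'. generates i W' \<Longrightarrow> card W \<le> card W'"
    and a: "\<And>w. w \<in> W \<Longrightarrow> homog xdeg 0 (a w)" and rel: "(\<Sum>w\<in>W. a w * w) = 0" and w: "w \<in> W"
  shows "a w = 0"
proof -
  have fin: "finite W" and WI: "W \<subseteq> I"
    and span: "\<And>f. f \<in> I \<Longrightarrow> homog xdeg i f \<Longrightarrow> \<exists>a. (\<forall>w. homog xdeg 0 (a w)) \<and> f = (\<Sum>w\<in>W. a w * w)"
    using W by (auto simp: generates_def)
  have "\<forall>w\<in>W. \<exists>\<delta>. supported (\<lambda>\<epsilon>. xdeg \<epsilon> = i \<and> ydeg \<epsilon> = \<delta>) w" using W by (simp add: generates_def)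
  then obtain \<delta> where deg: "\<And>w. w \<in> W \<Longrightarrow> supported (\<lambda>\<epsilon>. xdeg \<epsilon> = i \<and> ydeg \<epsilon> = \<delta> w) w" by metis
  have ydeg: "homog ydeg (\<delta> w) w" and xdeg: "homog xdeg i w" if "w \<in> W" for w
    using deg[OF that] by (auto elim: supported_mono)
  have comp: "gpart ydeg D (r * w) = (if \<delta> w \<le> D then gpart ydeg (D - \<delta> w) r else 0) * w" if "w \<in> W" for D r w
    using gpart_mult_homog[OF additive_ydeg ydeg[OF that], of "D - \<delta> w" r]
      gpart_mult_homog_less[OF additive_ydeg ydeg[OF that], of D r] by (auto simp: mult.commute)
  have redundant: False if z: "z \<in> W" and eq: "z = (\<Sum>w\<in>W - {z}. r w * w)"
    and r: "\<And>w. w \<in> W - {z} \<Longrightarrow> homog xdeg 0 (r w)" for z r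
  proof -
    have "\<exists>b. (\<forall>w. homog xdeg 0 (b w)) \<and> f = (\<Sum>w\<in>W - {z}. b w * w)" if f: "f \<in> I" "homog xdeg i f" for f
    proof -
      obtain b where b: "\<forall>w. homog xdeg 0 (b w)" "f = (\<Sum>w\<in>W. b w * w)" using span[OF f] by blast
      have "f = b z * z + (\<Sum>w\<in>W - {z}. b w * w)" unfolding b(2) using fin z by (rule sum.remove)
      also have "b z * z = (\<Sum>w\<in>W - {z}. b z * r w * w)" by (subst eq) (simp add: sum_distrib_left mult.assoc)
      finally have "f = (\<Sum>w\<in>W - {z}. (if w \<in> W - {z} then b z * r w + b w else 0) * w)"
        by (simp add: distrib_right sum.distrib)
      moreover have "homog xdeg 0 (if w \<in> W - {z} then b z * r w + b w else 0)" for w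
        using b(1) r homog_mult[OF additive_xdeg, of 0 "b z" 0 "r w"] by (auto intro: supported_add)
      ultimately show ?thesis by (intro exI[of _ "\<lambda>w. if w \<in> W - {z} then b z * r w + b w else 0"] conjI allI)
    qed
    then have "generates i (W - {z})" using W unfolding generates_def by auto
    then have "card W \<le> card (W - {z})" by (rule min)
    then show False using fin z by (metis card_Diff1_less not_le)
  qed
  have main: "\<forall>w\<in>W. b w = 0"
    if "\<And>w. w \<in> W \<Longrightarrow> \<delta> w \<le> D \<Longrightarrow> supported (\<lambda>\<epsilon>. xdeg \<epsilon> = 0 \<and> ydeg \<epsilon> = D - \<delta> w) (b w)"
      "\<And>w. w \<in> W \<Longrightarrow> D < \<delta> w \<Longrightarrow> b w = 0" "(\<Sum>w\<in>W. b w * w) = 0" for D b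
    using that
  proof (induction D arbitrary: b rule: less_induct)
    case (less D b)
    have "\<forall>w\<in>W. \<exists>c b'. b w = const c * cox_gen X21 ^ (D - \<delta> w) + cox_gen X20 * b' \<and>
        supported (\<lambda>\<epsilon>. xdeg \<epsilon> = 0 \<and> Suc (ydeg \<epsilon>) = D - \<delta> w) b' \<and> (D < \<delta> w \<longrightarrow> c = 0)"
    proof
      fix w assume w: "w \<in> W"
      show "\<exists>c b'. b w = const c * cox_gen X21 ^ (D - \<delta> w) + cox_gen X20 * b' \<and>
        supported (\<lambda>\<epsilon>. xdeg \<epsilon> = 0 \<and> Suc (ydeg \<epsilon>) = D - \<delta> w) b' \<and> (D < \<delta> w \<longrightarrow> c = 0)"
      proof (cases "\<delta> w \<le> D")
        case True
        show ?thesis by (rule y_form_split[OF less.prems(1)[OF w True]]) (use True in auto)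
      next
        case False
        then show ?thesis using less.prems(2)[OF w] by (intro exI[of _ 0]) simp
      qed
    qed
    from bchoice[OF this] obtain c where "\<forall>w\<in>W. \<exists>b'. b w = const (c w) * cox_gen X21 ^ (D - \<delta> w) + cox_gen X20 * b' \<and>
        supported (\<lambda>\<epsilon>. xdeg \<epsilon> = 0 \<and> Suc (ydeg \<epsilon>) = D - \<delta> w) b' \<and> (D < \<delta> w \<longrightarrow> c w = 0)" ..
    from bchoice[OF this] obtain b' where split: "\<And>w. w \<in> W \<Longrightarrow> b w = const (c w) * cox_gen X21 ^ (D - \<delta> w) + cox_gen X20 * b' w"
      and b': "\<And>w. w \<in> W \<Longrightarrow> supported (\<lambda>\<epsilon>. xdeg \<epsilon> = 0 \<and> Suc (ydeg \<epsilon>) = D - \<delta> w) (b' w)"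
      and c0: "\<And>w. w \<in> W \<Longrightarrow> D < \<delta> w \<Longrightarrow> c w = 0" by blast
    have sum_split: "(\<Sum>w\<in>W. const (c w) * cox_gen X21 ^ (D - \<delta> w) * w) + cox_gen X20 * (\<Sum>w\<in>W. b' w * w) = 0"
      using less.prems(3) split by (simp add: distrib_right sum.distrib sum_distrib_left mult.assoc)
    show ?case
    proof (cases "\<forall>w\<in>W. c w = 0")
      case True
      then have "cox_gen X20 * (\<Sum>w\<in>W. b' w * w) = 0" using sum_split by simp
      then have z: "(\<Sum>w\<in>W. b' w * w) = 0" by simp
      have "\<forall>w\<in>W. b' w = 0"
      proof (cases D)
        case 0
        then show ?thesis using b' by (auto simp: supported_def)
      next
        case (Suc D')
        show ?thesis
        proof (rule less.IH[of D', OF _ _ _ z])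
          show "supported (\<lambda>\<epsilon>. xdeg \<epsilon> = 0 \<and> ydeg \<epsilon> = D' - \<delta> w) (b' w)" if "w \<in> W" "\<delta> w \<le> D'" for w
            using b'[OF that(1)] by (rule supported_mono) (use that Suc in auto)
          show "b' w = 0" if "w \<in> W" "D' < \<delta> w" for w
            using b'[OF that(1)] that(2) Suc by (auto simp: supported_def)
        qed (use Suc in auto)
      qed
      then show ?thesis using True split by simp
    next
      case False
      define K where "K = {w \<in> W. c w \<noteq> 0}"
      have K: "finite K" "K \<noteq> {}" "K \<subseteq> W" using fin False by (auto simp: K_def)
      have "Max (\<delta> ` K) \<in> \<delta> ` K" by (rule Max_in) (use K in auto)
      then obtain z where z: "z \<in> K" "\<delta> z = Max (\<delta> ` K)" by auto
      have zmax: "\<delta> w \<le> \<delta> z" if "w \<in> K" for w unfolding z(2) using K(1) that by auto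
      have zW: "z \<in> W" "c z \<noteq> 0" "\<delta> z \<le> D" using z(1) c0[of z] by (auto simp: K_def not_le[symmetric])
      define v where "v = (\<Sum>w\<in>K. const (c w) * cox_gen X21 ^ (\<delta> z - \<delta> w) * w)"
      define p where "p = D - \<delta> z"
      define y where "y = - (\<Sum>w\<in>W. b' w * w)"
      have "cox_gen X21 ^ p * v = (\<Sum>w\<in>K. const (c w) * cox_gen X21 ^ (D - \<delta> w) * w)"
        unfolding v_def sum_distrib_left
      proof (rule sum.cong)
        fix w assume "w \<in> K"
        then have "D - \<delta> w = p + (\<delta> z - \<delta> w)" using zmax zW(3) by (simp add: p_def)
        then show "cox_gen X21 ^ p * (const (c w) * cox_gen X21 ^ (\<delta> z - \<delta> w) * w) =
            const (c w) * cox_gen X21 ^ (D - \<delta> w) * w" by (simp add: power_add mult_ac)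
      qed simp
      also have "\<dots> = (\<Sum>w\<in>W. const (c w) * cox_gen X21 ^ (D - \<delta> w) * w)"
        by (rule sum.mono_neutral_left) (use fin in \<open>auto simp: K_def\<close>)
      also have "\<dots> = cox_gen X20 ^ 1 * y" using sum_split by (simp add: y_def eq_neg_iff_add_eq_0)
      finally have pv: "cox_gen X21 ^ p * v = cox_gen X20 ^ 1 * y" .
      then obtain v' where "v = cox_gen X20 ^ 1 * v'" using var_power_cancel[of X20 X21] by blast
      then have v': "v = cox_gen X20 * v'" by simp
      then have "cox_gen X20 * (cox_gen X21 ^ p * v') = cox_gen X20 * y" using pv by (simp add: mult.left_commute)
      then have "cox_gen X21 ^ p * v' = y" by simp
      moreover have "y \<in> I" unfolding y_def
        by (intro type_ideal_uminus[OF id] type_ideal_sum[OF id] type_ideal_mult[OF id]) (use WI in auto)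
      moreover have "v \<in> I" unfolding v_def
        by (intro type_ideal_sum[OF id] type_ideal_mult[OF id]) (use WI K in auto)
      ultimately have v'I: "v' \<in> I" using saty[of 1 v' p] v' by simp
      have vdeg: "supported (\<lambda>\<epsilon>. xdeg \<epsilon> = i \<and> ydeg \<epsilon> = \<delta> z) v"
        unfolding v_def
      proof (rule supported_sum)
        fix w assume w: "w \<in> K"
        have "supported (\<lambda>\<epsilon>. xdeg \<epsilon> = 0 \<and> ydeg \<epsilon> = \<delta> z - \<delta> w) (const (c w) * cox_gen X21 ^ (\<delta> z - \<delta> w))"
          by (simp add: const_def cox_gen_power mult_single supported_def xdeg_def ydeg_def lookup_single)
        then show "supported (\<lambda>\<epsilon>. xdeg \<epsilon> = i \<and> ydeg \<epsilon> = \<delta> z) (const (c w) * cox_gen X21 ^ (\<delta> z - \<delta> w) * w)"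
          by (rule supported_mult[OF _ deg]) (use w K zmax[OF w] in \<open>auto simp: additiveD additive_xdeg additive_ydeg\<close>)
      qed
      have v'deg: "supported (\<lambda>\<epsilon>. xdeg \<epsilon> = i \<and> Suc (ydeg \<epsilon>) = \<delta> z) v'"
        unfolding supported_def
      proof
        fix \<epsilon> assume "\<epsilon> \<in> Poly_Mapping.keys v'"
        then have "Poly_Mapping.single X20 1 + \<epsilon> \<in> Poly_Mapping.keys v"
          unfolding v' cox_gen_def by (simp only: in_keys_iff lookup_single_mult) simp
        then have "xdeg (Poly_Mapping.single X20 1 + \<epsilon>) = i" "ydeg (Poly_Mapping.single X20 1 + \<epsilon>) = \<delta> z"
          using vdeg by (auto simp: supported_def)
        then show "xdeg \<epsilon> = i \<and> Suc (ydeg \<epsilon>) = \<delta> z" by (simp add: xdeg_def ydeg_def lookup_add lookup_single)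
      qed
      have "homog xdeg i v'" using v'deg by (rule supported_mono) auto
      then obtain s where s: "\<forall>w. homog xdeg 0 (s w)" "v' = (\<Sum>w\<in>W. s w * w)" using span[OF v'I] by blast
      \<comment> \<open>Only the part of weight \<open>\<delta> z - 1\<close> matters, and there \<open>z\<close> does not contribute.\<close>
      define t where "t w = (if Suc (\<delta> w) \<le> \<delta> z then gpart ydeg (\<delta> z - 1 - \<delta> w) (s w) else 0)" for w
      have t0: "homog xdeg 0 (t w)" for w using s(1) by (auto simp: t_def intro: supported_partI)
      have v't: "v' = (\<Sum>w\<in>W - {z}. t w * w)"
      proof (cases "\<delta> z = 0")
        case True
        then have "v' = 0" using v'deg by (auto simp: supported_def)
        then show ?thesis using True by (simp add: t_def)
      next
        case False
        have "v' = gpart ydeg (\<delta> z - 1) v'"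
          by (rule part_supported[symmetric]) (use v'deg in \<open>auto elim!: supported_mono\<close>)
        also have "\<dots> = (\<Sum>w\<in>W. t w * w)" unfolding s(2) part_sum t_def
          using False by (intro sum.cong) (auto simp: comp)
        also have "\<dots> = (\<Sum>w\<in>W - {z}. t w * w)"
          using False by (intro sum.mono_neutral_right) (use fin in \<open>auto simp: t_def\<close>)
        finally show ?thesis .
      qed
      define q where "q w = const (inverse (c z)) * (cox_gen X20 * t w - const (c w) * cox_gen X21 ^ (\<delta> z - \<delta> w))" for w
      have "v = const (c z) * z + (\<Sum>w\<in>K - {z}. const (c w) * cox_gen X21 ^ (\<delta> z - \<delta> w) * w)"
        unfolding v_def using K(1) z(1) by (subst sum.remove[of K z]) auto
      also have "(\<Sum>w\<in>K - {z}. const (c w) * cox_gen X21 ^ (\<delta> z - \<delta> w) * w) =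
          (\<Sum>w\<in>W - {z}. const (c w) * cox_gen X21 ^ (\<delta> z - \<delta> w) * w)"
        by (rule sum.mono_neutral_left) (use fin in \<open>auto simp: K_def\<close>)
      finally have "const (c z) * z = cox_gen X20 * v' - (\<Sum>w\<in>W - {z}. const (c w) * cox_gen X21 ^ (\<delta> z - \<delta> w) * w)"
        using v' by (simp add: algebra_simps)
      also have "\<dots> = (\<Sum>w\<in>W - {z}. (cox_gen X20 * t w - const (c w) * cox_gen X21 ^ (\<delta> z - \<delta> w)) * w)"
        unfolding v't by (simp add: sum_distrib_left sum_subtractf left_diff_distrib mult.assoc)
      finally have "const (inverse (c z)) * (const (c z) * z) = (\<Sum>w\<in>W - {z}. q w * w)"
        by (simp add: q_def sum_distrib_left mult.assoc)
      then have "z = (\<Sum>w\<in>W - {z}. q w * w)" using const_inverse[OF zW(2)] by (simp flip: mult.assoc)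
      moreover have "homog xdeg 0 (q w)" for w
      proof -
        have 1: "homog xdeg 0 (const r)" "homog xdeg 0 (cox_gen X20 :: 'k cox)" "homog xdeg 0 (cox_gen X21 ^ n :: 'k cox)" for r :: 'k and n
          using cox_gen_power[of X20 1, where 'k = 'k]
          by (simp_all add: const_def cox_gen_power supported_def xdeg_def lookup_single)
        have mult: "homog xdeg 0 (f * h)" if "homog xdeg 0 f" "homog xdeg 0 h" for f h :: "'k cox"
          using homog_mult[OF additive_xdeg that] by simp
        show ?thesis unfolding q_def by (intro mult supported_diff 1 t0)
      qed
      ultimately have False using redundant[OF zW(1)] by blast
      then show ?thesis ..
    qed
  qed
  have "gpart ydeg m (a w) = 0" for m
  proof -
    define D where "D = m + \<delta> w"
    define b where "b w = (if \<delta> w \<le> D then gpart ydeg (D - \<delta> w) (a w) else 0)" for w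
    have "(\<Sum>w\<in>W. b w * w) = gpart ydeg D (\<Sum>w\<in>W. a w * w)"
      unfolding part_sum b_def by (rule sum.cong) (simp_all add: comp)
    then have "(\<Sum>w\<in>W. b w * w) = 0" using rel by simp
    moreover have "supported (\<lambda>\<epsilon>. xdeg \<epsilon> = 0 \<and> ydeg \<epsilon> = D - \<delta> w) (b w)" if "w \<in> W" "\<delta> w \<le> D" for w
      using a[OF that(1)] that(2) by (auto simp: b_def supported_def keys_part)
    ultimately have "\<forall>w\<in>W. b w = 0" by (intro main[of D b]) (auto simp: b_def)
    then have "b w = 0" using w by blast
    then show ?thesis unfolding b_def D_def by simp
  qed
  moreover obtain n where "below ydeg n (a w)" using below_exists by blast
  ultimately show ?thesis using below_decompose[of ydeg n "a w"] by simp
qed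

end


section \<open>Determinants\<close>

text \<open>If \<open>r < n\<close>, pad \<open>A\<close> and \<open>B\<close> by zeros to square matrices: their determinants vanish, but not
  that of the product.\<close>

lemma scalar_product_dims:
  fixes A B :: "'a::idom mat"
  assumes A: "A \<in> carrier_mat n r" and B: "B \<in> carrier_mat r n" and AB: "A * B = c \<cdot>\<^sub>m 1\<^sub>m n" and c: "c \<noteq> 0"
  shows "n \<le> r"
proof (rule ccontr)
  assume "\<not> n \<le> r"
  then have r: "r < n" by simp
  define A' where "A' = mat n n (\<lambda>(i, j). if j < r then A $$ (i, j) else 0)"
  define B' where "B' = mat n n (\<lambda>(i, j). if i < r then B $$ (i, j) else 0)"
  have carr: "A' \<in> carrier_mat n n" "B' \<in> carrier_mat n n" by (simp_all add: A'_def B'_def)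
  have "A' * B' = A * B"
  proof (rule eq_matI)
    fix i j assume ij: "i < dim_row (A * B)" "j < dim_col (A * B)"
    then have "i < n" "j < n" using A B by auto
    then have "(A' * B') $$ (i, j) = (\<Sum>k\<in>{0..<n}. A' $$ (i, k) * B' $$ (k, j))"
      using carr by (simp add: scalar_prod_def)
    also have "\<dots> = (\<Sum>k\<in>{0..<r}. A' $$ (i, k) * B' $$ (k, j))"
      using r \<open>i < n\<close> \<open>j < n\<close> by (intro sum.mono_neutral_right) (auto simp: A'_def B'_def)
    also have "\<dots> = (\<Sum>k\<in>{0..<r}. A $$ (i, k) * B $$ (k, j))"
      using r \<open>i < n\<close> \<open>j < n\<close> by (intro sum.cong) (auto simp: A'_def B'_def)
    also have "\<dots> = (A * B) $$ (i, j)" using A B \<open>i < n\<close> \<open>j < n\<close> by (simp add: scalar_prod_def)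
    finally show "(A' * B') $$ (i, j) = (A * B) $$ (i, j)" .
  qed (use A B carr in auto)
  then have "det A' * det B' = c ^ n" using AB det_mult[OF carr] by simp
  moreover have "det A' = 0"
  proof -
    have "\<not> n - 1 < r" using r by simp
    then show ?thesis using laplace_expansion_column[OF carr(1), of "n - 1"] r by (simp add: A'_def)
  qed
  ultimately show False using c by simp
qed

lemma submatrix_delete_row:
  assumes M: "M \<in> carrier_mat (Suc a) a" and r: "r \<le> a"
  shows "submatrix M ({..<Suc a} - {r}) {..<a} = mat a a (\<lambda>(k, j). M $$ (if k < r then k else Suc k, j))"
proof (rule eq_matI)
  let ?K = "{..<Suc a} - {r}"
  have "{i. i < dim_row M \<and> i \<in> ?K} = ?K" "{j. j < dim_col M \<and> j \<in> {..<a}} = {..<a}" using M by auto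
  then have dims: "card {i. i < dim_row M \<and> i \<in> ?K} = a" "card {j. j < dim_col M \<and> j \<in> {..<a}} = a"
    using r by simp_all
  show "dim_row (submatrix M ?K {..<a}) = dim_row (mat a a (\<lambda>(k, j). M $$ (if k < r then k else Suc k, j)))"
    "dim_col (submatrix M ?K {..<a}) = dim_col (mat a a (\<lambda>(k, j). M $$ (if k < r then k else Suc k, j)))"
    by (simp_all only: dim_submatrix dims dim_row_mat dim_col_mat)
  fix k j assume "k < dim_row (mat a a (\<lambda>(k, j). M $$ (if k < r then k else Suc k, j)))"
    "j < dim_col (mat a a (\<lambda>(k, j). M $$ (if k < r then k else Suc k, j)))"
  then have kj: "k < a" "j < a" by auto
  define k' where "k' = (if k < r then k else Suc k)"
  have "k' \<in> ?K" using kj r by (auto simp: k'_def)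
  then have "pick ?K (card {x \<in> ?K. x < k'}) = k'" by (rule pick_card_in_set)
  moreover have "{x \<in> ?K. x < k'} = (if k < r then {..<k} else {..<Suc k} - {r})"
    using kj r by (auto simp: k'_def)
  then have "card {x \<in> ?K. x < k'} = k" by (auto simp: not_less)
  ultimately have pk: "pick ?K k = k'" by simp
  have "pick {..<a} (card {x \<in> {..<a}. x < j}) = j" by (rule pick_card_in_set) (use kj in simp)
  moreover have "{x \<in> {..<a}. x < j} = {..<j}" using kj by auto
  ultimately have pj: "pick {..<a} j = j" by simp
  show "submatrix M ?K {..<a} $$ (k, j) = mat a a (\<lambda>(k, j). M $$ (if k < r then k else Suc k, j)) $$ (k, j)"
    using submatrix_index[of k M ?K j "{..<a}"] kj unfolding dims pk pj by (simp add: k'_def)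
qed

lemma maximal_minors:
  assumes M: "M \<in> carrier_mat (Suc a) a"
  shows "minors a M = (\<lambda>r. det (submatrix M ({..<Suc a} - {r}) {..<a})) ` {..a}"
proof (intro equalityI subsetI)
  fix x assume "x \<in> minors a M"
  then obtain K L where x: "x = det (submatrix M K L)" and K: "K \<subseteq> {..<Suc a}" "card K = a"
    and L: "L \<subseteq> {..<a}" "card L = a"
    unfolding minors_def using M by auto
  have "card ({..<Suc a} - K) = 1" using K by (subst card_Diff_subset) (auto intro: finite_subset)
  then obtain r where r: "{..<Suc a} - K = {r}" by (auto simp: card_1_singleton_iff)
  then have "K = {..<Suc a} - {r}" "r \<le> a" using K(1) by auto
  moreover have "L = {..<a}" using L by (intro card_subset_eq) auto
  ultimately show "x \<in> (\<lambda>r. det (submatrix M ({..<Suc a} - {r}) {..<a})) ` {..a}" using x by blast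
next
  fix x assume "x \<in> (\<lambda>r. det (submatrix M ({..<Suc a} - {r}) {..<a})) ` {..a}"
  then obtain r where "r \<le> a" "x = det (submatrix M ({..<Suc a} - {r}) {..<a})" by auto
  then show "x \<in> minors a M" unfolding minors_def using M
    by (intro CollectI exI[of _ "{..<Suc a} - {r}"] exI[of _ "{..<a}"]) auto
qed

text \<open>Cramer's rule for the syzygies \<open>x\<^sub>0 (x\<^sub>1 w) - x\<^sub>1 (x\<^sub>0 w) = 0\<close>. The rows of \<open>C\<close> and \<open>C'\<close> are
  the coefficients of forms of degree \<open>a\<close> and \<open>a - 1\<close> in \<open>x\<^sub>0, x\<^sub>1\<close>, the latter being the \<open>w\<close>,
  and the columns of \<open>M\<close> express the syzygies by the former. Complete \<open>M\<close> by a unit vector; then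
  the product with the transpose of \<open>C\<close> is the product of two matrices: the matrix \<open>\<Delta>\<close> of the
  syzygies for monomials \<open>w\<close>, completed by a row of \<open>C\<close>, and the transpose of \<open>C'\<close>. The
  determinant of \<open>\<Delta>\<close> is the form with that row of coefficients, up to sign.\<close>

theorem syzygy_minors:
  fixes M C C' :: "'a::idom mat"
  assumes M: "M \<in> carrier_mat (Suc a) a" and C: "C \<in> carrier_mat (Suc a) (Suc a)" and C': "C' \<in> carrier_mat a a"
    and x1: "x1 \<noteq> 0"
    and rel: "\<And>j s. j < a \<Longrightarrow> s \<le> a \<Longrightarrow> (\<Sum>k\<le>a. M $$ (k, j) * C $$ (k, s)) =
      (if s = 0 then 0 else x0 * C' $$ (j, s - 1)) - (if s < a then x1 * C' $$ (j, s) else 0)"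
    and r: "r \<le> a"
  obtains \<sigma> where "\<sigma> = 1 \<or> \<sigma> = -1"
    "det C * det (submatrix M ({..<Suc a} - {r}) {..<a}) =
      \<sigma> * (\<Sum>s\<le>a. C $$ (r, s) * (x0 ^ (a - s) * x1 ^ s)) * det C'"
proof -
  let ?n = "Suc a"
  let ?f = "\<Sum>s\<le>a. C $$ (r, s) * (x0 ^ (a - s) * x1 ^ s)"
  define N where "N = mat ?n ?n (\<lambda>(k, j). if j < a then M $$ (k, j) else if k = r then 1 else 0)"
  define \<Delta> where "\<Delta> = mat ?n ?n (\<lambda>(s, q). if q < a then (if s = Suc q then x0 else if s = q then - x1 else 0) else C $$ (r, s))"
  define E where "E = mat ?n ?n (\<lambda>(q, j). if q < a \<and> j < a then C' $$ (j, q) else if q = a \<and> j = a then 1 else 0)"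
  \<comment> \<open>Adding the multiples of the other rows by \<open>x\<^sub>0\<^bsup>a-t\<^esup> x\<^sub>1\<^sup>t\<close> to \<open>x\<^sub>1\<^sup>a\<close> times the last row of
    \<open>\<Delta>\<close> annihilates all its entries but the last one.\<close>
  define L where "L = mat ?n ?n (\<lambda>(s, t). if s < a then (if s = t then 1 else 0) else x0 ^ (a - t) * x1 ^ t)"
  have carr: "N \<in> carrier_mat ?n ?n" "\<Delta> \<in> carrier_mat ?n ?n" "E \<in> carrier_mat ?n ?n" "L \<in> carrier_mat ?n ?n"
    "transpose_mat C \<in> carrier_mat ?n ?n"
    using C by (simp_all add: N_def \<Delta>_def E_def L_def)
  have mult: "(A * B) $$ (i, j) = (\<Sum>k\<le>a. A $$ (i, k) * B $$ (k, j))"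
    if "A \<in> carrier_mat ?n ?n" "B \<in> carrier_mat ?n ?n" "i \<le> a" "j \<le> a" for A B :: "'a mat" and i j
    using that by (simp add: scalar_prod_def atLeast0LessThan lessThan_Suc_atMost)
  have "transpose_mat C * N = \<Delta> * E"
  proof (rule eq_matI)
    fix s j assume "s < dim_row (\<Delta> * E)" "j < dim_col (\<Delta> * E)"
    then have sj: "s \<le> a" "j \<le> a" using carr by auto
    have lhs: "(transpose_mat C * N) $$ (s, j) = (\<Sum>k\<le>a. C $$ (k, s) * N $$ (k, j))"
      unfolding mult[OF carr(5,1) sj] using C sj by (intro sum.cong) auto
    have rhs: "(\<Delta> * E) $$ (s, j) = (\<Sum>q\<le>a. \<Delta> $$ (s, q) * E $$ (q, j))" by (rule mult[OF carr(2,3) sj])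
    show "(transpose_mat C * N) $$ (s, j) = (\<Delta> * E) $$ (s, j)"
    proof (cases "j < a")
      case True
      have "(\<Sum>k\<le>a. C $$ (k, s) * N $$ (k, j)) = (\<Sum>k\<le>a. M $$ (k, j) * C $$ (k, s))"
        using sj True by (intro sum.cong) (auto simp: N_def mult.commute)
      also have "\<dots> = (if s = 0 then 0 else x0 * C' $$ (j, s - 1)) - (if s < a then x1 * C' $$ (j, s) else 0)"
        by (rule rel[OF True sj(1)])
      also have "\<dots> = (\<Sum>q<a. (if q = s - 1 then (if s = 0 then 0 else x0 * C' $$ (j, q)) else 0)) +
          (\<Sum>q<a. (if q = s then - x1 * C' $$ (j, q) else 0))"
        using sj True by (auto simp: sum.delta)
      also have "\<dots> = (\<Sum>q<a. \<Delta> $$ (s, q) * E $$ (q, j))"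
        unfolding sum.distrib[symmetric] using sj True by (intro sum.cong) (auto simp: \<Delta>_def E_def)
      also have "\<dots> = (\<Sum>q\<le>a. \<Delta> $$ (s, q) * E $$ (q, j))"
        using True by (simp add: lessThan_Suc_atMost[symmetric] E_def)
      finally show ?thesis unfolding lhs rhs .
    next
      case False
      then have j: "j = a" using sj by simp
      have "(\<Sum>k\<le>a. C $$ (k, s) * N $$ (k, j)) = (\<Sum>k\<le>a. if k = r then C $$ (k, s) else 0)"
        using j by (intro sum.cong) (auto simp: N_def)
      also have "\<dots> = C $$ (r, s)" using r by simp
      also have "\<dots> = (\<Sum>q\<le>a. if q = a then \<Delta> $$ (s, q) else 0)" using sj by (simp add: \<Delta>_def)
      also have "\<dots> = (\<Sum>q\<le>a. \<Delta> $$ (s, q) * E $$ (q, j))" using j by (intro sum.cong) (auto simp: E_def)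
      finally show ?thesis unfolding lhs rhs .
    qed
  qed (use carr C in auto)
  then have "det C * det N = det \<Delta> * det E"
    using det_mult[OF carr(5,1)] det_mult[OF carr(2,3)] det_transpose[OF C] by simp
  moreover have "det N = (-1) ^ (r + a) * det (submatrix M ({..<Suc a} - {r}) {..<a})"
  proof -
    have "det N = (\<Sum>i<?n. N $$ (i, a) * cofactor N i a)" by (rule laplace_expansion_column[OF carr(1)]) simp
    also have "\<dots> = (\<Sum>i<?n. if i = r then cofactor N i a else 0)" by (intro sum.cong) (auto simp: N_def)
    also have "\<dots> = cofactor N r a" using r by simp
    also have "mat_delete N r a = submatrix M ({..<Suc a} - {r}) {..<a}"
      unfolding submatrix_delete_row[OF M r] mat_delete_def
      by (rule eq_matI) (use r in \<open>auto simp: N_def\<close>)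
    then have "cofactor N r a = (-1) ^ (r + a) * det (submatrix M ({..<Suc a} - {r}) {..<a})"
      by (simp add: cofactor_def)
    finally show ?thesis .
  qed
  moreover have "det E = det C'"
  proof -
    have "det E = (\<Sum>j<?n. E $$ (a, j) * cofactor E a j)" by (rule laplace_expansion_row[OF carr(3)]) simp
    also have "\<dots> = (\<Sum>j<?n. if j = a then cofactor E a j else 0)" by (intro sum.cong) (auto simp: E_def)
    also have "\<dots> = cofactor E a a" by simp
    also have "mat_delete E a a = transpose_mat C'"
      unfolding mat_delete_def by (rule eq_matI) (use C' in \<open>auto simp: E_def\<close>)
    then have "cofactor E a a = det C'" using det_transpose[OF C'] by (simp add: cofactor_def)
    finally show ?thesis .
  qed
  moreover have "det \<Delta> = (-1) ^ a * ?f"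
  proof -
    have detL: "det L = x1 ^ a"
    proof -
      have "det L = prod_list (diag_mat L)" by (rule det_lower_triangular[OF _ carr(4)]) (auto simp: L_def)
      also have "\<dots> = (\<Prod>i<?n. L $$ (i, i))"
        unfolding prod_list_diag_prod using carr(4) by (auto simp: atLeast0LessThan)
      also have "\<dots> = x1 ^ a" by (simp add: L_def)
      finally show ?thesis .
    qed
    have P: "L * \<Delta> \<in> carrier_mat ?n ?n" using carr by auto
    have upper: "(L * \<Delta>) $$ (s, q) = \<Delta> $$ (s, q)" if "s < a" "q \<le> a" for s q
    proof -
      have "(L * \<Delta>) $$ (s, q) = (\<Sum>k\<le>a. L $$ (s, k) * \<Delta> $$ (k, q))" by (rule mult[OF carr(4,2)]) (use that in auto)
      also have "\<dots> = (\<Sum>k\<le>a. if k = s then \<Delta> $$ (k, q) else 0)"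
        using that by (intro sum.cong) (auto simp: L_def)
      also have "\<dots> = \<Delta> $$ (s, q)" using that by simp
      finally show ?thesis .
    qed
    have last: "(L * \<Delta>) $$ (a, q) = (if q = a then ?f else 0)" if q: "q \<le> a" for q
    proof -
      have "(L * \<Delta>) $$ (a, q) = (\<Sum>t\<le>a. L $$ (a, t) * \<Delta> $$ (t, q))" by (rule mult[OF carr(4,2)]) (use q in auto)
      also have "\<dots> = (if q = a then ?f else 0)"
      proof (cases "q = a")
        case True
        then show ?thesis by (auto simp: L_def \<Delta>_def mult.commute intro!: sum.cong)
      next
        case False
        then have qa: "q < a" using q by simp
        have "(\<Sum>t\<le>a. L $$ (a, t) * \<Delta> $$ (t, q)) =
            (\<Sum>t\<le>a. (if t = Suc q then x0 ^ (a - t) * x1 ^ t * x0 else 0) + (if t = q then - (x0 ^ (a - t) * x1 ^ t * x1) else 0))"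
          using qa by (intro sum.cong) (auto simp: L_def \<Delta>_def)
        also have "\<dots> = x0 ^ (a - Suc q) * x1 ^ Suc q * x0 - x0 ^ (a - q) * x1 ^ q * x1"
          unfolding sum.distrib using qa by simp
        also have "x0 ^ (a - q) = x0 * x0 ^ (a - Suc q)" using qa by (metis Suc_diff_Suc power_Suc)
        finally show ?thesis using False by (simp add: mult_ac)
      qed
      finally show ?thesis .
    qed
    have "det (L * \<Delta>) = (\<Sum>q<?n. (L * \<Delta>) $$ (a, q) * cofactor (L * \<Delta>) a q)"
      by (rule laplace_expansion_row[OF P]) simp
    also have "\<dots> = (\<Sum>q<?n. if q = a then ?f * cofactor (L * \<Delta>) a q else 0)"
      by (intro sum.cong) (auto simp: last simp del: index_mult_mat)
    also have "\<dots> = ?f * cofactor (L * \<Delta>) a a" by simp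
    also have "cofactor (L * \<Delta>) a a = (- x1) ^ a"
    proof -
      let ?D = "mat a a (\<lambda>(s, q). \<Delta> $$ (s, q))"
      have "mat_delete (L * \<Delta>) a a = ?D"
        unfolding mat_delete_def
        by (rule eq_matI) (use carr upper in \<open>auto simp del: index_mult_mat simp: index_mult_mat(2,3)\<close>)
      moreover have "det ?D = (- x1) ^ a"
      proof -
        have "det ?D = prod_list (diag_mat ?D)" by (rule det_lower_triangular[of a]) (auto simp: \<Delta>_def)
        also have "\<dots> = (\<Prod>i<a. ?D $$ (i, i))" unfolding prod_list_diag_prod by (simp add: atLeast0LessThan)
        also have "\<dots> = (- x1) ^ a" by (simp add: \<Delta>_def)
        finally show ?thesis .
      qed
      ultimately show ?thesis by (simp add: cofactor_def)
    qed
    finally have "x1 ^ a * det \<Delta> = ?f * (- x1) ^ a" using det_mult[OF carr(4,2)] detL by simp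
    then have "x1 ^ a * det \<Delta> = x1 ^ a * ((-1) ^ a * ?f)"
      using power_minus[of x1 a] by (simp add: mult_ac)
    then show ?thesis using x1 by simp
  qed
  ultimately have eq: "det C * ((-1) ^ (r + a) * det (submatrix M ({..<Suc a} - {r}) {..<a})) = (-1) ^ a * ?f * det C'"
    by simp
  have "(-1) ^ (r + a) * (-1) ^ (r + a) = (1 :: 'a)" by (simp flip: power_mult_distrib)
  then have "det C * det (submatrix M ({..<Suc a} - {r}) {..<a}) =
      (-1) ^ (r + a) * (det C * ((-1) ^ (r + a) * det (submatrix M ({..<Suc a} - {r}) {..<a})))"
    by (metis (no_types, lifting) mult.assoc mult.left_commute mult_1)
  also have "\<dots> = ((-1) ^ (r + a) * (-1) ^ a) * ?f * det C'" unfolding eq by (simp add: mult.assoc)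
  finally show ?thesis
    by (rule that[rotated]) (metis minus_one_power_iff mult_minus1 mult_minus1_right mult_1 minus_minus)
qed

lemma det_homog_zero:
  fixes A :: "'k::field cox mat"
  assumes A: "A \<in> carrier_mat n n" and entries: "\<And>i j. i < n \<Longrightarrow> j < n \<Longrightarrow> homog xdeg 0 (A $$ (i, j))"
  shows "homog xdeg 0 (det A)"
proof -
  have mult: "homog xdeg 0 (f * h)" if "homog xdeg 0 f" "homog xdeg 0 h" for f h :: "'k cox"
    using homog_mult[OF additive_xdeg that] by simp
  have one: "homog xdeg 0 (1 :: 'k cox)" by (simp add: supported_def additive_zero[OF additive_xdeg])
  have prod: "homog xdeg 0 (prod f B)" if "\<And>x. x \<in> B \<Longrightarrow> homog xdeg 0 (f x)" for B and f :: "nat \<Rightarrow> 'k cox"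
    using that by (induction B rule: infinite_finite_induct) (auto intro: one mult)
  show ?thesis unfolding det_def'[OF A]
  proof (intro supported_sum mult prod)
    fix p show "homog xdeg 0 (signof p :: 'k cox)"
      using one supported_uminus[OF one] by (simp add: sign_def)
    fix i assume p: "p \<in> {p. p permutes {0..<n}}" "i \<in> {0..<n}"
    then have "p i < n" using permutes_in_image[of p "{0..<n}" i] by auto
    then show "homog xdeg 0 (A $$ (i, p i))" using entries p by auto
  qed
qed


section \<open>The Hilbert--Burch matrix\<close>

lemma homog_zero_mult: "homog xdeg 0 f \<Longrightarrow> homog xdeg i h \<Longrightarrow> homog xdeg i (f * h)"
  using homog_mult[OF additive_xdeg, of 0 f i h] by simp

context saturated_points
begin

text \<open>The determinant is that of the coefficients; that it does not vanish expresses linear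
  independence.\<close>

definition basis :: "nat \<Rightarrow> (nat \<Rightarrow> 'k cox) \<Rightarrow> bool" where
  "basis i w \<longleftrightarrow> (\<forall>k\<le>i. w k \<in> I \<and> homog xdeg i (w k)) \<and>
     (\<forall>f\<in>I. homog xdeg i f \<longrightarrow> (\<exists>r. (\<forall>k. homog xdeg 0 (r k)) \<and> f = (\<Sum>k\<le>i. r k * w k))) \<and>
     det (mat (Suc i) (Suc i) (\<lambda>(k, s). xcoeff i (w k) s)) \<noteq> 0"

text \<open>The module \<open>I\<^sub>i\<close> lies between \<open>F S\<^sub>i\<close> and \<open>S\<^sub>i\<close>. The matrices that express the monomials times
  \<open>F\<close> by a basis of \<open>I\<^sub>i\<close>, and this basis by the monomials, multiply to \<open>F\<close> times the identity
  in either order, so both are square.\<close>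

theorem basis_exists: "\<exists>w. basis i w"
proof -
  define n where "n = (LEAST n. \<exists>W. generates i W \<and> card W = n)"
  have "\<exists>W. generates i W \<and> card W = n"
    unfolding n_def by (rule LeastI_ex) (use generates_exists in blast)
  then obtain W where W: "generates i W" "card W = n" by blast
  have min: "card W \<le> card W'" if "generates i W'" for W'
    unfolding W(2) n_def by (rule Least_le) (use that in blast)
  have fin: "finite W" and WI: "W \<subseteq> I" using W by (auto simp: generates_def)
  obtain w where w: "bij_betw w {..<n} W"
    using ex_bij_betw_nat_finite[OF fin] W(2) by (auto simp: atLeast0LessThan)
  have wW: "w k \<in> W" if "k < n" for k using w that by (auto simp: bij_betw_def)
  have reindex: "(\<Sum>k<n. r (w k) * w k) = (\<Sum>z\<in>W. r z * z)" for r
    using sum.reindex_bij_betw[OF w, of "\<lambda>z. r z * z"] by simp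
  have wdeg: "homog xdeg i (w k)" if "k < n" for k
  proof -
    have "\<exists>\<delta>. supported (\<lambda>\<epsilon>. xdeg \<epsilon> = i \<and> ydeg \<epsilon> = \<delta>) (w k)"
      using W(1) wW[OF that] unfolding generates_def by blast
    then show ?thesis by (auto elim: supported_mono)
  qed
  have span: "\<exists>r. (\<forall>k. homog xdeg 0 (r k)) \<and> f = (\<Sum>k<n. r k * w k)" if f: "f \<in> I" "homog xdeg i f" for f
  proof -
    obtain r where "\<forall>z. homog xdeg 0 (r z)" "f = (\<Sum>z\<in>W. r z * z)" using W(1) f unfolding generates_def by blast
    then show ?thesis using reindex[of r] by (intro exI[of _ "\<lambda>k. r (w k)"]) auto
  qed
  have indep: "r k = 0" if r: "\<And>k. k < n \<Longrightarrow> homog xdeg 0 (r k)" "(\<Sum>k<n. r k * w k) = 0" "k < n" for r k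
  proof -
    define r' where "r' z = r (the_inv_into {..<n} w z)" for z
    have inv: "r' (w k) = r k" if "k < n" for k
      using the_inv_into_f_f[of w "{..<n}" k] w that by (simp add: r'_def bij_betw_def)
    have "(\<Sum>z\<in>W. r' z * z) = 0" using r(2) inv by (simp flip: reindex)
    moreover have "homog xdeg 0 (r' z)" if "z \<in> W" for z
      using w that inv r(1) by (force simp: bij_betw_def)
    ultimately have "r' (w k) = 0" using minimal_generators_independent[OF W(1) min] wW[OF r(3)] by blast
    then show ?thesis using inv[OF r(3)] by simp
  qed
  have "\<exists>r. (\<forall>k. homog xdeg 0 (r k)) \<and> F * xmon i s = (\<Sum>k<n. r k * w k)" if "s \<le> i" for s
    by (rule span) (use type_ideal_mult_right[OF id F_in] homog_zero_mult xdeg_homog(1) xmon_homog[OF that] in auto)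
  then have "\<forall>s\<in>{..i}. \<exists>r. (\<forall>k. homog xdeg 0 (r k)) \<and> F * xmon i s = (\<Sum>k<n. r k * w k)" by blast
  from bchoice[OF this] obtain b where b0: "\<And>s k. s \<le> i \<Longrightarrow> homog xdeg 0 (b s k)"
    and bF: "\<And>s. s \<le> i \<Longrightarrow> F * xmon i s = (\<Sum>k<n. b s k * w k)" by blast
  define C where "C = mat n (Suc i) (\<lambda>(k, s). xcoeff i (w k) s)"
  define B where "B = mat (Suc i) n (\<lambda>(s, k). b s k)"
  have carr: "C \<in> carrier_mat n (Suc i)" "B \<in> carrier_mat (Suc i) n" by (simp_all add: C_def B_def)
  have BC: "B * C = F \<cdot>\<^sub>m 1\<^sub>m (Suc i)"
  proof (rule eq_matI)
    fix s t assume "s < dim_row (F \<cdot>\<^sub>m 1\<^sub>m (Suc i))" "t < dim_col (F \<cdot>\<^sub>m 1\<^sub>m (Suc i))"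
    then have st: "s \<le> i" "t \<le> i" by auto
    then have "(B * C) $$ (s, t) = (\<Sum>k<n. b s k * xcoeff i (w k) t)"
      by (simp add: B_def C_def scalar_prod_def atLeast0LessThan)
    also have "\<dots> = xcoeff i (F * xmon i s) t"
      unfolding bF[OF st(1)] by (rule xcoeff_sum[symmetric]) (use b0 st wdeg in auto)
    also have "\<dots> = (if t = s then F else 0)" by (rule xcoeff_times_xmon[OF xdeg_homog(1) st])
    finally show "(B * C) $$ (s, t) = (F \<cdot>\<^sub>m 1\<^sub>m (Suc i)) $$ (s, t)" using st by auto
  qed (use carr in auto)
  have CB: "C * B = F \<cdot>\<^sub>m 1\<^sub>m n"
  proof (rule eq_matI)
    fix k j assume "k < dim_row (F \<cdot>\<^sub>m 1\<^sub>m n)" "j < dim_col (F \<cdot>\<^sub>m 1\<^sub>m n)"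
    then have kj: "k < n" "j < n" by auto
    define r where "r j = (\<Sum>s\<le>i. xcoeff i (w k) s * b s j) - (if j = k then F else 0)" for j
    have r0: "homog xdeg 0 (r j)" for j
      unfolding r_def
      by (intro supported_diff supported_sum homog_zero_mult xcoeff(1) wdeg kj b0) (use xdeg_homog(1) in auto)
    have "F * w k = (\<Sum>s\<le>i. xcoeff i (w k) s * (F * xmon i s))"
      by (subst xcoeff(2)[OF wdeg[OF kj(1)]]) (simp add: sum_distrib_left mult.left_commute)
    also have "\<dots> = (\<Sum>s\<le>i. \<Sum>j<n. xcoeff i (w k) s * b s j * w j)"
      by (rule sum.cong) (simp_all add: bF sum_distrib_left mult.assoc)
    also have "\<dots> = (\<Sum>j<n. (\<Sum>s\<le>i. xcoeff i (w k) s * b s j) * w j)"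
      by (subst sum.swap) (simp add: sum_distrib_right)
    finally have Fw: "F * w k = (\<Sum>j<n. (\<Sum>s\<le>i. xcoeff i (w k) s * b s j) * w j)" .
    have "(\<Sum>j<n. r j * w j) = (\<Sum>j<n. (\<Sum>s\<le>i. xcoeff i (w k) s * b s j) * w j) - (\<Sum>j<n. (if j = k then F * w j else 0))"
      unfolding sum_subtractf[symmetric] by (rule sum.cong) (auto simp: r_def left_diff_distrib)
    also have "\<dots> = 0" using Fw kj by simp
    finally have "r j = 0" using indep[of r j] r0 kj by blast
    moreover have "(C * B) $$ (k, j) = (\<Sum>s\<le>i. xcoeff i (w k) s * b s j)"
      using kj by (simp add: B_def C_def scalar_prod_def atLeast0LessThan lessThan_Suc_atMost)
    ultimately show "(C * B) $$ (k, j) = (F \<cdot>\<^sub>m 1\<^sub>m n) $$ (k, j)" using kj by (auto simp: r_def)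
  qed (use carr in auto)
  have n: "n = Suc i"
    using scalar_product_dims[OF carr(2,1) BC nonzero(1)] scalar_product_dims[OF carr(1,2) CB nonzero(1)] by simp
  have "det B * det C = F ^ Suc i" using det_mult[of B "Suc i" C] carr BC n by simp
  then have "det C \<noteq> 0" using nonzero(1) by auto
  then have "basis i w" unfolding basis_def
    using wW WI wdeg span n by (auto simp: C_def less_Suc_eq_le lessThan_Suc_atMost)
  then show ?thesis by blast
qed

definition w :: "nat \<Rightarrow> nat \<Rightarrow> 'k cox" where "w i = (SOME w. basis i w)"

definition C :: "nat \<Rightarrow> 'k cox mat" where "C i = mat (Suc i) (Suc i) (\<lambda>(k, s). xcoeff i (w i k) s)"

lemma basis_w: "basis i (w i)"
  unfolding w_def by (rule someI_ex[OF basis_exists])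

lemma w_in: "k \<le> i \<Longrightarrow> w i k \<in> I" and w_homog: "k \<le> i \<Longrightarrow> homog xdeg i (w i k)"
  and w_span: "f \<in> I \<Longrightarrow> homog xdeg i f \<Longrightarrow> \<exists>r. (\<forall>k. homog xdeg 0 (r k)) \<and> f = (\<Sum>k\<le>i. r k * w i k)"
  and det_C: "det (C i) \<noteq> 0"
  using basis_w[of i] by (auto simp: basis_def C_def)

lemma C_carrier: "C i \<in> carrier_mat (Suc i) (Suc i)"
  by (simp add: C_def)

lemma det_C_homog: "homog xdeg 0 (det (C i))"
  by (rule det_homog_zero[OF C_carrier]) (simp add: C_def xcoeff(1) w_homog less_Suc_eq_le)

lemma cox_x_homog: "homog xdeg 1 (cox_gen X10 :: 'k cox)" "homog xdeg 1 (cox_gen X11 :: 'k cox)"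
  by (simp_all add: cox_gen_def supported_def xdeg_def lookup_single)

text \<open>The columns of \<open>M\<close> come from the basis of \<open>I\<^sub>i\<close>: express \<open>x\<^sub>1 w\<close> and \<open>x\<^sub>0 w\<close> by the basis of
  \<open>I\<^bsub>i+1\<^esub>\<close>, multiply by \<open>x\<^sub>0\<close> and \<open>x\<^sub>1\<close>, and subtract.\<close>

theorem syzygy_matrix:
  obtains M where "M \<in> carrier_mat (Suc (Suc i)) (Suc i)"
    "\<And>r. r \<le> Suc i \<Longrightarrow> \<exists>\<sigma>. (\<sigma> = 1 \<or> \<sigma> = -1) \<and>
      det (C (Suc i)) * det (submatrix M ({..<Suc (Suc i)} - {r}) {..<Suc i}) = \<sigma> * w (Suc i) r * det (C i)"
proof -
  let ?a = "Suc i"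
  have ex: "\<exists>r. (\<forall>k. homog xdeg 0 (r k)) \<and> z * w i j = (\<Sum>k\<le>?a. r k * w ?a k)"
    if "j \<le> i" "homog xdeg 1 z" for j and z :: "'k cox"
    by (rule w_span)
       (use type_ideal_mult[OF id w_in[OF that(1)]] homog_mult[OF additive_xdeg that(2) w_homog[OF that(1)]] in auto)
  have "\<forall>j\<in>{..i}. \<exists>r. (\<forall>k. homog xdeg 0 (r k)) \<and> cox_gen X11 * w i j = (\<Sum>k\<le>?a. r k * w ?a k)"
    using ex[OF _ cox_x_homog(2)] by blast
  from bchoice[OF this] obtain U where U: "\<And>j k. j \<le> i \<Longrightarrow> homog xdeg 0 (U j k)"
    "\<And>j. j \<le> i \<Longrightarrow> cox_gen X11 * w i j = (\<Sum>k\<le>?a. U j k * w ?a k)" by blast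
  have "\<forall>j\<in>{..i}. \<exists>r. (\<forall>k. homog xdeg 0 (r k)) \<and> cox_gen X10 * w i j = (\<Sum>k\<le>?a. r k * w ?a k)"
    using ex[OF _ cox_x_homog(1)] by blast
  from bchoice[OF this] obtain V where V: "\<And>j k. j \<le> i \<Longrightarrow> homog xdeg 0 (V j k)"
    "\<And>j. j \<le> i \<Longrightarrow> cox_gen X10 * w i j = (\<Sum>k\<le>?a. V j k * w ?a k)" by blast
  define M where "M = mat (Suc ?a) ?a (\<lambda>(k, j). cox_gen X10 * U j k - cox_gen X11 * V j k)"
  have M: "M \<in> carrier_mat (Suc ?a) ?a" by (simp add: M_def)
  have rel: "(\<Sum>k\<le>?a. M $$ (k, j) * C ?a $$ (k, s)) =
      (if s = 0 then 0 else cox_gen X10 * C i $$ (j, s - 1)) - (if s < ?a then cox_gen X11 * C i $$ (j, s) else 0)"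
    if j: "j < ?a" and s: "s \<le> ?a" for j s
  proof -
    have ji: "j \<le> i" using j by simp
    have "(\<Sum>k\<le>?a. M $$ (k, j) * C ?a $$ (k, s)) =
        (\<Sum>k\<le>?a. cox_gen X10 * (U j k * xcoeff ?a (w ?a k) s) - cox_gen X11 * (V j k * xcoeff ?a (w ?a k) s))"
      using j s by (intro sum.cong) (auto simp: M_def C_def left_diff_distrib mult.assoc)
    also have "\<dots> = cox_gen X10 * (\<Sum>k\<le>?a. U j k * xcoeff ?a (w ?a k) s) -
        cox_gen X11 * (\<Sum>k\<le>?a. V j k * xcoeff ?a (w ?a k) s)"
      by (simp only: sum_subtractf sum_distrib_left)
    also have "(\<Sum>k\<le>?a. U j k * xcoeff ?a (w ?a k) s) = xcoeff ?a (cox_gen X11 * w i j) s"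
      unfolding U(2)[OF ji] by (rule xcoeff_sum[symmetric]) (use U(1)[OF ji] w_homog s in auto)
    also have "(\<Sum>k\<le>?a. V j k * xcoeff ?a (w ?a k) s) = xcoeff ?a (cox_gen X10 * w i j) s"
      unfolding V(2)[OF ji] by (rule xcoeff_sum[symmetric]) (use V(1)[OF ji] w_homog s in auto)
    finally show ?thesis
      unfolding xcoeff_x0[OF w_homog[OF ji] s] xcoeff_x1[OF w_homog[OF ji] s] using j s by (auto simp: C_def)
  qed
  show ?thesis
  proof (rule that[OF M])
    fix r assume r: "r \<le> ?a"
    have "w ?a r = (\<Sum>s\<le>?a. C ?a $$ (r, s) * (cox_gen X10 ^ (?a - s) * cox_gen X11 ^ s))"
      by (subst xcoeff(2)[OF w_homog[OF r]]) (use r in \<open>auto simp: C_def xmon_def intro!: sum.cong\<close>)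
    then show "\<exists>\<sigma>. (\<sigma> = 1 \<or> \<sigma> = -1) \<and>
      det (C ?a) * det (submatrix M ({..<Suc ?a} - {r}) {..<?a}) = \<sigma> * w ?a r * det (C i)"
      using syzygy_minors[OF M C_carrier C_carrier cox_gen_nonzero rel r] by metis
  qed
qed

text \<open>The determinant of \<open>C (i+1)\<close> divides the product of \<open>det (C i)\<close> with each basis element of
  \<open>I\<^bsub>i+1\<^esub>\<close>, hence with every element \<open>f\<close> of \<open>I\<^bsub>i+1\<^esub>\<close>. Take for \<open>f\<close> a multiple of \<open>G\<close>, a form in
  \<open>x\<^sub>0, x\<^sub>1\<close> alone: its coefficients are constants, so comparing one of them yields a divisor of
  \<open>det (C i)\<close> itself.\<close>

lemma det_C_dvd:
  assumes i: "c + e \<le> Suc i"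
  shows "det (C (Suc i)) dvd det (C i)"
proof -
  let ?a = "Suc i"
  obtain M where M: "\<And>r. r \<le> ?a \<Longrightarrow> \<exists>\<sigma>. (\<sigma> = 1 \<or> \<sigma> = -1) \<and>
      det (C ?a) * det (submatrix M ({..<Suc ?a} - {r}) {..<?a}) = \<sigma> * w ?a r * det (C i)"
    by (rule syzygy_matrix[of i]) blast
  have dvd: "det (C ?a) dvd w ?a r * det (C i)" if r: "r \<le> ?a" for r
  proof -
    obtain \<sigma> where \<sigma>: "\<sigma> = 1 \<or> \<sigma> = -1"
      "det (C ?a) * det (submatrix M ({..<Suc ?a} - {r}) {..<?a}) = \<sigma> * w ?a r * det (C i)" using M[OF r] by blast
    have "w ?a r * det (C i) = det (C ?a) * (\<sigma> * det (submatrix M ({..<Suc ?a} - {r}) {..<?a}))"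
      using \<sigma> by auto
    then show ?thesis by (rule dvdI)
  qed
  define f where "f = cox_gen X10 ^ (?a - (c + e)) * G"
  have fI: "f \<in> I" unfolding f_def by (rule type_ideal_mult[OF id G_in])
  have "supported (\<lambda>\<epsilon>. xdeg \<epsilon> = ?a - (c + e) \<and> ydeg \<epsilon> = 0) (cox_gen X10 ^ (?a - (c + e)) :: 'k cox)"
    by (simp add: cox_gen_power supported_def xdeg_def ydeg_def lookup_single)
  then have fdeg: "supported (\<lambda>\<epsilon>. xdeg \<epsilon> = ?a \<and> ydeg \<epsilon> = 0) f"
    unfolding f_def by (rule supported_mult[OF _ bideg(3)]) (use i in \<open>simp add: additiveD additive_xdeg additive_ydeg\<close>)
  have fx: "homog xdeg ?a f" using fdeg by (rule supported_mono) auto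
  obtain r where "f = (\<Sum>k\<le>?a. r k * w ?a k)" using w_span[OF fI fx] by blast
  then have "f * det (C i) = (\<Sum>k\<le>?a. r k * (w ?a k * det (C i)))"
    by (simp only: sum_distrib_right mult.assoc)
  moreover have "det (C ?a) dvd (\<Sum>k\<le>?a. r k * (w ?a k * det (C i)))"
    by (intro dvd_sum dvd_mult dvd) (simp only: atMost_iff)
  ultimately have "det (C ?a) dvd f * det (C i)" by (simp only:)
  then obtain T where T: "f * det (C i) = det (C ?a) * T" by (auto elim: dvdE)
  define T' where "T' = gpart xdeg ?a T"
  have T': "det (C i) * f = det (C ?a) * T'"
  proof -
    have "det (C i) * f = gpart xdeg (0 + ?a) (det (C i) * f)"
      using homog_zero_mult[OF det_C_homog fx] by (simp add: part_supported)
    also have "\<dots> = gpart xdeg (0 + ?a) (det (C ?a) * T)" using T by (simp add: mult.commute)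
    also have "\<dots> = det (C ?a) * T'"
      unfolding T'_def by (rule gpart_mult_homog[OF additive_xdeg det_C_homog])
    finally show ?thesis .
  qed
  have "f \<noteq> 0"
  proof -
    obtain \<kappa> h where *: "\<kappa> \<noteq> 0" "G' = const \<kappa> * cox_gen X11 ^ e + cox_gen X10 * h"
      using G'(1) by (auto simp: monic_form_def)
    have "G' \<noteq> 0" unfolding *(2) by (rule monic_form_nonzero[OF *(1)]) simp
    then show ?thesis by (simp add: f_def G_def)
  qed
  then obtain s where s: "s \<le> ?a" "xcoeff ?a f s \<noteq> 0"
    using xcoeff(2)[OF fx] by (metis (no_types, lifting) atMost_iff mult_zero_left sum.neutral)
  have f_ydeg: "f = gpart ydeg 0 f" by (rule part_supported[symmetric]) (use fdeg in \<open>auto elim: supported_mono\<close>)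
  have "gpart ydeg 0 (\<Sum>t\<le>?a. xcoeff ?a f t * xmon ?a t) = (\<Sum>t\<le>?a. gpart ydeg 0 (xcoeff ?a f t) * xmon ?a t)"
    unfolding part_sum
  proof (rule sum.cong)
    fix t assume "t \<in> {..?a}"
    then have "homog ydeg 0 (xmon ?a t :: 'k cox)" using xmon_supported[of t ?a, where 'k = 'k] by (auto elim: supported_mono)
    from gpart_mult_homog[OF additive_ydeg this, of 0 "xcoeff ?a f t"]
    show "gpart ydeg 0 (xcoeff ?a f t * xmon ?a t) = gpart ydeg 0 (xcoeff ?a f t) * xmon ?a t"
      by (simp add: mult.commute)
  qed simp
  then have "f = (\<Sum>t\<le>?a. gpart ydeg 0 (xcoeff ?a f t) * xmon ?a t)"
    using f_ydeg xcoeff(2)[OF fx] by simp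
  then have "xcoeff ?a f s = gpart ydeg 0 (xcoeff ?a f s)"
    by (intro xcoeff_eqI[OF _ _ s(1)]) (use xcoeff(1)[OF fx] in \<open>auto intro: supported_partI\<close>)
  then have "homog ydeg 0 (xcoeff ?a f s)" using supported_part by metis
  then have "supported (\<lambda>\<epsilon>. xdeg \<epsilon> = 0 \<and> ydeg \<epsilon> = 0) (xcoeff ?a f s)"
    using xcoeff(1)[OF fx] by (auto simp: supported_def)
  then obtain \<gamma> where \<gamma>: "xcoeff ?a f s = const \<gamma>"
    by (rule y_form_split) (auto simp: supported_def)
  then have "\<gamma> \<noteq> 0" using s(2) by auto
  have single: "xcoeff ?a (q * h) s = q * xcoeff ?a h s" if "homog xdeg 0 q" "homog xdeg ?a h" for q h :: "'k cox"
    using xcoeff_sum[of "{()}" "\<lambda>_. q" ?a "\<lambda>_. h" s] that s(1) by simp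
  have T'_homog: "homog xdeg ?a T'" unfolding T'_def by (rule supported_part)
  have "det (C i) * const \<gamma> = xcoeff ?a (det (C i) * f) s" unfolding single[OF det_C_homog fx] \<gamma> ..
  also have "\<dots> = det (C ?a) * xcoeff ?a T' s" unfolding T' by (rule single[OF det_C_homog T'_homog])
  finally have "det (C i) * const \<gamma> = det (C ?a) * xcoeff ?a T' s" .
  then have *: "const (inverse \<gamma>) * (det (C i) * const \<gamma>) = const (inverse \<gamma>) * (det (C ?a) * xcoeff ?a T' s)"
    by (simp only:)
  have "det (C i) = const (inverse \<gamma>) * (det (C i) * const \<gamma>)"
    using const_inverse[OF \<open>\<gamma> \<noteq> 0\<close>] by (metis mult.assoc mult.commute mult_1_right)
  also have "\<dots> = det (C ?a) * (const (inverse \<gamma>) * xcoeff ?a T' s)"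
    unfolding * by (rule mult.left_commute)
  finally have "det (C i) = det (C ?a) * (const (inverse \<gamma>) * xcoeff ?a T' s)" .
  then show ?thesis by (rule dvdI)
qed

text \<open>The principal ideals of the determinants form an ascending chain from the degree \<open>c + e\<close> on.\<close>

lemma det_C_stable: "\<exists>n. \<forall>i\<ge>n. det (C i) dvd det (C (Suc i)) \<and> det (C (Suc i)) dvd det (C i)"
proof -
  define D where "D m = det (C (c + e + m))" for m
  have succ: "D (Suc m) dvd D m" for m unfolding D_def using det_C_dvd[of "c + e + m"] by simp
  have mono: "D n dvd D m" if "m \<le> n" for m n
    using that
  proof (induction rule: dec_induct)
    case (step k)
    from succ step.IH show ?case by (rule dvd_trans)
  qed simp
  obtain N where N: "\<And>m. D m \<in> Idl\<^bsub>cox_ring\<^esub> (D ` {..<N})"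
    using noetherian_sequence_stable[OF noetherian_cox, of D] by blast
  have "D N dvd D m" for m
  proof -
    obtain r where "D m = (\<Sum>i<N. r i * D i)" by (rule genideal_image_sum[OF N])
    moreover have "D N dvd (\<Sum>i<N. r i * D i)" by (intro dvd_sum dvd_mult mono) simp
    ultimately show ?thesis by (simp only:)
  qed
  note min = this
  have st: "D m dvd D (Suc m)" if "N \<le> m" for m using mono[OF that] min by (rule dvd_trans)
  have "det (C i) dvd det (C (Suc i)) \<and> det (C (Suc i)) dvd det (C i)" if "c + e + N \<le> i" for i
    using st[of "i - (c + e)"] det_C_dvd[of i] that by (simp add: D_def)
  then show ?thesis by blast
qed

text \<open>Above the \<open>x\<close>-degrees of bihomogeneous generators, the coefficients have positive \<open>x\<close>-degree,
  and \<open>x\<^sub>0\<close> or \<open>x\<^sub>1\<close> splits off every monomial.\<close>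

lemma generated_in_bounded_degree:
  "\<exists>n. \<forall>i\<ge>n. \<forall>f\<in>I. homog xdeg (Suc i) f \<longrightarrow>
     (\<exists>u\<in>I. \<exists>v\<in>I. homog xdeg i u \<and> homog xdeg i v \<and> f = cox_gen X10 * u + cox_gen X11 * v)"
proof -
  obtain H where H: "finite H" "H \<subseteq> I" "\<And>h. h \<in> H \<Longrightarrow> \<exists>j \<delta>. supported (\<lambda>\<epsilon>. xdeg \<epsilon> = j \<and> ydeg \<epsilon> = \<delta>) h"
    and span: "\<And>f. f \<in> I \<Longrightarrow> \<exists>r. f = (\<Sum>h\<in>H. r h * h)" by (rule homogeneous_generators) blast
  obtain j \<delta> where deg: "\<And>h. h \<in> H \<Longrightarrow> supported (\<lambda>\<epsilon>. xdeg \<epsilon> = j h \<and> ydeg \<epsilon> = \<delta> h) h" using H(3) by metis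
  have hh: "homog xdeg (j h) h" if "h \<in> H" for h using deg[OF that] by (rule supported_mono) auto
  define n where "n = (\<Sum>h\<in>H. j h)"
  have jn: "j h \<le> n" if "h \<in> H" for h unfolding n_def by (rule member_le_sum) (use that H(1) in auto)
  have "\<exists>u\<in>I. \<exists>v\<in>I. homog xdeg i u \<and> homog xdeg i v \<and> f = cox_gen X10 * u + cox_gen X11 * v"
    if i: "n \<le> i" and f: "f \<in> I" "homog xdeg (Suc i) f" for i f
  proof -
    obtain r where r: "f = (\<Sum>h\<in>H. r h * h)" using span[OF f(1)] by blast
    have split: "\<exists>u v. q = cox_gen X10 * u + cox_gen X11 * v" if q: "homog xdeg (Suc m) q" for m and q :: "'k cox"
    proof -
      have "supported (\<lambda>\<epsilon>. 1 \<le> Poly_Mapping.lookup \<epsilon> X10) (part (\<lambda>\<epsilon>. 1 \<le> Poly_Mapping.lookup \<epsilon> X10) q)"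
        by (rule supported_part)
      then obtain u where u: "part (\<lambda>\<epsilon>. 1 \<le> Poly_Mapping.lookup \<epsilon> X10) q = cox_gen X10 ^ 1 * u"
        unfolding var_power_factor by blast
      have "supported (\<lambda>\<epsilon>. 1 \<le> Poly_Mapping.lookup \<epsilon> X11) (part (\<lambda>\<epsilon>. \<not> 1 \<le> Poly_Mapping.lookup \<epsilon> X10) q)"
        using q by (auto simp: supported_def keys_part xdeg_def)
      then obtain v where v: "part (\<lambda>\<epsilon>. \<not> 1 \<le> Poly_Mapping.lookup \<epsilon> X10) q = cox_gen X11 ^ 1 * v"
        unfolding var_power_factor by blast
      show ?thesis using part_split[of "\<lambda>\<epsilon>. 1 \<le> Poly_Mapping.lookup \<epsilon> X10" q] u v by (metis power_one_right)
    qed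
    have "\<forall>h\<in>H. \<exists>u v. gpart xdeg (Suc i - j h) (r h) = cox_gen X10 * u + cox_gen X11 * v"
    proof
      fix h assume "h \<in> H"
      then have "Suc i - j h = Suc (i - j h)" using jn i by (simp add: Suc_diff_le order_trans[OF jn])
      then show "\<exists>u v. gpart xdeg (Suc i - j h) (r h) = cox_gen X10 * u + cox_gen X11 * v"
        using split[OF supported_part] by metis
    qed
    from bchoice[OF this] obtain u where "\<forall>h\<in>H. \<exists>v. gpart xdeg (Suc i - j h) (r h) = cox_gen X10 * u h + cox_gen X11 * v" ..
    from bchoice[OF this] obtain v where uv: "\<And>h. h \<in> H \<Longrightarrow> gpart xdeg (Suc i - j h) (r h) = cox_gen X10 * u h + cox_gen X11 * v h"
      by blast
    define U where "U = (\<Sum>h\<in>H. u h * h)"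
    define V where "V = (\<Sum>h\<in>H. v h * h)"
    have UV: "U \<in> I" "V \<in> I" unfolding U_def V_def
      by (intro type_ideal_sum[OF id] type_ideal_mult[OF id], use H(2) in blast)+
    have "f = gpart xdeg (Suc i) f" by (rule part_supported[OF f(2), symmetric])
    also have "\<dots> = (\<Sum>h\<in>H. gpart xdeg (Suc i) (h * r h))" unfolding r part_sum by (simp only: mult.commute)
    also have "\<dots> = (\<Sum>h\<in>H. cox_gen X10 * (u h * h) + cox_gen X11 * (v h * h))"
    proof (rule sum.cong)
      fix h assume h: "h \<in> H"
      have "Suc i = j h + (Suc i - j h)" using jn[OF h] i by simp
      then have "gpart xdeg (Suc i) (h * r h) = h * gpart xdeg (Suc i - j h) (r h)"
        using gpart_mult_homog[OF additive_xdeg hh[OF h], of "Suc i - j h" "r h"] by simp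
      then show "gpart xdeg (Suc i) (h * r h) = cox_gen X10 * (u h * h) + cox_gen X11 * (v h * h)"
        unfolding uv[OF h] by (simp add: algebra_simps)
    qed simp
    also have "\<dots> = cox_gen X10 * U + cox_gen X11 * V" by (simp add: U_def V_def sum.distrib sum_distrib_left)
    finally have "gpart xdeg (Suc i) f = gpart xdeg (1 + i) (cox_gen X10 * U + cox_gen X11 * V)" by simp
    then have "f = cox_gen X10 * gpart xdeg i U + cox_gen X11 * gpart xdeg i V"
      unfolding part_add gpart_mult_homog[OF additive_xdeg cox_x_homog(1)] gpart_mult_homog[OF additive_xdeg cox_x_homog(2)]
      using part_supported[OF f(2)] by simp
    moreover have "gpart xdeg i U \<in> I" "gpart xdeg i V \<in> I"
      using homogeneous_ideal_part[OF hom_ideal UV(1), of "\<lambda>x y. x = i"]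
        homogeneous_ideal_part[OF hom_ideal UV(2), of "\<lambda>x y. x = i"] by auto
    ultimately show ?thesis using supported_part by blast
  qed
  then show ?thesis by blast
qed

text \<open>For large \<open>a\<close> the determinants of \<open>C (a - 1)\<close> and \<open>C a\<close> are associated. Then the maximal
  minors of the syzygy matrix are unit multiples of the basis elements of \<open>I\<^sub>a\<close>, which generate
  the part of \<open>I\<close> of \<open>x\<close>-degree at least \<open>a\<close>.\<close>

theorem hilbert_burch:
  "\<exists>n. \<forall>a\<ge>n. \<exists>M \<in> carrier_mat (a + 1) a. Idl\<^bsub>cox_ring\<^esub> (minors a M) = J a"
proof -
  obtain n1 where n1: "\<And>i. n1 \<le> i \<Longrightarrow> det (C i) dvd det (C (Suc i)) \<and> det (C (Suc i)) dvd det (C i)"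
    using det_C_stable by blast
  obtain n2 where n2: "\<And>i f. n2 \<le> i \<Longrightarrow> f \<in> I \<Longrightarrow> homog xdeg (Suc i) f \<Longrightarrow>
     \<exists>u\<in>I. \<exists>v\<in>I. homog xdeg i u \<and> homog xdeg i v \<and> f = cox_gen X10 * u + cox_gen X11 * v"
    using generated_in_bounded_degree by blast
  have "\<exists>M \<in> carrier_mat (a + 1) a. Idl\<^bsub>cox_ring\<^esub> (minors a M) = J a" if a: "Suc (n1 + n2) \<le> a" for a
  proof -
    obtain i where i: "a = Suc i" "n1 \<le> i" using a by (cases a) auto
    obtain M where M: "M \<in> carrier_mat (Suc a) a"
      "\<And>r. r \<le> a \<Longrightarrow> \<exists>\<sigma>. (\<sigma> = 1 \<or> \<sigma> = -1) \<and>
        det (C a) * det (submatrix M ({..<Suc a} - {r}) {..<a}) = \<sigma> * w a r * det (C i)"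
      unfolding i(1) by (rule syzygy_matrix[of i]) blast
    obtain \<mu> \<nu> where \<mu>: "det (C i) = det (C a) * \<mu>" and \<nu>: "det (C a) = det (C i) * \<nu>"
      using n1[OF i(2)] unfolding i(1) dvd_def by blast
    have "det (C i) * 1 = det (C a) * \<mu>" using \<mu> by (simp only: mult_1_right)
    also have "\<dots> = det (C i) * (\<mu> * \<nu>)" unfolding \<nu> by (simp only: mult_ac)
    finally have "det (C i) * (\<mu> * \<nu>) = det (C i) * 1" ..
    then have \<mu>\<nu>: "\<mu> * \<nu> = 1" using det_C[of i] by simp
    have minor: "\<exists>\<sigma>. (\<sigma> = 1 \<or> \<sigma> = -1) \<and> det (submatrix M ({..<Suc a} - {r}) {..<a}) = \<sigma> * \<mu> * w a r"
      if r: "r \<le> a" for r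
    proof -
      obtain \<sigma> where \<sigma>: "\<sigma> = 1 \<or> \<sigma> = -1"
        "det (C a) * det (submatrix M ({..<Suc a} - {r}) {..<a}) = \<sigma> * w a r * det (C i)" using M(2)[OF r] by blast
      have "det (C a) * det (submatrix M ({..<Suc a} - {r}) {..<a}) = det (C a) * (\<sigma> * \<mu> * w a r)"
        unfolding \<sigma>(2) by (subst \<mu>) (simp only: mult_ac)
      then have "det (submatrix M ({..<Suc a} - {r}) {..<a}) = \<sigma> * \<mu> * w a r"
        unfolding mult_cancel_left using det_C[of a] by blast
      then show ?thesis using \<sigma>(1) by blast
    qed
    let ?K = "Idl\<^bsub>cox_ring\<^esub> (minors a M)"
    have K: "ideal ?K cox_ring" by (rule genideal_type_ideal)
    have wJ: "w a r \<in> J a" if "r \<le> a" for r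
      using w_in[OF that] w_homog[OF that] by (auto simp: xpower_def supported_def)
    have "?K \<subseteq> J a"
    proof (rule genideal_mono_type[OF J_ideal])
      show "minors a M \<subseteq> J a"
      proof
        fix q assume "q \<in> minors a M"
        then obtain r where r: "r \<le> a" "q = det (submatrix M ({..<Suc a} - {r}) {..<a})"
          unfolding maximal_minors[OF M(1)] by blast
        then obtain \<sigma> where "q = \<sigma> * \<mu> * w a r" using minor by blast
        then show "q \<in> J a" using type_ideal_mult[OF J_ideal wJ[OF r(1)]] by (simp only:)
      qed
    qed
    moreover have "J a \<subseteq> ?K"
    proof
      have wK: "w a r \<in> ?K" if r: "r \<le> a" for r
      proof -
        obtain \<sigma> where \<sigma>: "\<sigma> = 1 \<or> \<sigma> = -1" "det (submatrix M ({..<Suc a} - {r}) {..<a}) = \<sigma> * \<mu> * w a r"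
          using minor[OF r] by blast
        have "det (submatrix M ({..<Suc a} - {r}) {..<a}) \<in> ?K"
          using genideal_type_self maximal_minors[OF M(1)] r by blast
        then have "(\<sigma> * \<nu>) * (\<sigma> * \<mu> * w a r) \<in> ?K" unfolding \<sigma>(2) by (rule type_ideal_mult[OF K])
        moreover have "(\<sigma> * \<nu>) * (\<sigma> * \<mu> * w a r) = (\<sigma> * \<sigma>) * (\<mu> * \<nu>) * w a r" by (simp only: mult_ac)
        moreover have "\<sigma> * \<sigma> = 1" using \<sigma>(1) by auto
        ultimately show ?thesis using \<mu>\<nu> by simp
      qed
      have piece: "f \<in> ?K" if "f \<in> I" "homog xdeg m f" "a \<le> m" for f m
        using that(3,1,2)
      proof (induction m arbitrary: f rule: dec_induct)
        case base
        then obtain r where "f = (\<Sum>k\<le>a. r k * w a k)" using w_span by blast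
        then show ?case using wK by (auto intro!: type_ideal_sum[OF K] type_ideal_mult[OF K])
      next
        case (step m)
        then obtain u v where "u \<in> I" "v \<in> I" "homog xdeg m u" "homog xdeg m v" "f = cox_gen X10 * u + cox_gen X11 * v"
          using n2[of m f] a by auto
        then show ?case using step.IH by (auto intro!: type_ideal_add[OF K] type_ideal_mult[OF K])
      qed
      fix f assume f: "f \<in> J a"
      obtain n where n: "below xdeg n f" using below_exists by blast
      have "f = (\<Sum>m<n. gpart xdeg m f)" by (rule below_decompose[OF n])
      also have "\<dots> \<in> ?K"
      proof (rule type_ideal_sum[OF K])
        fix m
        show "gpart xdeg m f \<in> ?K"
        proof (cases "a \<le> m")
          case True
          then show ?thesis
            using piece homogeneous_ideal_part[OF hom_ideal, of f "\<lambda>x y. x = m"] f supported_part by blast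
        next
          case False
          then show ?thesis using f type_ideal_zero[OF K] by (simp add: xpower_below)
        qed
      qed
      finally show "f \<in> ?K" .
    qed
    ultimately have "?K = J a" by blast
    then show ?thesis using M(1) by (intro bexI[of _ M]) auto
  qed
  then show ?thesis by blast
qed

end

lemma xpower_1: "xpower 1 = Idl\<^bsub>cox_ring\<^esub> {cox_gen X10, cox_gen X11 :: 'k::field cox}"
proof
  let ?K = "Idl\<^bsub>cox_ring\<^esub> {cox_gen X10, cox_gen X11 :: 'k cox}"
  show "?K \<subseteq> xpower 1"
    by (rule genideal_mono_type[OF xpower_ideal]) (simp add: xpower_def cox_gen_def supported_def xdeg_def)
  note K = genideal_type_ideal[of "{cox_gen X10, cox_gen X11 :: 'k cox}"]
  have "cox_gen X10 ^ 1 \<in> ?K" "cox_gen X11 ^ 1 \<in> ?K"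
    using genideal_type_self[of "{cox_gen X10, cox_gen X11 :: 'k cox}"] by auto
  note gen = this
  show "xpower 1 \<subseteq> ?K"
  proof
    fix f :: "'k cox" assume f: "f \<in> xpower 1"
    have "Poly_Mapping.single \<epsilon> q \<in> ?K" if \<epsilon>: "1 \<le> xdeg \<epsilon>" for \<epsilon> q
    proof -
      consider "1 \<le> Poly_Mapping.lookup \<epsilon> X10" | "1 \<le> Poly_Mapping.lookup \<epsilon> X11"
        using \<epsilon> unfolding xdeg_def by linarith
      then show ?thesis
      proof cases
        case 1 show ?thesis unfolding monomial_var_power[OF 1] by (rule type_ideal_mult_right[OF K gen(1)])
      next
        case 2 show ?thesis unfolding monomial_var_power[OF 2] by (rule type_ideal_mult_right[OF K gen(2)])
      qed
    qed
    then have "(\<Sum>\<epsilon>\<in>Poly_Mapping.keys f. Poly_Mapping.single \<epsilon> (Poly_Mapping.lookup f \<epsilon>)) \<in> ?K"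
      using f by (intro type_ideal_sum[OF K]) (auto simp: xpower_def supported_def)
    then show "f \<in> ?K" by (simp only: sum_monomials)
  qed
qed

text \<open>Taking the part of \<open>x\<close>-degree \<open>0\<close> is a ring homomorphism to the domain \<open>k[y\<^sub>0, y\<^sub>1]\<close> with
  kernel \<open>xpower 1\<close>.\<close>

lemma radical_xpower:
  assumes "a > 0"
  shows "radical_of cox_ring (xpower a) = Idl\<^bsub>cox_ring\<^esub> {cox_gen X10, cox_gen X11 :: 'k::field cox}"
proof -
  have "f \<in> xpower 1" if f: "f ^ n \<in> xpower a" for f :: "'k cox" and n
  proof -
    let ?f0 = "gpart xdeg 0 f"
    have top: "gpart xdeg 0 (f ^ n) = ?f0 ^ n"
    proof (induction n)
      case 0
      have "homog xdeg 0 (1 :: 'k cox)" by (simp add: supported_def xdeg_def)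
      then show ?case by (simp only: power_0 part_supported)
    next
      case (Suc n)
      have "f * f ^ n = ?f0 * f ^ n + part (\<lambda>\<epsilon>. xdeg \<epsilon> \<noteq> 0) f * f ^ n"
        using part_split[of "\<lambda>\<epsilon>. xdeg \<epsilon> = 0" f] by (metis distrib_right)
      moreover have "gpart xdeg 0 (part (\<lambda>\<epsilon>. xdeg \<epsilon> \<noteq> 0) f * f ^ n) = 0"
      proof (rule part_supported_none)
        show "supported (\<lambda>\<epsilon>. xdeg \<epsilon> \<noteq> 0) (part (\<lambda>\<epsilon>. xdeg \<epsilon> \<noteq> 0) f * f ^ n)"
          by (rule supported_mult[OF supported_part, of "\<lambda>_. True"])
             (auto simp: additiveD[OF additive_xdeg] supported_def)
      qed simp
      moreover have "gpart xdeg (0 + 0) (?f0 * f ^ n) = ?f0 * gpart xdeg 0 (f ^ n)"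
        by (rule gpart_mult_homog[OF additive_xdeg supported_part])
      ultimately show ?case using Suc by (simp add: part_add)
    qed
    have "gpart xdeg 0 (f ^ n) = 0" using f assms by (simp add: xpower_below)
    then have "?f0 = 0" using top by simp
    then show ?thesis by (simp add: xpower_below)
  qed
  moreover have "f ^ a \<in> xpower a" if "f \<in> xpower 1" for f :: "'k cox"
  proof (induction a)
    case 0 show ?case by (simp add: xpower_def supported_def)
  next
    case (Suc n)
    have "supported (\<lambda>e. Suc n \<le> xdeg e) (f * f ^ n)"
    proof (rule supported_mult)
      show "supported (\<lambda>e. 1 \<le> xdeg e) f" using that by (simp add: xpower_def)
      show "supported (\<lambda>e. n \<le> xdeg e) (f ^ n)" using Suc by (simp add: xpower_def)
      show "Suc n \<le> xdeg (\<alpha> + \<beta>)" if "1 \<le> xdeg \<alpha>" "n \<le> xdeg \<beta>" for \<alpha> \<beta>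
        using that additiveD[OF additive_xdeg, of \<alpha> \<beta>] by simp
    qed
    then show ?case by (simp add: xpower_def)
  qed
  ultimately show ?thesis unfolding xpower_1[symmetric] radical_of_def by auto
qed

theorem corollary4p2:
  fixes Z :: "cox_var set \<Rightarrow> 'k::field laurent set"
    and I :: "'k cox set"
  assumes "closed_subscheme Z"
    and "subscheme_dim Z = 0"
    and "is_saturated_ideal_of I Z"
  shows "\<exists>Q. ideal Q cox_ring \<and>
           radical_of cox_ring Q = Idl\<^bsub>cox_ring\<^esub> {cox_gen X10, cox_gen X11} \<and>
           cohen_macaulay (cox_ring Quot (I \<inter> Q)) \<and>
           (\<exists>m. \<exists>M \<in> carrier_mat (m + 1) m. Idl\<^bsub>cox_ring\<^esub> (minors m M) = I \<inter> Q)"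
proof -
  have hom: "homogeneous_ideal I" and sat: "saturation cox_ring I irrelevant_ideal = I"
    using assms(3) by (auto simp: is_saturated_ideal_of_def)
  then have id: "ideal I cox_ring" by (simp add: homogeneous_ideal_def)
  obtain b d F' where F': "d > 0" "monic_form X20 X21 d F'" "cox_gen X20 ^ b * F' \<in> I"
    by (rule zero_dimensional_forms[OF assms, of X20 X21]) auto
  obtain c e G' where G': "e > 0" "monic_form X10 X11 e G'" "cox_gen X10 ^ c * G' \<in> I"
    by (rule zero_dimensional_forms[OF assms, of X10 X11]) auto
  interpret saturated_points I F' G' b c d e
    by unfold_locales (use hom F' G' saturated_cancel[OF id sat] in blast)+
  obtain n where n: "\<And>a. n \<le> a \<Longrightarrow> \<exists>M \<in> carrier_mat (a + 1) a. Idl\<^bsub>cox_ring\<^esub> (minors a M) = J a"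
    using hilbert_burch by blast
  define a where "a = n + N\<^sub>0 + 1"
  have "ideal (xpower a :: 'k cox set) cox_ring" by (rule xpower_ideal)
  moreover have "radical_of cox_ring (xpower a) = Idl\<^bsub>cox_ring\<^esub> {cox_gen X10, cox_gen X11 :: 'k cox}"
    by (rule radical_xpower) (simp add: a_def)
  moreover have "cohen_macaulay (cox_ring Quot J a)" by (rule quotient_cohen_macaulay) (simp_all add: a_def)
  moreover have "\<exists>M \<in> carrier_mat (a + 1) a. Idl\<^bsub>cox_ring\<^esub> (minors a M) = J a" by (rule n) (simp add: a_def)
  ultimately show ?thesis by blast
qed

end
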